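(* Let $\{X(p)\}_{p\text{ prime}}$ be independent random variables uniformly distributed on the unit circle, let $L(1,X)=\lim_{y\to\infty}\prod_{p\leq y}(1-X(p)/p)^{-1}$, and for $\tau,\theta>0$ let $$\Phi(\tau,\theta)=\mathrm{Prob}\big(|L(1,X)|>e^{\gamma}\tau,\ |\arg L(1,X)|>\theta\big).$$ Fix $\theta_0>0$. Then for $\tau$ large and $(\log\tau)\sqrt{\log_2\tau/\tau}<\theta\leq\theta_0$, $$\Phi(\tau,\theta)=\exp\left(-\frac{1}{\tau}\exp\left(\tau+\frac{\theta^2\tau}{2\log\tau}+O\left(\frac{\theta^2\tau}{\log^2\tau}\right)\right)\right).$$
   Context: $\gamma$ is Euler's constant, $\log_2=\log\log$. The product defining $L(1,X)$ converges with probability $1$, and $\arg L(1,X)$ denotes $\mathrm{Im}\sum_p -\log(1-X(p)/p)$ with principal logarithms (equivalently $\mathrm{Im}\sum_{p}\sum_{k\ge1}X(p)^k/(kp^k)$). Implied constants may depend on $\theta_0$. *)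

theory Defs
  imports "HOL-Probability.Probability" "HOL-Computational_Algebra.Primes"
begin

definition circle_uniform :: "complex measure" where
  "circle_uniform = distr (uniform_measure lborel {0..<2 * pi}) borel cis"

text \<open>\<^const>\<open>prob_space.indep_vars\<close> includes measurability of the \<open>X p\<close>. Values of \<open>X\<close> at
  non-prime indices are irrelevant.\<close>

definition steinhaus_family :: "'a measure \<Rightarrow> (nat \<Rightarrow> 'a \<Rightarrow> complex) \<Rightarrow> bool" where
  "steinhaus_family M X \<longleftrightarrow>
     prob_space M \<and>
     prob_space.indep_vars M (\<lambda>_. borel) X {p. prime p} \<and>
     (\<forall>p. prime p \<longrightarrow> distr M borel (X p) = circle_uniform)"

text \<open>The Euler product and the sum of logarithms converge only conditionally (and almost surely),
  so both are limits over primes up to \<open>y\<close>. Off the almost sure set of convergence, \<^const>\<open>lim\<close>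
  takes one fixed unspecified value, so the events below remain measurable and their probabilities
  do not depend on it.\<close>

definition L1 :: "(nat \<Rightarrow> 'a \<Rightarrow> complex) \<Rightarrow> 'a \<Rightarrow> complex" where
  "L1 X \<omega> = lim (\<lambda>y. \<Prod>p | prime p \<and> p \<le> y. inverse (1 - X p \<omega> / of_nat p))"

text \<open>The argument is the one obtained by summing principal logarithms; it is not reduced modulo
  \<open>2 * pi\<close> and so is in general not the principal argument of \<^const>\<open>L1\<close>.\<close>

definition arg_L1 :: "(nat \<Rightarrow> 'a \<Rightarrow> complex) \<Rightarrow> 'a \<Rightarrow> real" where
  "arg_L1 X \<omega> = Im (lim (\<lambda>y. \<Sum>p | prime p \<and> p \<le> y. - Ln (1 - X p \<omega> / of_nat p)))"

definition Phi :: "'a measure \<Rightarrow> (nat \<Rightarrow> 'a \<Rightarrow> complex) \<Rightarrow> real \<Rightarrow> real \<Rightarrow> real" where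
  "Phi M X \<tau> \<theta> =
     measure M {\<omega> \<in> space M. cmod (L1 X \<omega>) > exp euler_mascheroni * \<tau> \<and> \<bar>arg_L1 X \<omega>\<bar> > \<theta>}"

end

theory Submission
  imports Defs "HOL-Number_Theory.Number_Theory" "HOL-Real_Asymp.Real_Asymp" "HOL-Library.Log_Nat"
    "HOL-Complex_Analysis.Cauchy_Integral_Theorem"
begin

text \<open>Write \<open>l = ln \<tau>\<close>. To reach \<open>\<bar>L(1,X)\<bar> > e\<^sup>\<gamma> \<tau>\<close> and \<open>arg L(1,X) > \<theta>\<close> most cheaply, all \<open>X(p)\<close> with \<open>p \<le> N\<close> point in a
  common direction \<open>\<phi>\<close>. By Mertens' theorems the argument is then about \<open>\<phi> ln ln N\<close>, forcing \<open>\<phi> = \<theta>/l\<close>, and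
  the logarithm of the modulus is about \<open>\<gamma> + ln ln N - (\<phi>\<^sup>2/2) ln ln N\<close>, forcing \<open>ln N = \<tau> + \<theta>\<^sup>2\<tau>/(2l)\<close> up to
  \<open>O(\<theta>\<^sup>2\<tau>/l\<^sup>2)\<close>. The lower bound for \<open>\<Phi>\<close> is the probability that every \<open>X(p)\<close> with \<open>p \<le> N\<close> lies
  in an arc of length \<open>\<phi>/l\<close> at \<open>\<phi>\<close>, which is at least \<open>\<tau>\<^sup>-\<^sup>2\<close> to the number of these primes, times the probability that the tail over \<open>p > N\<close> is negligible. For the upper bound
  consider the single linear functional \<open>Re + (\<theta>/l) Im\<close> of \<open>log L(1,X)\<close>: the primes \<open>p \<le> N\<close> contribute at most
  the deterministic maximum, which for \<open>N\<close> slightly smaller than above misses the required value by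
  \<open>1/\<tau>\<close>, and Hoeffding's inequality bounds the probability that the tail makes up for it. The lower bound
  on \<open>\<theta>\<close> makes the permitted error at least \<open>ln l\<close>, which absorbs all constants and powers of \<open>l\<close>.\<close>

section \<open>Chebyshev's bound\<close>

text \<open>An additive error \<open>h\<close> in the logarithm of the modulus is a relative error
  \<open>h\<close> in \<open>ln N\<close>, hence an error \<open>h * \<tau>\<close> in the final
  exponent. With \<open>d = \<theta>^2 / l^2\<close> the exponent may be off by a multiple of
  \<open>d * \<tau>\<close>, and \<open>d\<close> may be as small as \<open>ln l / \<tau>\<close>.
  So Mertens' product is needed with its exact constant and with error \<open>O(1 / ln N)\<close>;
  asymptotic equality would be too weak. The other sums over primes enter multiplied by a squared
  angle or by a sine, where \<open>O(1)\<close> suffices. The slope \<open>\<theta> / l\<close> is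
  the Lagrange multiplier of the extremal problem: for it the best common direction is
  \<open>\<phi>\<close> to first order, so both bounds meet up to \<open>O(d)\<close>. The prefactor
  \<open>1 / \<tau>\<close> has two sources: in the lower bound the number of primes, of order
  \<open>N / ln N\<close>; in the upper bound a deviation \<open>1 / \<tau>\<close> against a tail
  variance of order \<open>1 / (N * ln N)\<close>, whose cost \<open>N * ln N / \<tau>^2\<close> has
  the same order. Hoeffding's inequality is applied to the linear series of \<open>X(p) / p\<close>,
  whose terms are bounded and centred; passing to logarithms costs only
  \<open>O(1 / N)\<close>.\<close>

lemma abel_summation:
  fixes A g :: "nat \<Rightarrow> real"
  assumes "m \<le> n"
  shows "(\<Sum>k\<in>{m<..n}. (A k - A (k - 1)) * g k) =
    A n * g (Suc n) - A m * g (Suc m) + (\<Sum>k\<in>{m<..n}. A k * (g k - g (Suc k)))"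
  using assms
proof (induction n rule: dec_induct)
  case (step n)
  have "{m<..Suc n} = insert (Suc n) {m<..n}" using step by auto
  then show ?case using step by (simp add: algebra_simps)
qed simp

lemma telescope_Ioc:
  fixes g :: "nat \<Rightarrow> real"
  assumes "m \<le> n"
  shows "(\<Sum>k\<in>{m<..n}. g k - g (Suc k)) = g (Suc m) - g (Suc n)"
  using assms
proof (induction n rule: dec_induct)
  case (step n)
  have "{m<..Suc n} = insert (Suc n) {m<..n}" using step by auto
  then show ?case using step by simp
qed simp

text \<open>Against decreasing weights only the size of \<open>R\<close> matters, not that of its
  increments. What the telescoped sum saves at \<open>n\<close> pays for the boundary term there, so
  the bound depends on \<open>m\<close> alone; this makes the sums in Mertens' second theorem
  Cauchy.\<close>

lemma abel_bound:
  fixes R g :: "nat \<Rightarrow> real"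
  assumes "m \<le> n" and R: "\<And>k. \<bar>R k\<bar> \<le> K"
    and g: "\<And>k. k > m \<Longrightarrow> g (Suc k) \<le> g k" "\<And>k. k > m \<Longrightarrow> g k \<ge> 0"
  shows "\<bar>\<Sum>k\<in>{m<..n}. (R k - R (k - 1)) * g k\<bar> \<le> 2 * K * g (Suc m)"
proof -
  have b: "\<bar>R k * x\<bar> \<le> K * x" if "x \<ge> 0" for k x
    using that R[of k] by (simp add: abs_mult mult_right_mono)
  have "\<bar>\<Sum>k\<in>{m<..n}. R k * (g k - g (Suc k))\<bar> \<le> (\<Sum>k\<in>{m<..n}. K * (g k - g (Suc k)))"
    using g by (intro order_trans[OF sum_abs] sum_mono b) auto
  also have "\<dots> = K * (g (Suc m) - g (Suc n))"
    using telescope_Ioc[OF assms(1), of g] by (simp flip: sum_distrib_left)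
  finally show ?thesis
    using b[of "g (Suc n)" n] b[of "g (Suc m)" m] g(2)[of "Suc n"] g(2)[of "Suc m"] assms(1)
    unfolding abel_summation[OF assms(1)] by (simp add: algebra_simps)
qed

section \<open>Sums over the primes up to \<open>n\<close> and over those in
  \<open>(m, n]\<close>\<close>

definition primes_le :: "nat \<Rightarrow> nat set" where
  "primes_le n = {p. prime p \<and> p \<le> n}"

definition primes_between :: "nat \<Rightarrow> nat \<Rightarrow> nat set" where
  "primes_between m n = {p. prime p \<and> m < p \<and> p \<le> n}"

lemma finite_primes_le [simp, intro]: "finite (primes_le n)"
  by (rule finite_subset[of _ "{..n}"]) (auto simp: primes_le_def)

lemma finite_primes_between [simp, intro]: "finite (primes_between m n)"
  by (rule finite_subset[of _ "{..n}"]) (auto simp: primes_between_def)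

lemma primes_le_split:
  "m \<le> n \<Longrightarrow> primes_le n = primes_le m \<union> primes_between m n"
  "primes_le m \<inter> primes_between m n = {}"
  by (auto simp: primes_le_def primes_between_def)

lemma sum_primes_le_split:
  fixes f :: "nat \<Rightarrow> 'a :: comm_monoid_add"
  shows "m \<le> n \<Longrightarrow> sum f (primes_le n) = sum f (primes_le m) + sum f (primes_between m n)"
  unfolding primes_le_split(1)[of m n] by (rule sum.union_disjoint) (auto simp: primes_le_split)

lemma primes_le_Suc:
  "primes_le (Suc n) = (if prime (Suc n) then insert (Suc n) (primes_le n) else primes_le n)"
  by (auto simp: primes_le_def le_Suc_eq)

lemma primes_le_0 [simp]: "primes_le 0 = {}"
  and primes_le_1 [simp]: "primes_le (Suc 0) = {}"
  by (auto simp: primes_le_def dest: prime_gt_0_nat prime_gt_1_nat)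

lemma sum_primes_between_conv:
  fixes f :: "nat \<Rightarrow> 'a :: comm_monoid_add"
  shows "sum f (primes_between m n) = (\<Sum>k\<in>{m<..n}. if prime k then f k else 0)"
  by (intro sum.mono_neutral_cong_left) (auto simp: primes_between_def)

lemma primes_leD:
  assumes "p \<in> primes_le n" shows "prime p" "p \<le> n" "2 \<le> p"
  using assms prime_ge_2_nat by (auto simp: primes_le_def)

lemma primes_betweenD:
  assumes "p \<in> primes_between m n" shows "prime p" "m < p" "p \<le> n" "2 \<le> p"
  using assms prime_ge_2_nat by (auto simp: primes_between_def)

section \<open>Chebyshev's upper bound by central binomial coefficients\<close>

definition chebyshev_theta :: "nat \<Rightarrow> real" where
  "chebyshev_theta n = (\<Sum>p\<in>primes_le n. ln (real p))"

text \<open>The entries at \<open>m\<close> and \<open>m + 1\<close> of this odd row are equal and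
  together at most the row sum \<open>2 ^ (2 * m + 1)\<close>.\<close>

lemma central_binomial_le: "(2 * m + 1) choose m \<le> 4 ^ m"
proof -
  have "((2 * m + 1) choose m) + ((2 * m + 1) choose (m + 1)) =
      (\<Sum>k\<in>{m, m + 1}. (2 * m + 1) choose k)" by simp
  also have "\<dots> \<le> (\<Sum>k\<le>2 * m + 1. (2 * m + 1) choose k)"
    by (intro sum_mono2) auto
  also have "\<dots> = 2 ^ (2 * m + 1)" by (rule choose_row_sum)
  finally show ?thesis
    using binomial_symmetric[of m "2 * m + 1"] by (simp add: power_mult)
qed

lemma prod_primes_dvd:
  fixes n :: nat
  assumes "finite S" "\<And>p. p \<in> S \<Longrightarrow> prime p" "\<And>p. p \<in> S \<Longrightarrow> p dvd n"
  shows "\<Prod>S dvd n"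
  using assms
proof (induction S rule: finite_induct)
  case (insert p S)
  have "coprime p (\<Prod>S)"
    using insert by (intro prod_coprime_right) (auto intro!: primes_coprime)
  then show ?case using insert by (simp add: divides_mult)
qed simp

text \<open>A prime in \<open>(m + 1, 2 * m + 1]\<close> divides the factorial on top of the
  binomial coefficient but neither factorial below, so the product of all these primes divides a
  number that is at most \<open>4 ^ m\<close>.\<close>

lemma theta_odd_step: "chebyshev_theta (2 * m + 1) \<le> chebyshev_theta (m + 1) + real m * ln 4"
proof -
  let ?Q = "primes_between (m + 1) (2 * m + 1)"
  have "\<Prod>?Q dvd ((2 * m + 1) choose m)"
  proof (rule prod_primes_dvd)
    fix p assume "p \<in> ?Q"
    then have p: "prime p" "m + 1 < p" "p \<le> 2 * m + 1" by (auto dest: primes_betweenD)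
    have "p dvd fact (2 * m + 1)" using p by (simp add: prime_dvd_fact_iff del: fact_Suc)
    also have "fact (2 * m + 1) = fact m * fact (m + 1) * ((2 * m + 1) choose m)"
      using binomial_fact_lemma[of m "2 * m + 1"] by simp
    finally show "p dvd ((2 * m + 1) choose m)"
      using p by (simp add: prime_dvd_mult_iff prime_dvd_fact_iff del: fact_Suc binomial_Suc_Suc)
  qed (auto dest: primes_betweenD)
  then have "\<Prod>?Q \<le> 4 ^ m"
    using central_binomial_le[of m] dvd_imp_le[of "\<Prod>?Q" "(2 * m + 1) choose m"] by (simp del: binomial_Suc_Suc)
  then have "real (\<Prod>?Q) \<le> 4 ^ m" by (metis of_nat_le_iff of_nat_numeral of_nat_power)
  moreover have pos: "\<And>p. p \<in> ?Q \<Longrightarrow> 0 < real p" by (auto dest: primes_betweenD)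
  ultimately have "ln (\<Prod>p\<in>?Q. real p) \<le> ln (4 ^ m)"
    by (subst ln_le_cancel_iff) (auto intro: prod_pos)
  then have "(\<Sum>p\<in>?Q. ln (real p)) \<le> real m * ln 4"
    using pos by (subst (asm) ln_prod) (auto simp: ln_realpow)
  then show ?thesis
    unfolding chebyshev_theta_def by (subst sum_primes_le_split[of "m + 1"]) auto
qed

text \<open>Erdos' induction: an even \<open>n > 2\<close> is not prime and inherits the bound from
  \<open>n - 1\<close>; an odd \<open>n = 2 * m + 1\<close> uses the bound at \<open>m + 1\<close>,
  and the contributions \<open>m + 1\<close> and \<open>m\<close> add up to exactly
  \<open>n\<close>.\<close>

lemma theta_le: "chebyshev_theta n \<le> real n * ln 4"
proof (induction n rule: less_induct)
  case (less n)
  consider "n \<le> 1" | "n = 2" | "n > 2" "even n" | m where "n = 2 * m + 1" "m \<ge> 1"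
  proof (cases "even n")
    case False
    then obtain m where "n = 2 * m + 1" by (auto elim: oddE)
    then show ?thesis using that(1) that(4)[of m] by (cases "m = 0") auto
  qed (use that in force)
  then show ?case
  proof cases
    case 1
    then have "n = 0 \<or> n = Suc 0" by auto
    then show ?thesis by (auto simp: chebyshev_theta_def)
  next
    case 2
    have "primes_le 2 = {2}" by (auto simp: primes_le_def dest: prime_ge_2_nat)
    have "ln 2 \<le> ln (4 :: real)" by (subst ln_le_cancel_iff) auto
    moreover have "ln 4 > (0 :: real)" by (rule ln_gt_zero) simp
    ultimately have "ln 2 \<le> 2 * ln (4 :: real)" by linarith
    then show ?thesis using 2 \<open>primes_le 2 = {2}\<close> by (simp only: chebyshev_theta_def) simp
  next
    case 3
    then have "\<not> prime n" using prime_odd_nat by auto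
    then have "primes_le n = primes_le (n - 1)" using 3 primes_le_Suc[of "n - 1"] by simp
    then have "chebyshev_theta n = chebyshev_theta (n - 1)" by (simp add: chebyshev_theta_def)
    also have "\<dots> \<le> real (n - 1) * ln 4" using 3 by (intro less) auto
    also have "\<dots> \<le> real n * ln 4" by (intro mult_right_mono) auto
    finally show ?thesis .
  next
    case 4
    have "chebyshev_theta n \<le> real (m + 1) * ln 4 + real m * ln 4"
      using theta_odd_step[of m] less[of "m + 1"] 4 by auto
    then show ?thesis using 4 by (simp add: algebra_simps)
  qed
qed

lemma theta_nonneg: "0 \<le> chebyshev_theta n"
  unfolding chebyshev_theta_def by (intro sum_nonneg) (auto dest!: primes_leD)

text \<open>Legendre's formula one step at a time: only the factors \<open>p * j\<close> of the
  factorial count, and each counts once more than \<open>j\<close>. The recursion gives the lower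
  bound \<open>n div p\<close> at once and the upper bound \<open>n / (p - 1)\<close> by
  induction.\<close>

lemma multiplicity_fact_recursion:
  assumes "prime p"
  shows "multiplicity p (fact n :: nat) = n div p + multiplicity p (fact (n div p) :: nat)"
proof -
  have mf: "multiplicity p (fact n :: nat) = (\<Sum>i\<in>{1..n}. multiplicity p i)" for n
    unfolding fact_prod
    using assms by (subst of_nat_id, subst prime_elem_multiplicity_prod_distrib) auto
  have p: "p > 0" using assms prime_gt_0_nat by auto
  have "(\<Sum>i\<in>{1..n}. multiplicity p i) = (\<Sum>i\<in>(\<lambda>j. p * j) ` {1..n div p}. multiplicity p i)"
  proof (intro sum.mono_neutral_right)
    show "\<forall>i\<in>{1..n} - (\<lambda>j. p * j) ` {1..n div p}. multiplicity p i = 0"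
    proof
      fix i assume i: "i \<in> {1..n} - (\<lambda>j. p * j) ` {1..n div p}"
      have "\<not> p dvd i"
      proof
        assume "p dvd i"
        then obtain j where j: "i = p * j" by auto
        then have "j \<in> {1..n div p}"
          using i p by (auto simp: less_eq_div_iff_mult_less_eq mult.commute intro!: Suc_leI gr0I)
        then show False using i j by auto
      qed
      then show "multiplicity p i = 0" by (rule not_dvd_imp_multiplicity_0)
    qed
  qed (use p in \<open>auto simp: less_eq_div_iff_mult_less_eq mult.commute\<close>)
  also have "\<dots> = (\<Sum>j\<in>{1..n div p}. Suc (multiplicity p j))"
    using p assms by (subst sum.reindex) (auto simp: inj_on_def intro!: sum.cong multiplicity_times_same)
  also have "\<dots> = n div p + (\<Sum>j\<in>{1..n div p}. multiplicity p j)"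
    by (simp only: Suc_eq_plus1_left sum.distrib) simp
  finally show ?thesis unfolding mf .
qed

lemma multiplicity_fact_le:
  assumes "prime p"
  shows "(p - 1) * multiplicity p (fact n :: nat) \<le> n"
proof (induction n rule: less_induct)
  case (less n)
  have p: "p \<ge> 2" using assms prime_ge_2_nat by auto
  show ?case
  proof (cases "n = 0")
    case False
    then have "n div p < n" using p by (intro div_less_dividend) auto
    then have "(p - 1) * multiplicity p (fact (n div p) :: nat) \<le> n div p" by (rule less)
    then have "(p - 1) * multiplicity p (fact n :: nat) \<le> (p - 1) * (n div p) + n div p"
      unfolding multiplicity_fact_recursion[OF assms, of n] by (simp add: algebra_simps)
    also have "\<dots> = p * (n div p)" using p by (cases p) auto
    also have "\<dots> \<le> n" by simp
    finally show ?thesis .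
  qed auto
qed

lemma ln_fact_conv: "ln (fact n) = (\<Sum>p\<in>primes_le n. real (multiplicity p (fact n :: nat)) * ln (real p))"
proof -
  have *: "prime_factors (fact n :: nat) = primes_le n"
    by (auto simp: primes_le_def prime_factors_dvd prime_dvd_fact_iff)
  have "(fact n :: nat) = (\<Prod>p\<in>primes_le n. p ^ multiplicity p (fact n :: nat))"
    using prime_factorization_nat[of "fact n"] * by simp
  then have "real (fact n) = (\<Prod>p\<in>primes_le n. real p ^ multiplicity p (fact n :: nat))"
    by (metis (no_types, lifting) of_nat_power of_nat_prod prod.cong)
  then have "ln (fact n) = ln (\<Prod>p\<in>primes_le n. real p ^ multiplicity p (fact n :: nat))" by simp
  also have "\<dots> = (\<Sum>p\<in>primes_le n. ln (real p ^ multiplicity p (fact n :: nat)))"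
    by (intro ln_prod) (auto dest: primes_leD)
  also have "\<dots> = (\<Sum>p\<in>primes_le n. real (multiplicity p (fact n :: nat)) * ln (real p))"
    by (intro sum.cong ln_realpow) (auto dest: primes_leD)
  finally show ?thesis .
qed

lemma ln_fact_le: "n > 0 \<Longrightarrow> ln (fact n) \<le> real n * ln (real n)"
proof -
  assume "n > 0"
  have "(fact n :: real) \<le> real n ^ n" using fact_le_power[of n] by simp
  then have "ln (fact n) \<le> ln (real n ^ n)" using \<open>n > 0\<close> by (subst ln_le_cancel_iff) auto
  then show ?thesis using \<open>n > 0\<close> by (simp add: ln_realpow)
qed

text \<open>All of Stirling's formula that is needed: \<open>n ^ n / fact n\<close> is one term of
  the exponential series at \<open>n\<close>.\<close>

lemma ln_fact_ge: "n > 0 \<Longrightarrow> real n * ln (real n) - real n \<le> ln (fact n)"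
proof -
  assume "n > 0"
  have "real n ^ n / fact n \<le> exp (real n)"
    using sum_le_suminf[OF summable_exp_generic[of "real n"], of "{n}"]
    by (simp add: exp_def divide_inverse mult.commute)
  then have "ln (real n ^ n / fact n) \<le> ln (exp (real n))"
    using \<open>n > 0\<close> by (subst ln_le_cancel_iff) auto
  then show ?thesis using \<open>n > 0\<close> by (simp add: ln_div ln_realpow)
qed

section \<open>Mertens' theorems\<close>

text \<open>The logarithm of the Euler factor at \<open>X(p) = 1\<close>, where its modulus is
  largest. With this weight in place of \<open>1 / p\<close> the constant in Mertens' second theorem
  is exactly Euler's constant.\<close>

definition euler_weight :: "nat \<Rightarrow> real" where
  "euler_weight p = - ln (1 - 1 / real p)"

lemma euler_weight_bounds:
  assumes "p \<ge> 2"
  shows "1 / real p \<le> euler_weight p" "euler_weight p \<le> 1 / (real p - 1)"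
proof -
  show "1 / real p \<le> euler_weight p"
    using assms ln_le_minus_one[of "1 - 1 / real p"] by (simp add: euler_weight_def field_simps)
  have "euler_weight p = ln (inverse (1 - 1 / real p))"
    using assms by (simp add: euler_weight_def ln_inverse)
  also have "inverse (1 - 1 / real p) = 1 + 1 / (real p - 1)"
    using assms by (simp add: field_simps)
  also have "ln (1 + 1 / (real p - 1)) \<le> 1 / (real p - 1)"
    using assms by (intro ln_add_one_self_le_self) auto
  finally show "euler_weight p \<le> 1 / (real p - 1)" .
qed

lemma euler_weight_pos: "p \<ge> 2 \<Longrightarrow> euler_weight p > 0"
  using euler_weight_bounds(1)[of p] by (smt (verit) of_nat_0_less_iff zero_less_divide_1_iff zero_less_numeral order_less_le_trans)

lemma sum_primes_le_suminf:
  fixes f :: "nat \<Rightarrow> real"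
  assumes "summable f" "\<And>k. f k \<ge> 0"
  shows "sum f (primes_le n) \<le> suminf f"
  using assms by (intro sum_le_suminf) auto

lemma bounded_ln_over_p_pm1:
  obtains K where "K > 0" "\<And>n. (\<Sum>p\<in>primes_le n. ln (real p) / (real p * (real p - 1))) \<le> K"
proof -
  let ?f = "\<lambda>k::nat. ln (real k) / (real k * (real k - 1))"
  have "summable ?f"
  proof (rule summable_comparison_test_bigo)
    show "summable (\<lambda>n. norm (real n powr (-3/2)))" by (simp add: summable_real_powr_iff)
    show "?f \<in> O(\<lambda>n. real n powr (-3/2))" by real_asymp
  qed
  moreover have "?f k \<ge> 0" for k
  proof -
    consider "k = 0" | "k = 1" | "k \<ge> 2" by linarith
    then show ?thesis by cases (auto intro!: divide_nonneg_nonneg mult_nonneg_nonneg)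
  qed
  ultimately have "sum ?f (primes_le n) \<le> suminf ?f + 1" "suminf ?f + 1 > 0" for n
    using sum_primes_le_suminf[of ?f n] suminf_nonneg[of ?f] by fastforce+
  then show ?thesis using that by blast
qed

text \<open>Legendre's formula for \<open>ln (fact n)\<close>: a multiplicity is at least
  \<open>n / p - 1\<close>, which bounds \<open>?A\<close> from above once Chebyshev pays for the
  \<open>- 1\<close>, and at most \<open>n / (p - 1)\<close>, which bounds \<open>?B\<close> from
  below. The weighted sum lies between \<open>?A\<close> and \<open>?B\<close>, which differ by a
  convergent series.\<close>

lemma mertens_first:
  obtains K where "K > 0" "\<And>n. \<bar>(\<Sum>p\<in>primes_le n. euler_weight p * ln (real p)) - ln (real n)\<bar> \<le> K"
proof -
  obtain K where K: "K > 0" "\<And>n. (\<Sum>p\<in>primes_le n. ln (real p) / (real p * (real p - 1))) \<le> K"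
    using bounded_ln_over_p_pm1 by blast
  \<comment> \<open>Stated for \<open>n = 0\<close> too, where the sum is empty and
    \<open>ln 0 = 0\<close>, so that the remainder is bounded at every index as
    \<open>abel_bound\<close> requires.\<close>
  have bound: "\<bar>(\<Sum>p\<in>primes_le n. euler_weight p * ln (real p)) - ln (real n)\<bar> \<le> K + 2" for n
  proof (cases "n = 0")
    case False
    then have n: "n > 0" by simp
    let ?A = "\<Sum>p\<in>primes_le n. ln (real p) / real p"
    let ?B = "\<Sum>p\<in>primes_le n. ln (real p) / (real p - 1)"
    let ?W = "\<Sum>p\<in>primes_le n. euler_weight p * ln (real p)"
    have AW: "?A \<le> ?W"
    proof (intro sum_mono)
      fix p assume "p \<in> primes_le n"
      then have p: "p \<ge> 2" by (rule primes_leD)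
      have "1 / real p * ln (real p) \<le> euler_weight p * ln (real p)"
        using p by (intro mult_right_mono euler_weight_bounds) auto
      then show "ln (real p) / real p \<le> euler_weight p * ln (real p)" by simp
    qed
    have WB: "?W \<le> ?B"
    proof (intro sum_mono)
      fix p assume "p \<in> primes_le n"
      then have p: "p \<ge> 2" by (rule primes_leD)
      have "euler_weight p * ln (real p) \<le> 1 / (real p - 1) * ln (real p)"
        using p by (intro mult_right_mono euler_weight_bounds) auto
      then show "euler_weight p * ln (real p) \<le> ln (real p) / (real p - 1)" by simp
    qed
    have "?B - ?A = (\<Sum>p\<in>primes_le n. ln (real p) / (real p * (real p - 1)))"
      unfolding sum_subtractf[symmetric]
    proof (rule sum.cong)
      fix p assume "p \<in> primes_le n"
      then have p: "p \<ge> 2" by (rule primes_leD)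
      then show "ln (real p) / (real p - 1) - ln (real p) / real p = ln (real p) / (real p * (real p - 1))"
        by (simp add: field_simps)
    qed auto
    then have BA: "?B - ?A \<le> K" using K(2)[of n] by simp
    have "real n * ?A - chebyshev_theta n = (\<Sum>p\<in>primes_le n. (real n / real p - 1) * ln (real p))"
      by (simp add: chebyshev_theta_def sum_distrib_left sum_subtractf algebra_simps)
    also have "\<dots> \<le> ln (fact n)"
      unfolding ln_fact_conv
    proof (intro sum_mono mult_right_mono)
      fix p assume "p \<in> primes_le n"
      then have p: "prime p" "p \<ge> 2" by (auto dest: primes_leD)
      have "real n / real p - 1 \<le> real (n div p)"
        using floor_correct[of "real n / real p"] by (simp add: floor_divide_of_nat_eq)
      also have "\<dots> \<le> real (multiplicity p (fact n :: nat))"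
        unfolding multiplicity_fact_recursion[OF p(1), of n] by simp
      finally show "real n / real p - 1 \<le> real (multiplicity p (fact n :: nat))" .
      show "0 \<le> ln (real p)" using p by simp
    qed
    finally have "real n * ?A - real n * ln 4 \<le> real n * ln (real n)"
      using ln_fact_le[OF n] theta_le[of n] by linarith
    then have "real n * (?A - ln 4) \<le> real n * ln (real n)" by (simp add: algebra_simps)
    then have A: "?A \<le> ln (real n) + ln 4" using n by simp
    have "real n * ln (real n) - real n \<le> ln (fact n)" by (rule ln_fact_ge[OF n])
    also have "\<dots> \<le> (\<Sum>p\<in>primes_le n. real n / (real p - 1) * ln (real p))"
      unfolding ln_fact_conv
    proof (intro sum_mono mult_right_mono)
      fix p assume "p \<in> primes_le n"
      then have p: "prime p" "p \<ge> 2" by (auto dest: primes_leD)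
      have "real (p - 1) * real (multiplicity p (fact n :: nat)) \<le> real n"
        using multiplicity_fact_le[OF p(1), of n] by (metis of_nat_le_iff of_nat_mult)
      then show "real (multiplicity p (fact n :: nat)) \<le> real n / (real p - 1)"
        using p by (simp add: of_nat_diff field_simps)
      show "0 \<le> ln (real p)" using p by simp
    qed
    also have "\<dots> = real n * ?B" by (simp add: sum_distrib_left)
    finally have "real n * (ln (real n) - 1) \<le> real n * ?B" by (simp add: algebra_simps)
    then have "ln (real n) - 1 \<le> ?B" using n by simp
    moreover have "ln 4 \<le> (2 :: real)"
    proof -
      have "ln (2 ^ 2 :: real) = 2 * ln 2" by (subst ln_realpow) auto
      then show ?thesis using ln_le_minus_one[of "2 :: real"] by simp
    qed
    ultimately show ?thesis using A AW WB BA K(1) by linarith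
  qed (use K in auto)
  show ?thesis by (rule that[of "K + 2"]) (use bound K in auto)
qed

text \<open>One step of the integral of \<open>1 / ln t\<close> with respect to \<open>ln t\<close>.
  The error is at most an increment of \<open>- 1 / ln\<close>, so over a range starting at
  \<open>m\<close> it telescopes to at most \<open>1 / ln m\<close>.\<close>

lemma ln_ln_increment:
  assumes "k \<ge> 3"
  defines "d \<equiv> ln (real k) - ln (real (k - 1))"
  shows "d / ln (real k) \<le> ln (ln (real k)) - ln (ln (real (k - 1)))"
    "ln (ln (real k)) - ln (ln (real (k - 1))) - d / ln (real k) \<le> 1 / ln (real (k - 1)) - 1 / ln (real k)"
proof -
  let ?a = "ln (real (k - 1))" and ?b = "ln (real k)"
  have a: "?a > 0" "?b > 0" "?a \<le> ?b" using assms by auto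
  have "ln (?a / ?b) \<le> ?a / ?b - 1" using a by (intro ln_le_minus_one) auto
  then show "d / ?b \<le> ln ?b - ln ?a" using a by (simp add: ln_div d_def diff_divide_distrib)
  have "ln (?b / ?a) \<le> ?b / ?a - 1" using a by (intro ln_le_minus_one) auto
  then have "ln ?b - ln ?a \<le> d * (1 / ?a)" using a by (simp add: ln_div d_def diff_divide_distrib)
  moreover have "d \<le> 1"
  proof -
    have "d = ln (real k / real (k - 1))" using assms by (simp add: ln_div)
    also have "\<dots> \<le> real k / real (k - 1) - 1" using assms by (intro ln_le_minus_one) auto
    also have "\<dots> \<le> 1" using assms by (simp add: field_simps)
    finally show ?thesis .
  qed
  moreover have "d * (1 / ?a - 1 / ?b) \<le> 1 * (1 / ?a - 1 / ?b)"
    using a \<open>d \<le> 1\<close> by (intro mult_right_mono) (auto simp: field_simps)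
  ultimately show "ln ?b - ln ?a - d / ?b \<le> 1 / ?a - 1 / ?b"
    by (simp add: algebra_simps)
qed

text \<open>Partial summation of Mertens' first theorem against \<open>1 / ln k\<close>:
  \<open>W\<close> is \<open>ln\<close> plus a bounded remainder \<open>R\<close>. The part from
  \<open>ln\<close> gives the difference of \<open>ln ln\<close>, the part from \<open>R\<close> is
  small by \<open>abel_bound\<close>.\<close>

lemma mertens_second_Cauchy:
  obtains C where "C > 0" "\<And>m n. 2 \<le> m \<Longrightarrow> m \<le> n \<Longrightarrow>
    \<bar>(\<Sum>p\<in>primes_between m n. euler_weight p) - (ln (ln (real n)) - ln (ln (real m)))\<bar> \<le> C / ln (real m)"
proof -
  obtain K where K: "K > 0"
    "\<And>n. \<bar>(\<Sum>p\<in>primes_le n. euler_weight p * ln (real p)) - ln (real n)\<bar> \<le> K"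
    using mertens_first by blast
  define W where "W n = (\<Sum>p\<in>primes_le n. euler_weight p * ln (real p))" for n
  define R where "R n = W n - ln (real n)" for n
  have "\<bar>(\<Sum>p\<in>primes_between m n. euler_weight p) - (ln (ln (real n)) - ln (ln (real m)))\<bar> \<le> (2 * K + 1) / ln (real m)"
    if mn: "2 \<le> m" "m \<le> n" for m n
  proof -
    let ?d = "\<lambda>k. ln (real k) - ln (real (k - 1))"
    have 1: "\<bar>\<Sum>k\<in>{m<..n}. (R k - R (k - 1)) * (1 / ln (real k))\<bar> \<le> 2 * K * (1 / ln (real (Suc m)))"
      using K mn by (intro abel_bound) (auto simp: R_def W_def intro!: divide_left_mono)
    have W_step: "W k - W (k - 1) = (if prime k then euler_weight k * ln (real k) else 0)" for k
    proof (cases k)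
      case (Suc j)
      have "Suc j \<notin> primes_le j" by (auto simp: primes_le_def)
      then show ?thesis using Suc by (simp add: W_def primes_le_Suc)
    qed simp
    have "(\<Sum>k\<in>{m<..n}. (R k - R (k - 1)) * (1 / ln (real k))) =
      (\<Sum>k\<in>{m<..n}. (if prime k then euler_weight k else 0) - ?d k / ln (real k))"
    proof (rule sum.cong)
      fix k assume "k \<in> {m<..n}"
      then have "ln (real k) > 0" using mn by auto
      moreover have "R k - R (k - 1) = (if prime k then euler_weight k * ln (real k) else 0) - ?d k"
        using W_step[of k] by (simp add: R_def)
      ultimately show "(R k - R (k - 1)) * (1 / ln (real k)) =
        (if prime k then euler_weight k else 0) - ?d k / ln (real k)"
        by (auto simp: field_simps)
    qed simp
    then have 2: "(\<Sum>k\<in>{m<..n}. (R k - R (k - 1)) * (1 / ln (real k))) =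
      (\<Sum>p\<in>primes_between m n. euler_weight p) - (\<Sum>k\<in>{m<..n}. ?d k / ln (real k))"
      by (simp add: sum_subtractf sum_primes_between_conv)
    have tele: "(\<Sum>k\<in>{m<..n}. g k - g (k - 1)) = g n - g m" for g :: "nat \<Rightarrow> real"
      using mn(2)
    proof (induction n rule: dec_induct)
      case (step n)
      have "{m<..Suc n} = insert (Suc n) {m<..n}" using step by auto
      then show ?case using step by simp
    qed simp
    have 3: "(\<Sum>k\<in>{m<..n}. ?d k / ln (real k)) \<le> (\<Sum>k\<in>{m<..n}. ln (ln (real k)) - ln (ln (real (k - 1))))"
      using mn by (intro sum_mono ln_ln_increment) auto
    have "(\<Sum>k\<in>{m<..n}. ln (ln (real k)) - ln (ln (real (k - 1))) - ?d k / ln (real k)) \<le>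
       (\<Sum>k\<in>{m<..n}. 1 / ln (real (k - 1)) - 1 / ln (real k))"
      using mn by (intro sum_mono ln_ln_increment) auto
    also have "\<dots> = (\<Sum>k\<in>{m<..n}. (- 1 / ln (real k)) - (- 1 / ln (real (k - 1))))" by simp
    also have "\<dots> = 1 / ln (real m) - 1 / ln (real n)" using tele[of "\<lambda>k. - 1 / ln (real k)"] by simp
    also have "\<dots> \<le> 1 / ln (real m)" using mn by simp
    finally have 4: "(ln (ln (real n)) - ln (ln (real m))) - (\<Sum>k\<in>{m<..n}. ?d k / ln (real k)) \<le> 1 / ln (real m)"
      using tele[of "\<lambda>k. ln (ln (real k))"] by (simp add: sum_subtractf)
    have "2 * K * (1 / ln (real (Suc m))) \<le> 2 * K * (1 / ln (real m))"
      using K mn by (intro mult_left_mono) (auto intro!: divide_left_mono)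
    then show ?thesis
      using 1 2 3 4 tele[of "\<lambda>k. ln (ln (real k))"] by (simp add: add_divide_distrib)
  qed
  then show ?thesis using that[of "2 * K + 1"] K by auto
qed

text \<open>Letting \<open>n\<close> tend to infinity in the Cauchy form yields the constant without
  loss in the rate.\<close>

lemma mertens_second:
  obtains c C where "C > 0" "\<And>n. 2 \<le> n \<Longrightarrow>
    \<bar>(\<Sum>p\<in>primes_le n. euler_weight p) - ln (ln (real n)) - c\<bar> \<le> C / ln (real n)"
proof -
  obtain C where C: "C > 0" "\<And>m n. 2 \<le> m \<Longrightarrow> m \<le> n \<Longrightarrow>
    \<bar>(\<Sum>p\<in>primes_between m n. euler_weight p) - (ln (ln (real n)) - ln (ln (real m)))\<bar> \<le> C / ln (real m)"
    using mertens_second_Cauchy by blast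
  define D where "D n = (\<Sum>p\<in>primes_le n. euler_weight p) - ln (ln (real n))" for n
  have D: "\<bar>D n - D m\<bar> \<le> C / ln (real m)" if "2 \<le> m" "m \<le> n" for m n
    using C(2)[OF that] sum_primes_le_split[OF that(2), of euler_weight] by (simp add: D_def)
  have "(\<lambda>m. C / ln (real m)) \<longlonglongrightarrow> 0" by real_asymp
  have "Cauchy D"
  proof (rule CauchyI')
    fix e :: real assume "e > 0"
    then have "eventually (\<lambda>m. C / ln (real m) < e) sequentially"
      using order_tendstoD(2)[OF \<open>(\<lambda>m. C / ln (real m)) \<longlonglongrightarrow> 0\<close>] by blast
    then obtain M where M: "\<And>m. m \<ge> M \<Longrightarrow> C / ln (real m) < e"
      by (auto simp: eventually_at_top_linorder)
    show "\<exists>M. \<forall>m\<ge>M. \<forall>n>m. dist (D m) (D n) < e"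
    proof (intro exI[of _ "max M 2"] allI impI)
      fix m n assume "max M 2 \<le> m" "m < n"
      then show "dist (D m) (D n) < e" using D[of m n] M[of m] by (simp add: dist_real_def abs_minus_commute)
    qed
  qed
  then obtain c where c: "D \<longlonglongrightarrow> c" by (auto simp: Cauchy_convergent_iff convergent_def)
  have "\<bar>D m - c\<bar> \<le> C / ln (real m)" if "2 \<le> m" for m
  proof -
    have "(\<lambda>n. \<bar>D n - D m\<bar>) \<longlonglongrightarrow> \<bar>c - D m\<bar>" by (intro tendsto_intros c)
    then have "\<bar>c - D m\<bar> \<le> C / ln (real m)"
      by (rule tendsto_upperbound)
        (use D that in \<open>auto intro!: eventually_mono[OF eventually_ge_at_top[of m]]\<close>)
    then show ?thesis by (simp add: abs_minus_commute)
  qed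
  then show ?thesis using that[of C c] C(1) by (simp add: D_def)
qed

section \<open>The constant in Mertens' third theorem\<close>

text \<open>Partial summation turns the difference into \<open>1 - r\<close> times the power series
  of \<open>B\<close>, the error of the partial sums. The first \<open>N\<close> terms vanish with
  \<open>1 - r\<close>; the rest is at most \<open>e / 2\<close>, as \<open>1 - r\<close> times the
  geometric series is 1.\<close>

lemma Abel_limit_at_1:
  fixes b :: "nat \<Rightarrow> real"
  assumes b: "b sums l"
  shows "((\<lambda>r. \<Sum>n. b n * r ^ n) \<longlongrightarrow> l) (at_left 1)"
proof (rule tendstoI)
  fix e :: real assume e: "e > 0"
  define B where "B n = (\<Sum>k\<le>n. b k) - l" for n
  have "B \<longlonglongrightarrow> l - l"
    unfolding B_def using b by (intro tendsto_intros) (simp add: sums_def_le)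
  then have B: "B \<longlonglongrightarrow> 0" by simp
  then obtain N where N: "\<And>n. n \<ge> N \<Longrightarrow> \<bar>B n\<bar> < e / 2"
    using e by (force simp: LIMSEQ_iff dest: spec[of _ "e / 2"])
  obtain K where K: "K > 0" "\<And>n. \<bar>B n\<bar> \<le> K"
    using Bseq_def[of B] convergent_imp_Bseq[of B] B by (auto simp: convergent_def)
  have key: "\<bar>(\<Sum>n. b n * r ^ n) - l\<bar> \<le> (1 - r) * (real N * K) + e / 2" if r: "0 < r" "r < 1" for r
  proof -
    have sumB: "summable (\<lambda>n. \<bar>B n\<bar> * r ^ n)"
      by (rule summable_comparison_test'[where N = 0 and g = "\<lambda>n. K * r ^ n"])
        (use r K in \<open>auto simp: abs_mult intro!: mult_right_mono summable_mult summable_geometric\<close>)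
    have sumB': "summable (\<lambda>n. B n * r ^ n)"
      by (rule summable_norm_cancel) (use sumB r in \<open>simp add: abs_mult\<close>)
    have Bsums: "(\<lambda>n. B n * r ^ n) sums (\<Sum>n. B n * r ^ n)" using sumB' by (rule summable_sums)
    have "(\<lambda>n. B (Suc n) * r ^ Suc n) sums ((\<Sum>n. B n * r ^ n) - B 0)"
      using Bsums by (subst sums_Suc_iff) simp
    moreover have "(\<lambda>n. r * (B n * r ^ n)) sums (r * (\<Sum>n. B n * r ^ n))"
      using Bsums by (rule sums_mult)
    ultimately have "(\<lambda>n. B (Suc n) * r ^ Suc n - r * (B n * r ^ n)) sums
       ((\<Sum>n. B n * r ^ n) - B 0 - r * (\<Sum>n. B n * r ^ n))" by (rule sums_diff)
    moreover have "B (Suc n) * r ^ Suc n - r * (B n * r ^ n) = b (Suc n) * r ^ Suc n" for n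
      by (simp add: B_def algebra_simps)
    ultimately have "(\<lambda>n. b (Suc n) * r ^ Suc n) sums
       ((\<Sum>n. B n * r ^ n) - B 0 - r * (\<Sum>n. B n * r ^ n))" by simp
    then have "(\<lambda>n. b n * r ^ n) sums ((\<Sum>n. B n * r ^ n) - B 0 - r * (\<Sum>n. B n * r ^ n) + b 0)"
      by (subst (asm) sums_Suc_iff) simp
    moreover have "(\<Sum>n. B n * r ^ n) - B 0 - r * (\<Sum>n. B n * r ^ n) + b 0 = l + (1 - r) * (\<Sum>n. B n * r ^ n)"
      by (simp add: B_def algebra_simps)
    ultimately have eq: "(\<Sum>n. b n * r ^ n) - l = (1 - r) * (\<Sum>n. B n * r ^ n)"
      by (simp add: sums_iff)
    have "\<bar>\<Sum>n. B n * r ^ n\<bar> \<le> (\<Sum>n. \<bar>B n\<bar> * r ^ n)"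
      using summable_rabs[of "\<lambda>n. B n * r ^ n"] sumB r by (simp add: abs_mult)
    also have "\<dots> = (\<Sum>n. \<bar>B (n + N)\<bar> * r ^ (n + N)) + (\<Sum>n<N. \<bar>B n\<bar> * r ^ n)"
      by (rule suminf_split_initial_segment[OF sumB])
    also have "(\<Sum>n<N. \<bar>B n\<bar> * r ^ n) \<le> (\<Sum>n<N. K * 1)"
      using K r by (intro sum_mono mult_mono power_le_one) auto
    also have "(\<Sum>n. \<bar>B (n + N)\<bar> * r ^ (n + N)) \<le> (\<Sum>n. e / 2 * r ^ n)"
    proof (rule suminf_le)
      show "summable (\<lambda>n. \<bar>B (n + N)\<bar> * r ^ (n + N))" using sumB by (rule summable_ignore_initial_segment)
      show "summable (\<lambda>n. e / 2 * r ^ n)" using r by (intro summable_mult summable_geometric) auto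
      fix n
      have "r ^ (n + N) \<le> r ^ n" using r by (intro power_decreasing) auto
      then show "\<bar>B (n + N)\<bar> * r ^ (n + N) \<le> e / 2 * r ^ n"
        using r e N[of "n + N"] by (intro mult_mono) auto
    qed
    also have "(\<Sum>n. e / 2 * r ^ n) = e / 2 * (1 / (1 - r))"
      using r by (subst suminf_mult) (auto simp: suminf_geometric)
    finally have "\<bar>\<Sum>n. B n * r ^ n\<bar> \<le> e / 2 * (1 / (1 - r)) + real N * K" by simp
    then have "(1 - r) * \<bar>\<Sum>n. B n * r ^ n\<bar> \<le> (1 - r) * (e / 2 * (1 / (1 - r)) + real N * K)"
      using r by (intro mult_left_mono) auto
    also have "\<dots> = (1 - r) * (real N * K) + e / 2" using r by (simp add: field_simps)
    finally show ?thesis unfolding eq using r by (simp add: abs_mult)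
  qed
  have "((\<lambda>r. (1 - r) * (real N * K)) \<longlongrightarrow> (1 - 1) * (real N * K)) (at_left 1)" by (intro tendsto_intros)
  then have "eventually (\<lambda>r. (1 - r) * (real N * K) < e / 2) (at_left 1)"
    using e by (intro order_tendstoD(2)[where y = "(1 - 1) * (real N * K)"]) auto
  moreover have "eventually (\<lambda>r. r \<in> {0<..<1}) (at_left (1::real))"
    by (rule eventually_at_left_real) simp
  ultimately show "eventually (\<lambda>r. dist (\<Sum>n. b n * r ^ n) l < e) (at_left 1)"
  proof eventually_elim
    case (elim r)
    then show ?case using key[of r] by (simp add: dist_real_def)
  qed
qed

section \<open>The Euler product of zeta on the real axis, by sieving\<close>

definition sifted_zeta_term :: "real \<Rightarrow> nat set \<Rightarrow> nat \<Rightarrow> real" where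
  "sifted_zeta_term s P n = (if n \<ge> 1 \<and> (\<forall>p\<in>P. \<not> p dvd n) then real n powr (- s) else 0)"

lemma sifted_zeta_term_bounds: "0 \<le> sifted_zeta_term s P n" "sifted_zeta_term s P n \<le> real n powr (- s)"
  by (auto simp: sifted_zeta_term_def)

lemma summable_sifted_zeta:
  assumes "s > 1"
  shows "summable (sifted_zeta_term s P)"
  by (rule summable_comparison_test'[where N = 0 and g = "\<lambda>n. real n powr (- s)"])
    (use assms in \<open>auto simp: summable_real_powr_iff sifted_zeta_term_bounds\<close>)

text \<open>The discarded terms are those at \<open>n = q * m\<close>. Divisibility by primes other
  than \<open>q\<close> is the same for \<open>n\<close> and \<open>m\<close>, so they form the
  whole series again, scaled by \<open>q powr (- s)\<close>.\<close>

lemma sifted_zeta_insert: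
  assumes s: "s > 1" and P: "\<And>p. p \<in> P \<Longrightarrow> prime p" "prime q" "q \<notin> P"
  shows "suminf (sifted_zeta_term s (insert q P)) = suminf (sifted_zeta_term s P) * (1 - real q powr (- s))"
proof -
  have q: "q > 0" using P prime_gt_0_nat by auto
  let ?h = "\<lambda>n. if q dvd n then sifted_zeta_term s P n else 0"
  have "(\<lambda>m. ?h (q * m)) = (\<lambda>m. real q powr (- s) * sifted_zeta_term s P m)"
  proof
    fix m
    have "p dvd q * m \<longleftrightarrow> p dvd m" if "p \<in> P" for p
      using that P by (auto simp: prime_dvd_mult_iff dest: primes_dvd_imp_eq)
    then show "?h (q * m) = real q powr (- s) * sifted_zeta_term s P m"
      using q by (auto simp: sifted_zeta_term_def powr_mult)
  qed
  then have "(\<lambda>m. ?h (q * m)) sums (real q powr (- s) * suminf (sifted_zeta_term s P))"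
    using summable_sums[OF summable_sifted_zeta[OF s, of P]] by (simp only: sums_mult)
  then have "?h sums (real q powr (- s) * suminf (sifted_zeta_term s P))"
    using q by (subst (asm) sums_mono_reindex[of "\<lambda>m. q * m" ?h]) (auto simp: strict_mono_def dvd_def)
  from sums_diff[OF summable_sums[OF summable_sifted_zeta[OF s, of P]] this]
  have "(\<lambda>n. sifted_zeta_term s P n - ?h n) sums
      (suminf (sifted_zeta_term s P) - real q powr (- s) * suminf (sifted_zeta_term s P))" .
  moreover have "(\<lambda>n. sifted_zeta_term s P n - ?h n) = sifted_zeta_term s (insert q P)"
    by (auto simp: sifted_zeta_term_def)
  ultimately show ?thesis by (simp add: sums_iff algebra_simps)
qed

lemma sifted_zeta_finite:
  assumes s: "s > 1" and "finite P" "\<And>p. p \<in> P \<Longrightarrow> prime p"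
  shows "suminf (sifted_zeta_term s P) = suminf (sifted_zeta_term s {}) * (\<Prod>p\<in>P. 1 - real p powr (- s))"
  using assms(2,3)
proof (induction P rule: finite_induct)
  case (insert q P)
  then show ?case by (simp add: sifted_zeta_insert[OF s])
qed simp

text \<open>Any \<open>n\<close> with \<open>2 \<le> n < N\<close> has a prime factor below
  \<open>N\<close>, so besides the term at 1 only terms from \<open>N\<close> on survive, and these
  are dominated by a tail of zeta.\<close>

lemma sifted_zeta_primes_le_tendsto:
  assumes s: "s > 1"
  shows "(\<lambda>N. suminf (sifted_zeta_term s (primes_le N))) \<longlonglongrightarrow> 1"
proof (rule tendsto_sandwich)
  have sm: "summable (\<lambda>n. real n powr (- s))" using s by (simp add: summable_real_powr_iff)
  have "1 \<le> suminf (sifted_zeta_term s (primes_le N))" for N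
  proof -
    have "sifted_zeta_term s (primes_le N) 1 = 1"
      by (auto simp: sifted_zeta_term_def dest: primes_leD)
    moreover have "(\<Sum>n\<in>{1}. sifted_zeta_term s (primes_le N) n) \<le> suminf (sifted_zeta_term s (primes_le N))"
      by (intro sum_le_suminf summable_sifted_zeta s) (auto simp: sifted_zeta_term_bounds)
    ultimately show ?thesis by simp
  qed
  then show "eventually (\<lambda>N. 1 \<le> suminf (sifted_zeta_term s (primes_le N))) sequentially" by simp
  have "suminf (sifted_zeta_term s (primes_le N)) \<le> 1 + (\<Sum>n. real (n + N) powr (- s))" if "N \<ge> 2" for N
  proof -
    have z: "sifted_zeta_term s (primes_le N) n = (if n = 1 then 1 else 0)" if "n < N" for n
    proof -
      consider "n = 0" | "n = 1" | "n \<ge> 2" by linarith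
      then show ?thesis
      proof cases
        case 3
        then obtain p where "prime p" "p dvd n" using prime_factor_nat[of n] by auto
        moreover have "p \<le> n" using \<open>p dvd n\<close> 3 by (intro dvd_imp_le) auto
        ultimately show ?thesis using \<open>n < N\<close> 3 by (auto simp: sifted_zeta_term_def primes_le_def)
      qed (auto simp: sifted_zeta_term_def dest: primes_leD)
    qed
    have "suminf (sifted_zeta_term s (primes_le N)) =
      (\<Sum>n. sifted_zeta_term s (primes_le N) (n + N)) + (\<Sum>n<N. sifted_zeta_term s (primes_le N) n)"
      by (intro suminf_split_initial_segment summable_sifted_zeta s)
    also have "(\<Sum>n<N. sifted_zeta_term s (primes_le N) n) = (\<Sum>n<N. if n = 1 then 1 else 0)"
      by (intro sum.cong) (auto simp: z)
    also have "\<dots> = 1" using that by simp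
    also have "(\<Sum>n. sifted_zeta_term s (primes_le N) (n + N)) \<le> (\<Sum>n. real (n + N) powr (- s))"
      by (intro suminf_le sifted_zeta_term_bounds summable_ignore_initial_segment sm
          summable_ignore_initial_segment[OF summable_sifted_zeta[OF s]])
    finally show ?thesis by simp
  qed
  then show "eventually (\<lambda>N. suminf (sifted_zeta_term s (primes_le N)) \<le> 1 + (\<Sum>n. real (n + N) powr (- s))) sequentially"
    by (auto intro: eventually_mono[OF eventually_ge_at_top[of 2]])
  have "(\<lambda>N. 1 + (\<Sum>n. real (n + N) powr (- s))) \<longlonglongrightarrow> 1 + 0"
    by (intro tendsto_intros suminf_exist_split2 sm)
  then show "(\<lambda>N. 1 + (\<Sum>n. real (n + N) powr (- s))) \<longlonglongrightarrow> 1" by simp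
qed simp

section \<open>The pole of zeta at 1 and twisted sums over primes\<close>

lemma powr_diff_bounds:
  fixes x d :: real
  assumes "x > 0" "d > 0"
  shows "d * (x + 1) powr (- (1 + d)) \<le> x powr (- d) - (x + 1) powr (- d)"
    "x powr (- d) - (x + 1) powr (- d) \<le> d * x powr (- (1 + d))"
proof -
  have *: "\<exists>z. x < z \<and> z < x + 1 \<and> (x + 1) powr (- d) - x powr (- d) = (x + 1 - x) * (- d * z powr (- d - 1))"
    using assms by (intro MVT2) (auto intro!: derivative_eq_intros simp: field_simps powr_diff)
  then obtain z where z: "x < z" "z < x + 1" "x powr (- d) - (x + 1) powr (- d) = d * z powr (- (1 + d))"
  proof -
    from * obtain z where "x < z" "z < x + 1" "(x + 1) powr (- d) - x powr (- d) = (x + 1 - x) * (- d * z powr (- d - 1))"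
      by blast
    moreover have "- d - 1 = - (1 + d)" by simp
    ultimately show ?thesis using that[of z] by simp
  qed
  then show "d * (x + 1) powr (- (1 + d)) \<le> x powr (- d) - (x + 1) powr (- d)"
    "x powr (- d) - (x + 1) powr (- d) \<le> d * x powr (- (1 + d))"
    using assms by (auto intro!: mult_left_mono powr_mono2')
qed

text \<open>\<open>P = {}\<close> gives the full zeta series, so these bounds describe its pole. A
  telescoping sum of \<open>n powr (- d)\<close> replaces the integral test: its total is 1, and it
  is compared with the series from \<open>n = 1\<close> and from \<open>n = 2\<close>.\<close>

lemma zeta_real_bounds:
  assumes d: "d > 0"
  defines "z \<equiv> suminf (sifted_zeta_term (1 + d) {})"
  shows "1 / d \<le> z" "z \<le> 1 + 1 / d"
proof -
  let ?f = "sifted_zeta_term (1 + d) {}"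
  let ?g = "\<lambda>n::nat. real (Suc n) powr (- d)"
  have "?g \<longlonglongrightarrow> 0" using d by real_asymp
  then have "(\<lambda>n. ?g n - ?g (Suc n)) sums (?g 0 - 0)" by (rule telescope_sums')
  then have g: "(\<lambda>n. ?g n - ?g (Suc n)) sums 1" by simp
  have f: "?f sums z" unfolding z_def using d by (intro summable_sums summable_sifted_zeta) auto
  have f1: "(\<lambda>n. ?f (Suc n)) sums z" using f by (subst sums_Suc_iff) (simp add: sifted_zeta_term_def)
  have f2: "(\<lambda>n. ?f (Suc (Suc n))) sums (z - 1)"
    using f1 by (subst sums_Suc_iff) (simp add: sifted_zeta_term_def)
  have fS: "?f (Suc n) = real (Suc n) powr (- (1 + d))" for n by (simp add: sifted_zeta_term_def)
  have "1 \<le> d * z"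
    using sums_le[OF _ g sums_mult[OF f1, of d]] powr_diff_bounds(2)[of "real (Suc n)" d for n] d
    by (simp add: fS algebra_simps)
  then show "1 / d \<le> z" using d by (simp add: field_simps)
  have "d * (z - 1) \<le> 1"
    using sums_le[OF _ sums_mult[OF f2, of d] g] powr_diff_bounds(1)[of "real (Suc n)" d for n] d
    by (simp add: fS algebra_simps)
  then show "z \<le> 1 + 1 / d" using d by (simp add: field_simps)
qed

text \<open>The two terms cancel at \<open>d = 0\<close>, and the mean value theorem in
  \<open>d\<close> brings out the factor \<open>d\<close>. The derivative is small because
  \<open>1 / (p - p powr (- z))\<close> and \<open>euler_weight p\<close> both lie between
  \<open>1 / p\<close> and \<open>1 / (p - 1)\<close>.\<close>

lemma twisted_weight_bound:
  assumes p: "p \<ge> 2" and d: "d \<ge> 0"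
  shows "\<bar>euler_weight p * real p powr (- d) + ln (1 - real p powr (- (1 + d)))\<bar>
    \<le> d * (ln (real p) / (real p * (real p - 1)))"
proof (cases "d = 0")
  case True
  then show ?thesis using p by (simp add: euler_weight_def powr_minus field_simps)
next
  case False
  then have d: "d > 0" using assms by simp
  define e where "e x = euler_weight p * real p powr (- x) + ln (1 - real p powr (- (1 + x)))" for x
  define e' where "e' x = real p powr (- x) * ln (real p) * (1 / (real p - real p powr (- x)) - euler_weight p)" for x
  have lt: "real p powr (- x) \<le> 1" if "x \<ge> 0" for x
    using p that by (simp add: powr_minus inverse_le_1_iff ge_one_powr_ge_zero)
  have eq: "real p powr (- (1 + x)) = real p powr (- x) / real p" for x
  proof -
    have "- (1 + x) = - x - 1" by simp
    then show ?thesis using p by (simp only: powr_diff) simp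
  qed
  have lt1: "real p powr (- (1 + x)) < 1" if "x \<ge> 0" for x
    unfolding eq using p lt[OF that] by (simp add: divide_less_eq)
  have "\<exists>z. 0 < z \<and> z < d \<and> e d - e 0 = (d - 0) * e' z"
  proof (rule MVT2[OF d])
    fix x assume x: "0 \<le> x" "x \<le> d"
    have ne: "real p - real p powr (- x) \<noteq> 0" using lt[OF x(1)] p by auto
    have "(e has_real_derivative (- euler_weight p * real p powr (- x) * ln (real p)
        + real p powr (- (1 + x)) * ln (real p) / (1 - real p powr (- (1 + x))))) (at x)"
      unfolding e_def using p lt1[OF x(1)] by (auto intro!: derivative_eq_intros)
    also have "real p powr (- (1 + x)) * ln (real p) / (1 - real p powr (- (1 + x))) =
        real p powr (- x) * ln (real p) * (1 / (real p - real p powr (- x)))"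
      unfolding eq using p ne by (simp add: field_simps)
    finally show "(e has_real_derivative e' x) (at x)" by (simp add: e'_def algebra_simps)
  qed
  then obtain z where z: "0 < z" "z < d" "e d - e 0 = d * e' z" by auto
  have "e 0 = 0" using p by (simp add: e_def euler_weight_def powr_minus field_simps)
  have pz: "1 / real p \<le> 1 / (real p - real p powr (- z))" "1 / (real p - real p powr (- z)) \<le> 1 / (real p - 1)"
    using lt[of z] z p by (auto intro!: divide_left_mono mult_pos_pos)
  have "\<bar>1 / (real p - real p powr (- z)) - euler_weight p\<bar> \<le> 1 / (real p - 1) - 1 / real p"
    using euler_weight_bounds[OF p] pz by linarith
  also have "\<dots> = 1 / (real p * (real p - 1))" using p by (simp add: field_simps)
  finally have *: "\<bar>1 / (real p - real p powr (- z)) - euler_weight p\<bar> \<le> 1 / (real p * (real p - 1))" .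
  have "\<bar>e' z\<bar> = real p powr (- z) * ln (real p) * \<bar>1 / (real p - real p powr (- z)) - euler_weight p\<bar>"
    using p by (simp add: e'_def abs_mult)
  also have "\<dots> \<le> 1 * ln (real p) * (1 / (real p * (real p - 1)))"
    using p z lt[of z] * by (intro mult_mono) auto
  finally have "\<bar>e' z\<bar> \<le> ln (real p) / (real p * (real p - 1))" by simp
  then have "\<bar>d * e' z\<bar> \<le> d * (ln (real p) / (real p * (real p - 1)))"
    using d unfolding abs_mult by (intro mult_mono) auto
  then show ?thesis using z(3) \<open>e 0 = 0\<close> by (simp add: e_def)
qed

text \<open>The logarithm of the finite sieve identity at \<open>s = 1 + d\<close>. The error splits
  into \<open>d * K\<close>, uniform in \<open>n\<close>, and \<open>e n\<close>, the absolute
  logarithm of the sifted series, which tends to 0 for fixed \<open>d\<close>.\<close>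

lemma twisted_sum_tendsto:
  assumes d: "d > 0" and K: "\<And>n. (\<Sum>p\<in>primes_le n. ln (real p) / (real p * (real p - 1))) \<le> K"
  defines "z \<equiv> suminf (sifted_zeta_term (1 + d) {})"
  shows "\<exists>e. e \<longlonglongrightarrow> 0 \<and> (\<forall>n. \<bar>(\<Sum>p\<in>primes_le n. euler_weight p * real p powr (- d)) - ln z\<bar> \<le> d * K + e n)"
proof -
  define y where "y n = suminf (sifted_zeta_term (1 + d) (primes_le n))" for n
  have y: "y \<longlonglongrightarrow> 1" unfolding y_def using d by (intro sifted_zeta_primes_le_tendsto) auto
  have zpos: "z > 0" using less_le_trans[OF _ zeta_real_bounds(1)[OF d], of 0] d unfolding z_def by simp
  have lt1: "real p powr (- (1 + d)) < 1" if "p \<ge> 2" for p :: nat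
    using that d gr_one_powr[of "real p" "1 + d"] by (simp only: powr_minus inverse_less_1_iff) simp
  have "\<bar>(\<Sum>p\<in>primes_le n. euler_weight p * real p powr (- d)) - ln z\<bar> \<le> d * K + \<bar>ln (y n)\<bar>" for n
  proof -
    have fac: "1 - real p powr (- (1 + d)) > 0" if "p \<in> primes_le n" for p
      using lt1[of p] primes_leD(3)[OF that] by simp
    have "y n = z * (\<Prod>p\<in>primes_le n. 1 - real p powr (- (1 + d)))"
      unfolding y_def z_def using d by (intro sifted_zeta_finite) (auto dest: primes_leD)
    moreover have "(\<Prod>p\<in>primes_le n. 1 - real p powr (- (1 + d))) > 0" using fac by (intro prod_pos) auto
    ultimately have "ln (y n) = ln z + ln (\<Prod>p\<in>primes_le n. 1 - real p powr (- (1 + d)))"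
      using zpos by (metis ln_mult_pos)
    also have "ln (\<Prod>p\<in>primes_le n. 1 - real p powr (- (1 + d))) = (\<Sum>p\<in>primes_le n. ln (1 - real p powr (- (1 + d))))"
      by (rule ln_prod) (simp, metis fac less_irrefl)
    finally have "(\<Sum>p\<in>primes_le n. euler_weight p * real p powr (- d)) - ln z =
      (\<Sum>p\<in>primes_le n. euler_weight p * real p powr (- d) + ln (1 - real p powr (- (1 + d)))) - ln (y n)"
      by (simp add: sum.distrib)
    moreover have "\<bar>\<Sum>p\<in>primes_le n. euler_weight p * real p powr (- d) + ln (1 - real p powr (- (1 + d)))\<bar>
      \<le> (\<Sum>p\<in>primes_le n. d * (ln (real p) / (real p * (real p - 1))))"
      using d by (intro order_trans[OF sum_abs] sum_mono twisted_weight_bound) (auto dest: primes_leD)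
    moreover have "\<dots> \<le> d * K" using mult_left_mono[OF K[of n] less_imp_le[OF d]] by (subst sum_distrib_left[symmetric])
    ultimately show ?thesis by linarith
  qed
  moreover have "(\<lambda>n. \<bar>ln (y n)\<bar>) \<longlonglongrightarrow> \<bar>ln 1\<bar>" by (intro tendsto_intros y) auto
  ultimately show ?thesis by (intro exI[of _ "\<lambda>n. \<bar>ln (y n)\<bar>"]) auto
qed

text \<open>Cut-offs that group the primes by \<open>ln p\<close> in unit intervals, so that up to
  rounding a Laplace transform over primes becomes a power series in \<open>exp (- d)\<close>. The
  value 1 at 0 lets the first group start with the prime 2.\<close>

definition exp_floor :: "nat \<Rightarrow> nat" where
  "exp_floor n = nat \<lfloor>exp (real n)\<rfloor>"

lemma exp_floor_mono: "m \<le> n \<Longrightarrow> exp_floor m \<le> exp_floor n"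
  unfolding exp_floor_def by (intro nat_mono floor_mono) simp

lemma le_exp_floor_iff: "p > 0 \<Longrightarrow> p \<le> exp_floor n \<longleftrightarrow> ln (real p) \<le> real n"
  using ln_le_cancel_iff[of "real p" "exp (real n)"]
  by (simp add: exp_floor_def le_nat_iff le_floor_iff del: ln_le_cancel_iff)

lemma exp_floor_0 [simp]: "exp_floor 0 = 1"
  by (simp add: exp_floor_def)

text \<open>The constant is found by comparing the primes, placed at \<open>ln p\<close> with weight \<open>euler_weight p\<close>, with
  the integers, placed at \<open>n\<close> with weight \<open>1/n\<close>: both have Laplace transform \<open>- ln d + o(1)\<close>, so by
  Abel's theorem their partial sums have the same constant term.\<close>

lemma mertens_constant:
  assumes C: "\<And>n. 2 \<le> n \<Longrightarrow>
    \<bar>(\<Sum>p\<in>primes_le n. euler_weight p) - ln (ln (real n)) - c\<bar> \<le> C / ln (real n)"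
  shows "c = euler_mascheroni"
proof -
  \<comment> \<open>\<open>a k\<close> is the prime mass with \<open>k - 1 < ln p \<le> k\<close>,
    \<open>h k\<close> the harmonic mass. Their partial sums are \<open>ln n + c + o(1)\<close> and
    \<open>ln n + euler_mascheroni + o(1)\<close>, so the series of \<open>a - h\<close> converges
    to the difference of the constants; it remains to see that its Abel sum is 0.\<close>
  define a where "a n = (if n = 0 then 0 else \<Sum>p\<in>primes_between (exp_floor (n - 1)) (exp_floor n). euler_weight p)" for n
  define h where "h n = (if n = 0 then 0 else 1 / real n)" for n
  have bin: "(\<Sum>k\<le>n. f k * (if k = 0 then 0 else \<Sum>p\<in>primes_between (exp_floor (k - 1)) (exp_floor k). g p))
     = (\<Sum>k\<in>{1..n}. \<Sum>p\<in>primes_between (exp_floor (k - 1)) (exp_floor k). f k * g p)" for f g :: "nat \<Rightarrow> real" and n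
    by (intro sum.mono_neutral_cong_right) (auto simp: sum_distrib_left)
  have split: "(\<Sum>k\<in>{1..n}. \<Sum>p\<in>primes_between (exp_floor (k - 1)) (exp_floor k). g p) = (\<Sum>p\<in>primes_le (exp_floor n). g p)"
    for g :: "nat \<Rightarrow> real" and n
  proof (induction n)
    case (Suc n)
    then show ?case
      using sum_primes_le_split[of "exp_floor n" "exp_floor (Suc n)" g] exp_floor_mono[of n "Suc n"] by simp
  qed simp
  have partial: "(\<Sum>k\<le>n. a k) = (\<Sum>p\<in>primes_le (exp_floor n). euler_weight p)" for n
    using bin[of "\<lambda>_. 1" "euler_weight" n] split[of euler_weight n] by (simp add: a_def)
  have "(\<lambda>n. (\<Sum>k\<le>n. a k) - (\<Sum>k\<le>n. h k)) \<longlonglongrightarrow> c - euler_mascheroni"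
  proof -
    have top: "filterlim exp_floor at_top sequentially"
      unfolding exp_floor_def by real_asymp
    have "(\<lambda>n. (\<Sum>p\<in>primes_le n. euler_weight p) - ln (ln (real n)) - c) \<longlonglongrightarrow> 0"
    proof (rule Lim_null_comparison)
      show "\<forall>\<^sub>F n in sequentially. norm ((\<Sum>p\<in>primes_le n. euler_weight p) - ln (ln (real n)) - c) \<le> C / ln (real n)"
        using C by (auto intro: eventually_mono[OF eventually_ge_at_top[of 2]])
      show "(\<lambda>n. C / ln (real n)) \<longlonglongrightarrow> 0" by real_asymp
    qed
    from filterlim_compose[OF this top]
    have 1: "(\<lambda>n. (\<Sum>k\<le>n. a k) - ln (ln (real (exp_floor n))) - c) \<longlonglongrightarrow> 0" by (simp add: partial)
    have 2: "(\<lambda>n. ln (ln (real (exp_floor n))) - ln (real n)) \<longlonglongrightarrow> 0"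
      unfolding exp_floor_def by real_asymp
    have h: "(\<Sum>k\<le>n. h k) = harm n" for n
      unfolding harm_def h_def by (intro sum.mono_neutral_cong_right) (auto simp: field_simps)
    have "(\<lambda>n. ((\<Sum>k\<le>n. a k) - ln (ln (real (exp_floor n))) - c) + (ln (ln (real (exp_floor n))) - ln (real n))
       - (harm n - ln (real n)) + c) \<longlonglongrightarrow> 0 + 0 - euler_mascheroni + c"
      by (intro tendsto_intros 1 2 euler_mascheroni_LIMSEQ)
    then show ?thesis by (simp add: h algebra_simps)
  qed
  then have sums: "(\<lambda>n. a n - h n) sums (c - euler_mascheroni)"
    by (simp add: sums_def_le sum_subtractf)
  then have lim1: "((\<lambda>r. \<Sum>n. (a n - h n) * r ^ n) \<longlongrightarrow> c - euler_mascheroni) (at_left 1)"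
    by (rule Abel_limit_at_1)
  obtain K where K: "K > 0" "\<And>n. (\<Sum>p\<in>primes_le n. ln (real p) / (real p * (real p - 1))) \<le> K"
    using bounded_ln_over_p_pm1 by blast
  \<comment> \<open>With \<open>r = exp (- d)\<close> both transforms are compared with
    \<open>- ln d\<close>: the primes through \<open>ln z\<close> with
    \<open>1 / d \<le> z \<le> 1 + 1 / d\<close>, the integers through \<open>- ln (1 - r)\<close>.
    Both bounds tend to 0 with \<open>d\<close>.\<close>
  have bounds: "exp (- d) * (ln (1 / d) - d * K) + ln (1 - exp (- d)) \<le> (\<Sum>n. (a n - h n) * exp (- d) ^ n)"
    "(\<Sum>n. (a n - h n) * exp (- d) ^ n) \<le> ln (1 + 1 / d) + d * K + ln (1 - exp (- d))" if d: "d > 0" for d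
  proof -
    define r where "r = exp (- d)"
    define z where "z = suminf (sifted_zeta_term (1 + d) {})"
    define S where "S n = (\<Sum>p\<in>primes_le (exp_floor n). euler_weight p * real p powr (- d))" for n
    have r: "0 < r" "r < 1" using d by (auto simp: r_def)
    obtain e where e: "e \<longlonglongrightarrow> 0"
      "\<And>n. \<bar>(\<Sum>p\<in>primes_le n. euler_weight p * real p powr (- d)) - ln z\<bar> \<le> d * K + e n"
      using twisted_sum_tendsto[OF d K(2)] unfolding z_def by blast
    have "filterlim exp_floor at_top sequentially"
      unfolding exp_floor_def by real_asymp
    with e(1) have e': "(\<lambda>n. e (exp_floor n)) \<longlonglongrightarrow> 0" by (rule filterlim_compose)
    have S: "ln z - d * K - e (exp_floor n) \<le> S n" "S n \<le> ln z + d * K + e (exp_floor n)" for n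
      using e(2)[of "exp_floor n"] unfolding S_def by linarith+
    have ar: "(\<Sum>k\<le>n. a k * r ^ k) = (\<Sum>k\<in>{1..n}. \<Sum>p\<in>primes_between (exp_floor (k - 1)) (exp_floor k). r ^ k * euler_weight p)" for n
      using bin[of "\<lambda>k. r ^ k" euler_weight n] by (simp add: a_def mult.commute)
    have S': "S n = (\<Sum>k\<in>{1..n}. \<Sum>p\<in>primes_between (exp_floor (k - 1)) (exp_floor k). euler_weight p * real p powr (- d))" for n
      unfolding S_def split ..
    \<comment> \<open>Rounding \<open>ln p\<close> up to \<open>k\<close> costs at most one factor
      \<open>r\<close>, in the end a loss of order \<open>d * ln (1 / d)\<close>.\<close>
    have cmp: "r ^ k \<le> real p powr (- d)" "r * real p powr (- d) \<le> r ^ k" "p \<ge> 2"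
      if "k \<in> {1..n}" "p \<in> primes_between (exp_floor (k - 1)) (exp_floor k)" for k p n
    proof -
      show p: "p \<ge> 2" using that primes_betweenD by auto
      have "ln (real p) \<le> real k" "\<not> ln (real p) \<le> real (k - 1)"
        using primes_betweenD(2,3)[OF that(2)] p by (simp_all only: flip: le_exp_floor_iff)
      then have "ln (real p) \<le> real k" "real k \<le> ln (real p) + 1" using that by auto
      then have "d * ln (real p) \<le> d * real k" "d * real k \<le> d * (ln (real p) + 1)" using d by auto
      then show "r ^ k \<le> real p powr (- d)" "r * real p powr (- d) \<le> r ^ k"
        using p by (auto simp: r_def powr_def algebra_simps simp flip: exp_of_nat_mult exp_add)
    qed
    have up: "(\<Sum>k\<le>n. a k * r ^ k) \<le> S n" for n
      unfolding ar S'
    proof (intro sum_mono)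
      fix k p assume kp: "k \<in> {1..n}" "p \<in> primes_between (exp_floor (k - 1)) (exp_floor k)"
      show "r ^ k * euler_weight p \<le> euler_weight p * real p powr (- d)"
        using cmp[OF kp] euler_weight_pos[of p] by (simp add: mult.commute)
    qed
    have lo: "r * S n \<le> (\<Sum>k\<le>n. a k * r ^ k)" for n
      unfolding ar S' sum_distrib_left
    proof (intro sum_mono)
      fix k p assume kp: "k \<in> {1..n}" "p \<in> primes_between (exp_floor (k - 1)) (exp_floor k)"
      show "r * (euler_weight p * real p powr (- d)) \<le> r ^ k * euler_weight p"
        using mult_left_mono[OF cmp(2)[OF kp], of "euler_weight p"] cmp(3)[OF kp] euler_weight_pos[of p]
        by (simp add: mult_ac)
    qed
    \<comment> \<open>The logarithm series at \<open>1 - r\<close>, shifted by one because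
      \<open>h 0 = 0\<close>.\<close>
    have hs: "(\<lambda>n. h n * r ^ n) sums (- ln (1 - r))"
    proof -
      have "(\<lambda>n. (-1) ^ n * (1 / real (n + 1)) * ((1 - r) - 1) ^ Suc n) sums ln (1 - r)"
      proof -
        have "summable (\<lambda>n. (-1) ^ n * (1 / real (n + 1)) * ((1 - r) - 1) ^ Suc n)"
        proof (rule summable_comparison_test'[where N = 0 and g = "\<lambda>n. r ^ n"])
          fix n
          have "1 / real (n + 1) * r ^ Suc n \<le> 1 * r ^ n"
            using r by (intro mult_mono power_decreasing) auto
          then show "norm ((-1) ^ n * (1 / real (n + 1)) * ((1 - r) - 1) ^ Suc n) \<le> r ^ n"
            using r by (simp add: abs_mult power_abs)
        qed (use r in \<open>auto intro!: summable_geometric\<close>)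
        then show ?thesis using ln_series[of "1 - r"] r by (simp add: sums_iff)
      qed
      then have "(\<lambda>n. - ((-1) ^ n * (1 / real (n + 1)) * ((1 - r) - 1) ^ Suc n)) sums (- ln (1 - r))"
        by (rule sums_minus)
      moreover have "- ((-1) ^ n * (1 / real (n + 1)) * ((1 - r) - 1) ^ Suc n) = h (Suc n) * r ^ Suc n" for n
      proof -
        have "(- r) ^ Suc n = - ((-1) ^ n * r ^ Suc n)" by (simp add: power_minus[of r])
        then show ?thesis by (simp add: h_def mult.assoc flip: power_mult_distrib)
      qed
      ultimately have "(\<lambda>n. h (Suc n) * r ^ Suc n) sums (- ln (1 - r))" by simp
      then show ?thesis by (subst (asm) sums_Suc_iff) (simp add: h_def)
    qed
    have "summable (\<lambda>n. (a n - h n) * r ^ n)"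
    proof (rule powser_inside)
      show "summable (\<lambda>n. (a n - h n) * 1 ^ n)" using sums by (simp add: sums_iff)
      show "norm r < norm (1 :: real)" using r by simp
    qed
    then have "(\<lambda>n. (a n - h n) * r ^ n + h n * r ^ n) sums ((\<Sum>n. (a n - h n) * r ^ n) + - ln (1 - r))"
      by (intro sums_add summable_sums hs)
    then have "(\<lambda>n. a n * r ^ n) sums ((\<Sum>n. (a n - h n) * r ^ n) - ln (1 - r))"
      by (simp add: algebra_simps)
    then have lima: "(\<lambda>n. \<Sum>k\<le>n. a k * r ^ k) \<longlonglongrightarrow> (\<Sum>n. (a n - h n) * r ^ n) - ln (1 - r)"
      by (simp add: sums_def_le)
    have "(\<lambda>n. ln z + d * K + e (exp_floor n)) \<longlonglongrightarrow> ln z + d * K + 0" by (intro tendsto_intros e')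
    from LIMSEQ_le[OF lima this] have A: "(\<Sum>n. (a n - h n) * r ^ n) - ln (1 - r) \<le> ln z + d * K"
      using order_trans[OF up S(2)] by auto
    have "(\<lambda>n. r * (ln z - d * K - e (exp_floor n))) \<longlonglongrightarrow> r * (ln z - d * K - 0)" by (intro tendsto_intros e')
    from LIMSEQ_le[OF this lima] have B: "r * (ln z - d * K) \<le> (\<Sum>n. (a n - h n) * r ^ n) - ln (1 - r)"
      using order_trans[OF mult_left_mono[OF S(1), of r] lo] r by auto
    have zb: "1 / d \<le> z" "z \<le> 1 + 1 / d" using zeta_real_bounds[OF d] by (auto simp: z_def)
    moreover have "1 / d > 0" using d by simp
    ultimately have "ln (1 / d) \<le> ln z" "ln z \<le> ln (1 + 1 / d)"
      by (intro ln_mono; linarith)+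
    moreover from this have "r * (ln (1 / d) - d * K) \<le> r * (ln z - d * K)" using r by (intro mult_left_mono) auto
    ultimately show "exp (- d) * (ln (1 / d) - d * K) + ln (1 - exp (- d)) \<le> (\<Sum>n. (a n - h n) * exp (- d) ^ n)"
      "(\<Sum>n. (a n - h n) * exp (- d) ^ n) \<le> ln (1 + 1 / d) + d * K + ln (1 - exp (- d))"
      using A B unfolding r_def by linarith+
  qed
  have "((\<lambda>d. \<Sum>n. (a n - h n) * exp (- d) ^ n) \<longlongrightarrow> 0) (at_right 0)"
  proof (rule tendsto_sandwich)
    show "\<forall>\<^sub>F d in at_right 0. exp (- d) * (ln (1 / d) - d * K) + ln (1 - exp (- d)) \<le> (\<Sum>n. (a n - h n) * exp (- d) ^ n)"
      "\<forall>\<^sub>F d in at_right 0. (\<Sum>n. (a n - h n) * exp (- d) ^ n) \<le> ln (1 + 1 / d) + d * K + ln (1 - exp (- d))"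
      using bounds by (auto simp: eventually_at_right_less eventually_at_filter intro!: always_eventually)
    show "((\<lambda>d. exp (- d) * (ln (1 / d) - d * K) + ln (1 - exp (- d))) \<longlongrightarrow> 0) (at_right 0)" by real_asymp
    show "((\<lambda>d. ln (1 + 1 / d) + d * K + ln (1 - exp (- d))) \<longlongrightarrow> 0) (at_right 0)" by real_asymp
  qed
  moreover have "((\<lambda>d. \<Sum>n. (a n - h n) * exp (- d) ^ n) \<longlongrightarrow> c - euler_mascheroni) (at_right 0)"
  proof (rule filterlim_compose[OF lim1])
    show "filterlim (\<lambda>d::real. exp (- d)) (at_left 1) (at_right 0)" by real_asymp
  qed
  ultimately have "c - euler_mascheroni = 0"
    by (intro tendsto_unique[OF trivial_limit_at_right_real])
  then show ?thesis by simp
qed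

theorem mertens_third:
  obtains C where "C > 0" "\<And>n. 2 \<le> n \<Longrightarrow>
    \<bar>(\<Sum>p\<in>primes_le n. euler_weight p) - ln (ln (real n)) - euler_mascheroni\<bar> \<le> C / ln (real n)"
proof -
  obtain c C where C: "C > 0" "\<And>n. 2 \<le> n \<Longrightarrow>
    \<bar>(\<Sum>p\<in>primes_le n. euler_weight p) - ln (ln (real n)) - c\<bar> \<le> C / ln (real n)"
    using mertens_second by blast
  from mertens_constant[OF C(2)] C that[of C] show ?thesis by simp
qed

section \<open>Sums over large primes\<close>

lemma sum_inverse_square_Ioc:
  assumes "m \<ge> 1" "m \<le> n"
  shows "(\<Sum>k\<in>{m<..n}. 1 / real k ^ 2) \<le> 1 / real m - 1 / real n"
  using assms(2)
proof (induction n rule: dec_induct)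
  case (step n)
  have "{m<..Suc n} = insert (Suc n) {m<..n}" using step by auto
  moreover have "1 / real (Suc n) ^ 2 \<le> 1 / real n - 1 / real (Suc n)"
  proof -
    have n: "real n > 0" using step assms by simp
    have "1 / real (Suc n) ^ 2 \<le> 1 / (real n * real (Suc n))"
      using n by (intro divide_left_mono) (auto simp: power2_eq_square intro!: mult_right_mono)
    also have "\<dots> = 1 / real n - 1 / real (Suc n)" using n by (simp add: field_simps)
    finally show ?thesis .
  qed
  ultimately show ?case using step by simp
qed simp

lemma sum_primes_between_inverse_square:
  assumes "m \<ge> 1"
  shows "(\<Sum>p\<in>primes_between m n. 1 / real p ^ 2) \<le> 1 / real m"
proof (cases "m \<le> n")
  case True
  have "(\<Sum>p\<in>primes_between m n. 1 / real p ^ 2) \<le> (\<Sum>k\<in>{m<..n}. 1 / real k ^ 2)"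
    by (rule sum_mono2) (auto simp: primes_between_def)
  also have "\<dots> \<le> 1 / real m - 1 / real n" using sum_inverse_square_Ioc[OF assms True] .
  also have "\<dots> \<le> 1 / real m" by simp
  finally show ?thesis .
next
  case False
  then have "primes_between m n = {}" by (auto simp: primes_between_def)
  then show ?thesis by simp
qed

text \<open>Above \<open>sqrt n\<close> every prime has \<open>ln p \<ge> ln n / 2\<close>, so
  counting primes there costs \<open>2 / ln n\<close> times Chebyshev's function. Below there are at
  most \<open>sqrt n\<close> integers.\<close>

lemma chebyshev_prime_count:
  obtains C where "C > 0" "\<And>n. 2 \<le> n \<Longrightarrow> real (card (primes_le n)) \<le> C * real n / ln (real n)"
proof -
  have "real (card (primes_le n)) \<le> (2 + 2 * ln 4) * real n / ln (real n)" if n: "2 \<le> n" for n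
  proof -
    let ?L = "ln (real n)"
    define r where "r = nat \<lfloor>sqrt (real n)\<rfloor>"
    have L: "?L > 0" using n by simp
    have r: "real r \<le> sqrt (real n)" "sqrt (real n) < real r + 1" unfolding r_def by (auto simp: of_nat_nat)
    have "sqrt (real n) \<ge> 1" using n by simp
    then have "r \<ge> 1" unfolding r_def by (simp add: le_nat_iff)
    have rn: "r \<le> n"
    proof -
      have "sqrt (real n) \<le> real n" using n sqrt_le_D[of "real n" "real n"] by (intro real_le_lsqrt) (auto simp: power2_eq_square)
      then show ?thesis using r by linarith
    qed
    have "real (card (primes_le n)) = (\<Sum>p\<in>primes_le n. 1)" by simp
    also have "\<dots> = (\<Sum>p\<in>primes_le r. 1) + (\<Sum>p\<in>primes_between r n. 1)"
      by (rule sum_primes_le_split[OF rn])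
    also have "(\<Sum>p\<in>primes_le r. 1) \<le> (\<Sum>p\<in>{1..r}. (1 :: real))"
      by (intro sum_mono2) (auto simp: primes_le_def dest: prime_ge_1_nat)
    also have "\<dots> \<le> sqrt (real n)" using r by simp
    also have "(\<Sum>p\<in>primes_between r n. 1) \<le> (\<Sum>p\<in>primes_between r n. ln (real p) * (2 / ?L))"
    proof (intro sum_mono)
      fix p assume "p \<in> primes_between r n"
      then have "real r + 1 \<le> real p" using primes_betweenD(2) by fastforce
      then have "sqrt (real n) \<le> real p" using r by linarith
      then have "ln (sqrt (real n)) \<le> ln (real p)" using n by (intro ln_mono) auto
      then have "?L / 2 \<le> ln (real p)" using n by (simp add: ln_sqrt)
      then show "1 \<le> ln (real p) * (2 / ?L)" using L by (simp add: field_simps)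
    qed
    also have "\<dots> \<le> chebyshev_theta n * (2 / ?L)"
      unfolding chebyshev_theta_def sum_distrib_right[symmetric]
      using L by (intro mult_right_mono sum_mono2) (auto simp: primes_between_def primes_le_def dest: prime_ge_1_nat)
    also have "\<dots> \<le> real n * ln 4 * (2 / ?L)"
      using L theta_le[of n] by (intro mult_right_mono) auto
    also have "sqrt (real n) \<le> 2 * real n / ?L"
    proof -
      have "ln (sqrt (real n)) \<le> sqrt (real n) - 1" using n by (intro ln_le_minus_one) auto
      then have "?L \<le> 2 * sqrt (real n)" using n by (simp add: ln_sqrt)
      then have "sqrt (real n) * ?L \<le> sqrt (real n) * (2 * sqrt (real n))" by (intro mult_left_mono) auto
      also have "\<dots> = 2 * real n" by simp
      finally show ?thesis using L by (simp add: field_simps)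
    qed
    finally show ?thesis by (simp add: add_divide_distrib algebra_simps)
  qed
  moreover have "2 + 2 * ln 4 > (0 :: real)" using ln_gt_zero[of "4 :: real"] by linarith
  ultimately show ?thesis using that by blast
qed

text \<open>Chebyshev's bound saves a factor \<open>ln m\<close> over the sum over all integers. The
  upper bound for \<open>Phi\<close> needs it: otherwise the cost of the tail would drop by a factor
  of order \<open>\<tau>\<close>, that is by \<open>l\<close> in the final exponent, more than is
  allowed for small \<open>\<theta>\<close>.\<close>

lemma prime_square_tail:
  obtains C where "C > 0"
    "\<And>m n. 2 \<le> m \<Longrightarrow> (\<Sum>p\<in>primes_between m n. 1 / real p ^ 2) \<le> C / (real m * ln (real m))"
proof -
  have "(\<Sum>p\<in>primes_between m n. 1 / real p ^ 2) \<le> (4 * ln 4) / (real m * ln (real m))" if m: "2 \<le> m" for m n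
  proof (cases "m \<le> n")
    case True
    have L: "ln (real m) > 0" using m by simp
    have "(\<Sum>p\<in>primes_between m n. 1 / real p ^ 2) \<le> (\<Sum>p\<in>primes_between m n. ln (real p) / real p ^ 2 / ln (real m))"
    proof (intro sum_mono)
      fix p assume p: "p \<in> primes_between m n"
      have "ln (real m) \<le> ln (real p)" using primes_betweenD(2)[OF p] m by (intro ln_mono) auto
      then have "1 \<le> ln (real p) / ln (real m)" using L by (simp add: field_simps)
      then have "1 / real p ^ 2 * 1 \<le> 1 / real p ^ 2 * (ln (real p) / ln (real m))" by (intro mult_left_mono) auto
      then show "1 / real p ^ 2 \<le> ln (real p) / real p ^ 2 / ln (real m)" by (simp add: mult.commute)
    qed
    also have "\<dots> = (\<Sum>p\<in>primes_between m n. ln (real p) / real p ^ 2) / ln (real m)"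
      by (simp add: sum_divide_distrib)
    also have "(\<Sum>p\<in>primes_between m n. ln (real p) / real p ^ 2) =
      (\<Sum>k\<in>{m<..n}. (chebyshev_theta k - chebyshev_theta (k - 1)) * (1 / real k ^ 2))"
      unfolding sum_primes_between_conv
    proof (rule sum.cong)
      fix k assume "k \<in> {m<..n}"
      then obtain j where j: "k = Suc j" by (cases k) auto
      have "Suc j \<notin> primes_le j" by (auto simp: primes_le_def)
      then show "(if prime k then ln (real k) / real k ^ 2 else 0) =
        (chebyshev_theta k - chebyshev_theta (k - 1)) * (1 / real k ^ 2)"
        unfolding j by (simp add: chebyshev_theta_def primes_le_Suc)
    qed simp
    also have "\<dots> = chebyshev_theta n * (1 / real (Suc n) ^ 2) - chebyshev_theta m * (1 / real (Suc m) ^ 2)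
      + (\<Sum>k\<in>{m<..n}. chebyshev_theta k * (1 / real k ^ 2 - 1 / real (Suc k) ^ 2))"
      by (rule abel_summation[OF True])
    \<comment> \<open>The difference of the weights is of order \<open>1 / k^3\<close>; against
      Chebyshev's linear bound this leaves \<open>1 / k^2\<close>, whose sum is at most
      \<open>1 / m\<close>.\<close>
    also have "(\<Sum>k\<in>{m<..n}. chebyshev_theta k * (1 / real k ^ 2 - 1 / real (Suc k) ^ 2)) \<le>
       (\<Sum>k\<in>{m<..n}. 3 * ln 4 * (1 / real k ^ 2))"
    proof (intro sum_mono)
      fix k assume "k \<in> {m<..n}"
      then have k: "k \<ge> 1" by auto
      have "1 / real k ^ 2 - 1 / real (Suc k) ^ 2 = (2 * real k + 1) / (real k ^ 2 * real (Suc k) ^ 2)"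
        using k by (simp add: divide_simps) (simp add: power2_eq_square algebra_simps)
      also have "\<dots> \<le> (3 * real k) / (real k ^ 2 * real k ^ 2)"
        using k by (intro frac_le mult_left_mono power_mono) auto
      also have "\<dots> = 3 / real k * (1 / real k ^ 2)" using k by (simp add: power2_eq_square)
      finally have *: "1 / real k ^ 2 - 1 / real (Suc k) ^ 2 \<le> 3 / real k * (1 / real k ^ 2)" .
      have "chebyshev_theta k * (1 / real k ^ 2 - 1 / real (Suc k) ^ 2) \<le>
         chebyshev_theta k * (3 / real k * (1 / real k ^ 2))"
        using theta_nonneg[of k] * by (intro mult_left_mono) auto
      also have "\<dots> \<le> (real k * ln 4) * (3 / real k * (1 / real k ^ 2))"
        using theta_le[of k] by (intro mult_right_mono) auto
      also have "\<dots> = 3 * ln 4 * (1 / real k ^ 2)" using k by simp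
      finally show "chebyshev_theta k * (1 / real k ^ 2 - 1 / real (Suc k) ^ 2) \<le> 3 * ln 4 * (1 / real k ^ 2)" .
    qed
    also have "\<dots> = 3 * ln 4 * (\<Sum>k\<in>{m<..n}. 1 / real k ^ 2)" by (simp only: sum_distrib_left)
    also have "\<dots> \<le> 3 * ln 4 * (1 / real m)"
    proof (intro mult_left_mono)
      show "(\<Sum>k\<in>{m<..n}. 1 / real k ^ 2) \<le> 1 / real m"
        using sum_inverse_square_Ioc[of m n] True m by (smt (verit) divide_nonneg_nonneg of_nat_0_le_iff one_le_numeral order_trans)
      show "0 \<le> 3 * ln (4 :: real)" using ln_gt_zero[of "4 :: real"] by simp
    qed
    also have "chebyshev_theta n * (1 / real (Suc n) ^ 2) \<le> ln 4 * (1 / real m)"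
    proof -
      have "chebyshev_theta n * (1 / real (Suc n) ^ 2) \<le> (real n * ln 4) * (1 / real n ^ 2)"
        using theta_le[of n] theta_nonneg[of n] m True by (intro mult_mono divide_left_mono power_mono) auto
      also have "\<dots> = ln 4 * (1 / real n)" using m True by (simp add: power2_eq_square)
      also have "\<dots> \<le> ln 4 * (1 / real m)"
        using m True ln_gt_zero[of "4 :: real"] by (intro mult_left_mono divide_left_mono) auto
      finally show ?thesis .
    qed
    finally have "(\<Sum>p\<in>primes_between m n. 1 / real p ^ 2) \<le>
      (ln 4 * (1 / real m) - chebyshev_theta m * (1 / real (Suc m) ^ 2) + 3 * ln 4 * (1 / real m)) / ln (real m)"
      using L by (simp add: divide_right_mono)
    also have "\<dots> \<le> (4 * ln 4 * (1 / real m)) / ln (real m)"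
      using L theta_nonneg[of m] by (intro divide_right_mono) auto
    finally show ?thesis by simp
  next
    case False
    then have "primes_between m n = {}" by (auto simp: primes_between_def)
    then show ?thesis using m ln_gt_zero[of "4 :: real"] by simp
  qed
  moreover have "4 * ln 4 > (0 :: real)" using ln_gt_zero[of "4 :: real"] by linarith
  ultimately show ?thesis using that by blast
qed

text \<open>A change by \<open>O(1 / p^2)\<close> alters the sum by a bounded amount only. The exact
  constant is given up: these sums will be multiplied by a squared angle or by a sine.\<close>

lemma mertens_perturbed:
  assumes f: "\<And>p. p \<ge> 2 \<Longrightarrow> \<bar>f p - 1 / real p\<bar> \<le> K / real p ^ 2" and "K \<ge> 0"
  obtains C where "C > 0" "\<And>n. 2 \<le> n \<Longrightarrow> \<bar>(\<Sum>p\<in>primes_le n. f p) - ln (ln (real n))\<bar> \<le> C"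
proof -
  obtain C where C: "C > 0" "\<And>n. 2 \<le> n \<Longrightarrow>
    \<bar>(\<Sum>p\<in>primes_le n. euler_weight p) - ln (ln (real n)) - euler_mascheroni\<bar> \<le> C / ln (real n)"
    using mertens_third by blast
  have "\<bar>(\<Sum>p\<in>primes_le n. f p) - ln (ln (real n))\<bar> \<le> (K + 2) + C / ln 2 + \<bar>euler_mascheroni\<bar>" if n: "2 \<le> n" for n
  proof -
    have fw: "\<bar>f p - euler_weight p\<bar> \<le> (K + 2) * (1 / real p ^ 2)" if "p \<in> primes_le n" for p
    proof -
      have p: "p \<ge> 2" using primes_leD(3)[OF that] .
      have "1 / (real p - 1) \<le> 1 / real p + 2 / real p ^ 2"
        using p by (simp add: field_simps power2_eq_square)
      then show ?thesis using f[OF p] euler_weight_bounds[OF p] by (simp add: add_divide_distrib)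
    qed
    have "\<bar>(\<Sum>p\<in>primes_le n. f p) - (\<Sum>p\<in>primes_le n. euler_weight p)\<bar> \<le> (\<Sum>p\<in>primes_le n. (K + 2) * (1 / real p ^ 2))"
      unfolding sum_subtractf[symmetric] by (intro order_trans[OF sum_abs] sum_mono fw)
    also have "primes_le n = primes_between 1 n" by (auto simp: primes_le_def primes_between_def dest: prime_gt_1_nat)
    also have "(\<Sum>p\<in>primes_between 1 n. (K + 2) * (1 / real p ^ 2)) \<le> (K + 2) * 1"
      using sum_primes_between_inverse_square[of 1 n] \<open>K \<ge> 0\<close>
      by (simp only: flip: sum_distrib_left) (intro mult_left_mono, auto)
    finally have 1: "\<bar>(\<Sum>p\<in>primes_le n. f p) - (\<Sum>p\<in>primes_le n. euler_weight p)\<bar> \<le> K + 2"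
      by (simp add: \<open>primes_le n = primes_between 1 n\<close>)
    have "C / ln (real n) \<le> C / ln 2" using C n by (intro divide_left_mono) auto
    then show ?thesis using C(2)[OF n] 1 by linarith
  qed
  moreover have "(K + 2) + C / ln 2 + \<bar>euler_mascheroni\<bar> > 0"
    using divide_pos_pos[OF C(1) ln_gt_zero[of 2]] \<open>K \<ge> 0\<close> by linarith
  ultimately show ?thesis using that by blast
qed

section \<open>Random sums over primes\<close>

locale steinhaus = prob_space M for M :: "'a measure" +
  fixes X :: "nat \<Rightarrow> 'a \<Rightarrow> complex"
  assumes indep: "indep_vars (\<lambda>_. borel) X {p. prime p}"
    and distr_X: "\<And>p. prime p \<Longrightarrow> distr M borel (X p) = circle_uniform"

section \<open>The uniform distribution on the circle\<close>

lemma emeasure_Ico_2pi: "emeasure lborel {0..<2 * pi} = ennreal (2 * pi)"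
  by (simp add: emeasure_lborel_Ico)

lemma cis_measurable [measurable]: "cis \<in> borel_measurable borel"
  by (intro borel_measurable_continuous_onI continuous_intros) 

lemma AE_circle_uniform: "AE z in circle_uniform. cmod z = 1"
proof -
  have "AE x in uniform_measure lborel {0..<2 * pi}. cmod (cis x) = 1" by simp
  then show ?thesis unfolding circle_uniform_def by (subst AE_distr_iff) auto
qed

lemma integral_circle_uniform:
  "(\<integral>z. a * Re z + b * Im z \<partial>circle_uniform) = 0"
proof -
  let ?F = "\<lambda>x. (a * sin x - b * cos x) / (2 * pi)"
  have "(\<integral>z. a * Re z + b * Im z \<partial>circle_uniform) =
      (\<integral>x. a * cos x + b * sin x \<partial>uniform_measure lborel {0..<2 * pi})"
    unfolding circle_uniform_def by (subst integral_distr) auto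
  also have "uniform_measure lborel {0..<2 * pi} = density lborel (\<lambda>x. ennreal (indicat_real {0..<2 * pi} x / (2 * pi)))"
    unfolding uniform_measure_def emeasure_Ico_2pi
    by (intro density_cong) (auto simp: indicator_def divide_ennreal[symmetric])
  also have "(\<integral>x. a * cos x + b * sin x \<partial>\<dots>) = (\<integral>x. (indicat_real {0..<2 * pi} x / (2 * pi)) * (a * cos x + b * sin x) \<partial>lborel)"
    by (subst integral_real_density) auto
  also have "\<dots> = (\<integral>x. ((a * cos x + b * sin x) / (2 * pi)) * indicat_real {0..2 * pi} x \<partial>lborel)"
  proof (rule integral_cong_AE)
    show "AE x in lborel. (indicat_real {0..<2 * pi} x / (2 * pi)) * (a * cos x + b * sin x) =
       ((a * cos x + b * sin x) / (2 * pi)) * indicat_real {0..2 * pi} x"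
      using AE_lborel_singleton[of "2 * pi"] by eventually_elim (auto simp: indicator_def)
  qed auto
  also have "\<dots> = ?F (2 * pi) - ?F 0"
    by (rule integral_FTC_Icc_real) (auto intro!: derivative_eq_intros continuous_intros simp: field_simps)
  finally show ?thesis by simp
qed

text \<open>An inequality suffices, as the preimage of the arc under \<open>cis\<close> contains
  \<open>{u..v}\<close>; injectivity of \<open>cis\<close> does not enter.\<close>

lemma measure_circle_uniform_arc:
  assumes "0 \<le> u" "u \<le> v" "v < 2 * pi"
  shows "measure circle_uniform (cis ` {u..v}) \<ge> (v - u) / (2 * pi)"
proof -
  have K: "cis ` {u..v} \<in> sets borel"
    by (intro borel_compact compact_continuous_image continuous_intros) auto
  then have V: "cis -` (cis ` {u..v}) \<in> sets borel"
    using measurable_sets[OF cis_measurable K] by simp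
  have "measure circle_uniform (cis ` {u..v}) = measure (uniform_measure lborel {0..<2 * pi}) (cis -` (cis ` {u..v}))"
    unfolding circle_uniform_def using K by (subst measure_distr) auto
  also have "\<dots> = measure lborel ({0..<2 * pi} \<inter> cis -` (cis ` {u..v})) / measure lborel {0..<2 * pi}"
    using V by (intro measure_uniform_measure) auto
  also have "\<dots> \<ge> measure lborel {u..v} / measure lborel {0..<2 * pi}"
  proof (intro divide_right_mono measure_mono_fmeasurable fmeasurableI)
    have "emeasure lborel ({0..<2 * pi} \<inter> cis -` (cis ` {u..v})) \<le> emeasure lborel {0..<2 * pi}"
      by (intro emeasure_mono) auto
    also have "\<dots> < \<infinity>" by (simp add: emeasure_lborel_Ico)
    finally show "emeasure lborel ({0..<2 * pi} \<inter> cis -` (cis ` {u..v})) < \<infinity>" .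
    show "{u..v} \<subseteq> {0..<2 * pi} \<inter> cis -` cis ` {u..v}" using assms by auto
    show "{0..<2 * pi} \<inter> cis -` cis ` {u..v} \<in> sets lborel" using V by auto
  qed auto
  finally show ?thesis using assms by simp
qed

section \<open>Hoeffding's inequality for blocks of primes\<close>

context steinhaus
begin

lemma X_measurable [measurable (raw)]: "prime p \<Longrightarrow> X p \<in> borel_measurable M"
  using indep unfolding indep_vars_def by auto

lemma AE_unit: "AE \<omega> in M. \<forall>p. prime p \<longrightarrow> cmod (X p \<omega>) = 1"
proof -
  have "AE \<omega> in M. cmod (X p \<omega>) = 1" if "prime p" for p
  proof -
    have "AE z in distr M borel (X p). cmod z = 1" unfolding distr_X[OF that] by (rule AE_circle_uniform)
    then show ?thesis using X_measurable[OF that] by (subst (asm) AE_distr_iff) auto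
  qed
  then have "AE \<omega> in M. prime p \<longrightarrow> cmod (X p \<omega>) = 1" for p by (cases "prime p") auto
  then show ?thesis by (simp add: AE_all_countable)
qed

lemma expectation_X_comb:
  assumes "prime p"
  shows "expectation (\<lambda>\<omega>. a * Re (X p \<omega>) + b * Im (X p \<omega>)) = 0"
proof -
  have "expectation (\<lambda>\<omega>. a * Re (X p \<omega>) + b * Im (X p \<omega>)) = (\<integral>z. a * Re z + b * Im z \<partial>distr M borel (X p))"
    using X_measurable[OF assms] by (subst integral_distr) auto
  then show ?thesis using integral_circle_uniform distr_X[OF assms] by simp
qed

text \<open>The linear part of the logarithm of the Euler product. It carries the conditional
  convergence and the probability estimates; the nonlinear rest converges absolutely.\<close>

definition prime_sum :: "nat \<Rightarrow> 'a \<Rightarrow> complex" where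
  "prime_sum n \<omega> = (\<Sum>p\<in>primes_le n. X p \<omega> / of_nat p)"

lemma prime_sum_measurable [measurable]: "prime_sum n \<in> borel_measurable M"
  unfolding prime_sum_def[abs_def] by (intro borel_measurable_sum borel_measurable_divide) (auto dest: primes_leD)

lemma prime_sum_diff: "m \<le> n \<Longrightarrow> prime_sum n \<omega> - prime_sum m \<omega> = (\<Sum>p\<in>primes_between m n. X p \<omega> / of_nat p)"
  unfolding prime_sum_def by (simp add: sum_primes_le_split)

text \<open>By Cauchy-Schwarz each term lies within \<open>sqrt (a^2 + b^2) / p\<close> of its mean
  0. A free direction \<open>(a, b)\<close> serves the tilted functional as well as single
  coordinates, and a free \<open>V\<close> admits both the crude and the sharp bound for the tail of
  \<open>1 / p^2\<close>.\<close>

lemma hoeffding_tail: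
  assumes "u > 0" "m \<le> n" and V: "(\<Sum>p\<in>primes_between m n. 1 / real p ^ 2) \<le> V" and ab: "a\<^sup>2 + b\<^sup>2 > 0"
  shows "prob {\<omega>\<in>space M. a * Re (prime_sum n \<omega> - prime_sum m \<omega>) + b * Im (prime_sum n \<omega> - prime_sum m \<omega>) \<ge> u}
    \<le> exp (- u\<^sup>2 / (2 * (a\<^sup>2 + b\<^sup>2) * V))"
proof (cases "primes_between m n = {}")
  \<comment> \<open>The variance is zero, so Hoeffding's inequality is not invoked; the event is
    empty because \<open>u > 0\<close>.\<close>
  case True
  then show ?thesis using assms by (simp add: prime_sum_diff)
next
  case False
  define r where "r = sqrt (a\<^sup>2 + b\<^sup>2)"
  have r: "r > 0" "r\<^sup>2 = a\<^sup>2 + b\<^sup>2" using ab by (auto simp: r_def)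
  let ?I = "primes_between m n"
  define Y where "Y p \<omega> = (a * Re (X p \<omega>) + b * Im (X p \<omega>)) / real p" for p \<omega>
  interpret H: Hoeffding_ineq M ?I Y "\<lambda>p. - r / real p" "\<lambda>p. r / real p" "\<Sum>p\<in>?I. expectation (Y p)"
  proof unfold_locales
    have "indep_vars (\<lambda>_. borel) X ?I"
      by (rule indep_vars_subset[OF indep]) (auto dest: primes_betweenD)
    then show "indep_vars (\<lambda>_. borel) Y ?I"
      unfolding Y_def by (rule indep_vars_compose2[where Y = "\<lambda>p z. (a * Re z + b * Im z) / real p"]) measurable
    fix p assume p: "p \<in> ?I"
    show "AE \<omega> in M. Y p \<omega> \<in> {- r / real p..r / real p}"
      using AE_unit
    proof eventually_elim
      case (elim \<omega>)
      then have c: "cmod (X p \<omega>) = 1" using primes_betweenD[OF p] by auto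
      have "\<bar>a * Re (X p \<omega>) + b * Im (X p \<omega>)\<bar> = \<bar>(a, b) \<bullet> (Re (X p \<omega>), Im (X p \<omega>))\<bar>" by simp
      also have "\<dots> \<le> norm (a, b) * norm (Re (X p \<omega>), Im (X p \<omega>))" by (rule Cauchy_Schwarz_ineq2)
      also have "\<dots> = r" using c by (simp add: norm_Pair r_def cmod_def)
      finally have "\<bar>Y p \<omega>\<bar> \<le> r / real p" unfolding Y_def by (simp add: divide_right_mono)
      then show ?case by auto
    qed
  qed auto
  have EY: "expectation (Y p) = 0" if "p \<in> ?I" for p
    using expectation_X_comb[of p a b] primes_betweenD[OF that] unfolding Y_def by simp
  have sq: "(\<Sum>p\<in>?I. (r / real p - - r / real p)\<^sup>2) = 4 * (a\<^sup>2 + b\<^sup>2) * (\<Sum>p\<in>?I. 1 / real p ^ 2)"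
    unfolding sum_distrib_left r(2)[symmetric] by (intro sum.cong) (auto simp: power2_eq_square)
  have Vpos: "(\<Sum>p\<in>?I. 1 / real p ^ 2) > 0"
    using False by (intro sum_pos) (auto dest!: primes_betweenD)
  have sumY: "(\<Sum>p\<in>?I. Y p \<omega>) = a * Re (prime_sum n \<omega> - prime_sum m \<omega>) + b * Im (prime_sum n \<omega> - prime_sum m \<omega>)" for \<omega>
    unfolding prime_sum_diff[OF assms(2)] Y_def by (simp add: sum_distrib_left sum.distrib add_divide_distrib)
  have "prob {\<omega>\<in>space M. (\<Sum>p\<in>?I. Y p \<omega>) \<ge> (\<Sum>p\<in>?I. expectation (Y p)) + u} \<le>
     exp (- 2 * u\<^sup>2 / (\<Sum>p\<in>?I. (r / real p - - r / real p)\<^sup>2))"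
    using assms(1) by (intro H.Hoeffding_ineq_ge) (use sq Vpos ab in auto)
  also have "- 2 * u\<^sup>2 / (\<Sum>p\<in>?I. (r / real p - - r / real p)\<^sup>2) = - (u\<^sup>2 / (2 * (a\<^sup>2 + b\<^sup>2) * (\<Sum>p\<in>?I. 1 / real p ^ 2)))"
  proof -
    have "- 2 * u\<^sup>2 / (4 * c * S) = - (u\<^sup>2 / (2 * c * S))" for c S :: real by (simp add: divide_simps)
    then show ?thesis unfolding sq .
  qed
  also have "exp \<dots> \<le> exp (- (u\<^sup>2 / (2 * (a\<^sup>2 + b\<^sup>2) * V)))"
    using V Vpos ab by (simp, intro divide_left_mono mult_left_mono mult_pos_pos) auto
  finally show ?thesis by (simp add: sumY EY)
qed

end

section \<open>Almost sure convergence of the linear series\<close>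

lemma convergent_if_dyadic_blocks:
  fixes t :: "nat \<Rightarrow> 'a :: banach"
  assumes e: "summable e" and blk: "\<And>k n. k \<ge> k0 \<Longrightarrow> 2 ^ k \<le> n \<Longrightarrow> n \<le> 2 ^ Suc k \<Longrightarrow> norm (t n - t (2 ^ k)) \<le> e k"
  shows "convergent t"
proof -
  have "summable (\<lambda>k. t (2 ^ Suc k) - t (2 ^ k))"
    by (rule summable_comparison_test'[OF e, where N = k0]) (rule blk; simp)
  then have "convergent (\<lambda>n. \<Sum>k<n. t (2 ^ Suc k) - t (2 ^ k))" by (simp add: summable_iff_convergent)
  then have "convergent (\<lambda>n. t (2 ^ n) - t (2 ^ 0))" by (subst (asm) sum_lessThan_telescope)
  then obtain l where "(\<lambda>n. t (2 ^ n) - t (2 ^ 0)) \<longlonglongrightarrow> l" by (auto simp: convergent_def)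
  then have "(\<lambda>n. t (2 ^ n) - t (2 ^ 0) + t (2 ^ 0)) \<longlonglongrightarrow> l + t (2 ^ 0)" by (intro tendsto_intros)
  then have l: "(\<lambda>n. t (2 ^ n)) \<longlonglongrightarrow> l + t (2 ^ 0)" by simp
  have fl: "filterlim (\<lambda>n::nat. floor_log n) at_top sequentially"
    unfolding filterlim_at_top
  proof
    fix K :: nat
    show "eventually (\<lambda>n. K \<le> floor_log n) sequentially"
    proof (rule eventually_mono[OF eventually_ge_at_top[of "2 ^ K"]])
      fix n :: nat assume "2 ^ K \<le> n"
      then show "K \<le> floor_log n" using monoD[OF floor_log_mono, of "2 ^ K" n] by simp
    qed
  qed
  \<comment> \<open>\<open>2 ^ floor_log n\<close> is the start of the dyadic block containing
    \<open>n\<close>.\<close>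
  have "(\<lambda>n. t n - t (2 ^ floor_log n)) \<longlonglongrightarrow> 0"
  proof (rule Lim_null_comparison)
    show "(\<lambda>n. e (floor_log n)) \<longlonglongrightarrow> 0"
      by (rule filterlim_compose[OF summable_LIMSEQ_zero[OF e] fl])
    have "eventually (\<lambda>n. k0 \<le> floor_log n) sequentially" using fl by (auto simp: filterlim_at_top)
    then show "eventually (\<lambda>n. norm (t n - t (2 ^ floor_log n)) \<le> e (floor_log n)) sequentially"
      using eventually_gt_at_top[of 0]
    proof eventually_elim
      case (elim n)
      then show ?case using floor_log_exp2_le[of n] floor_log_exp2_gt[of n]
        by (intro blk) auto
    qed
  qed
  from tendsto_add[OF this filterlim_compose[OF l fl]] show ?thesis
    by (auto simp: convergent_def)
qed

context steinhaus
begin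

text \<open>A modulus of at least \<open>2 * e\<close> forces the real or the imaginary part to be
  at least \<open>e\<close> in absolute value, which leaves four half-planes.\<close>

lemma prob_prime_sum_block:
  assumes "e > 0" "m \<ge> 1" "m \<le> n"
  shows "prob {\<omega>\<in>space M. cmod (prime_sum n \<omega> - prime_sum m \<omega>) \<ge> 2 * e} \<le> 4 * exp (- (e\<^sup>2 * real m / 2))"
proof -
  have *: "prob {\<omega>\<in>space M. a * Re (prime_sum n \<omega> - prime_sum m \<omega>) + b * Im (prime_sum n \<omega> - prime_sum m \<omega>) \<ge> e} \<le> exp (- (e\<^sup>2 * real m / 2))"
    if "a\<^sup>2 + b\<^sup>2 = 1" for a b
    using hoeffding_tail[OF assms(1,3) sum_primes_between_inverse_square[OF assms(2)], of a b] that by simp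
  let ?A = "\<lambda>a b. {\<omega>\<in>space M. a * Re (prime_sum n \<omega> - prime_sum m \<omega>) + b * Im (prime_sum n \<omega> - prime_sum m \<omega>) \<ge> e}"
  have "\<omega> \<in> (?A 1 0 \<union> ?A (-1) 0) \<union> (?A 0 1 \<union> ?A 0 (-1))"
    if "\<omega> \<in> space M" "cmod (prime_sum n \<omega> - prime_sum m \<omega>) \<ge> 2 * e" for \<omega>
    using cmod_le[of "prime_sum n \<omega> - prime_sum m \<omega>"] that by auto
  then have "prob {\<omega>\<in>space M. cmod (prime_sum n \<omega> - prime_sum m \<omega>) \<ge> 2 * e} \<le> prob ((?A 1 0 \<union> ?A (-1) 0) \<union> (?A 0 1 \<union> ?A 0 (-1)))"
    by (intro finite_measure_mono) (blast, measurable)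
  also have "\<dots> \<le> (prob (?A 1 0) + prob (?A (-1) 0)) + (prob (?A 0 1) + prob (?A 0 (-1)))"
    by (intro order_trans[OF measure_Un_le] add_mono measure_Un_le) auto
  also have "\<dots> \<le> (exp (- (e\<^sup>2 * real m / 2)) + exp (- (e\<^sup>2 * real m / 2))) + (exp (- (e\<^sup>2 * real m / 2)) + exp (- (e\<^sup>2 * real m / 2)))"
    by (intro add_mono *) auto
  finally show ?thesis by simp
qed

text \<open>Borel-Cantelli over dyadic blocks. A union bound over all \<open>n\<close> of a block
  replaces a maximal inequality: the \<open>2 ^ k + 1\<close> indices are harmless against the
  factor \<open>exp (- 2 ^ k / (2 * (k + 1) ^ 4))\<close>.\<close>

lemma AE_prime_sum_convergent: "AE \<omega> in M. convergent (\<lambda>n. prime_sum n \<omega>)"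
proof -
  define e where "e k = 1 / (real k + 1) ^ 2" for k
  define A where "A k = (\<Union>n\<in>{2 ^ k..2 ^ Suc k}. {\<omega>\<in>space M. cmod (prime_sum n \<omega> - prime_sum (2 ^ k) \<omega>) \<ge> 2 * e k})" for k
  have A: "A k \<in> events" for k unfolding A_def by (intro sets.finite_UN) auto
  have "prob (A k) \<le> 4 * (2 ^ k + 1) * exp (- ((e k)\<^sup>2 * 2 ^ k / 2))" for k
  proof -
    have "prob (A k) \<le> (\<Sum>n\<in>{2 ^ k..2 ^ Suc k}. prob {\<omega>\<in>space M. cmod (prime_sum n \<omega> - prime_sum (2 ^ k) \<omega>) \<ge> 2 * e k})"
      unfolding A_def by (intro measure_UNION_le) auto
    also have "\<dots> \<le> (\<Sum>n\<in>{2 ^ k..2 ^ Suc k :: nat}. 4 * exp (- ((e k)\<^sup>2 * real (2 ^ k) / 2)))"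
      by (intro sum_mono prob_prime_sum_block) (auto simp: e_def)
    also have "\<dots> = 4 * (2 ^ k + 1) * exp (- ((e k)\<^sup>2 * 2 ^ k / 2))"
      by (simp add: Suc_diff_le algebra_simps)
    finally show ?thesis .
  qed
  then have bound: "norm (prob (A k)) \<le> 4 * (2 ^ k + 1) * exp (- ((e k)\<^sup>2 * 2 ^ k / 2))" for k by simp
  have "summable (\<lambda>k. 4 * (2 ^ k + 1) * exp (- ((e k)\<^sup>2 * 2 ^ k / 2)))"
  proof (rule summable_comparison_test_bigo)
    show "summable (\<lambda>n. norm (1 / (real n) ^ 2))" using inverse_power_summable[of 2, where ?'a = real] by (simp add: inverse_eq_divide)
    show "(\<lambda>k. 4 * (2 ^ k + 1) * exp (- ((e k)\<^sup>2 * 2 ^ k / 2))) \<in> O(\<lambda>n. 1 / (real n) ^ 2)"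
      unfolding e_def by real_asymp
  qed
  then have "summable (\<lambda>k. prob (A k))"
    by (rule summable_comparison_test') (rule bound)
  then have "AE \<omega> in M. eventually (\<lambda>k. \<omega> \<in> space M - A k) sequentially"
    by (intro borel_cantelli_AE1 A) (auto simp: emeasure_eq_measure)
  then show ?thesis
  proof eventually_elim
    case (elim \<omega>)
    then obtain k0 where k0: "\<And>k. k \<ge> k0 \<Longrightarrow> \<omega> \<in> space M - A k" by (auto simp: eventually_at_top_linorder)
    show ?case
    proof (rule convergent_if_dyadic_blocks)
      have "summable (\<lambda>k. 1 / real (Suc k) ^ 2)"
        using inverse_power_summable[of 2, where ?'a = real] by (subst summable_Suc_iff) (simp add: inverse_eq_divide)
      then show "summable (\<lambda>k. 2 * e k)" unfolding e_def by (intro summable_mult) (simp add: add.commute)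
      show "cmod (prime_sum n \<omega> - prime_sum (2 ^ k) \<omega>) \<le> 2 * e k" if "k \<ge> k0" "2 ^ k \<le> n" "n \<le> 2 ^ Suc k" for k n
        using k0[OF that(1)] that by (force simp: A_def)
    qed
  qed
qed

definition prime_series :: "'a \<Rightarrow> complex" where "prime_series \<omega> = lim (\<lambda>n. prime_sum n \<omega>)"

lemma prime_series_measurable [measurable]: "prime_series \<in> borel_measurable M"
  unfolding prime_series_def[abs_def] by measurable

text \<open>The almost sure event on which the pathwise arguments run; there the \<open>lim\<close>
  in \<open>prime_series\<close> is a genuine limit.\<close>

definition conv_event :: "'a set" where
  "conv_event = {\<omega>\<in>space M. (\<forall>p. prime p \<longrightarrow> cmod (X p \<omega>) = 1) \<and> (\<lambda>n. prime_sum n \<omega>) \<longlonglongrightarrow> prime_series \<omega>}"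

lemma AE_conv_event: "AE \<omega> in M. \<omega> \<in> conv_event"
  using AE_unit AE_prime_sum_convergent AE_space
  by eventually_elim (auto simp: conv_event_def prime_series_def convergent_LIMSEQ_iff)

section \<open>Independence of the primes up to \<open>N\<close> and the primes beyond\<close>

definition head_event :: "(nat \<Rightarrow> complex set) \<Rightarrow> nat \<Rightarrow> 'a set" where
  "head_event A N = {\<omega>\<in>space M. \<forall>p\<in>primes_le N. X p \<omega> \<in> A p}"

lemma head_measurable [measurable]:
  assumes "\<And>p. A p \<in> sets borel"
  shows "head_event A N \<in> events"
  unfolding head_event_def
proof (intro sets.sets_Collect_finite_All)
  fix p assume "p \<in> primes_le N"
  then have [measurable]: "X p \<in> borel_measurable M" by (auto dest: primes_leD)
  note assms[measurable]
  show "{\<omega> \<in> space M. X p \<omega> \<in> A p} \<in> events" by measurable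
qed auto

lemma prob_head:
  assumes A: "\<And>p. A p \<in> sets borel"
  shows "prob (head_event A N) = (\<Prod>p\<in>primes_le N. measure circle_uniform (A p))"
proof (cases "primes_le N = {}")
  case True
  then show ?thesis by (simp add: head_event_def prob_space)
next
  case False
  have "head_event A N = (\<Inter>p\<in>primes_le N. X p -` A p \<inter> space M)" using False by (auto simp: head_event_def)
  also have "prob \<dots> = (\<Prod>p\<in>primes_le N. prob (X p -` A p \<inter> space M))"
    using False A by (intro indep_varsD[OF indep]) (auto dest: primes_leD)
  also have "\<dots> = (\<Prod>p\<in>primes_le N. measure circle_uniform (A p))"
  proof (rule prod.cong)
    fix p assume p: "p \<in> primes_le N"
    show "prob (X p -` A p \<inter> space M) = measure circle_uniform (A p)"
      unfolding distr_X[OF primes_leD(1)[OF p], symmetric]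
      using X_measurable[OF primes_leD(1)[OF p]] A by (subst measure_distr) auto
  qed simp
  finally show ?thesis .
qed

text \<open>The index sets are disjoint, so the two restricted families are independent as points of
  product spaces, and the events are preimages of \<open>B\<close> and \<open>C\<close> under
  them.\<close>

lemma prob_head_tail:
  assumes A: "\<And>p. A p \<in> sets borel" and "m \<le> n"
  shows "prob (head_event A m \<inter> {\<omega>\<in>space M. a * Re (prime_sum n \<omega> - prime_sum m \<omega>) + b * Im (prime_sum n \<omega> - prime_sum m \<omega>) \<ge> u}) =
    prob (head_event A m) * prob {\<omega>\<in>space M. a * Re (prime_sum n \<omega> - prime_sum m \<omega>) + b * Im (prime_sum n \<omega> - prime_sum m \<omega>) \<ge> u}"
proof -
  let ?P = "primes_le m" and ?Q = "primes_between m n"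
  define B where "B = {f \<in> space (PiM ?P (\<lambda>_. borel :: complex measure)). \<forall>p\<in>?P. f p \<in> A p}"
  define C where "C = {f \<in> space (PiM ?Q (\<lambda>_. borel :: complex measure)).
    a * Re (\<Sum>p\<in>?Q. f p / of_nat p) + b * Im (\<Sum>p\<in>?Q. f p / of_nat p) \<ge> u}"
  have ind: "indep_var (PiM ?P (\<lambda>_. borel)) (\<lambda>\<omega>. restrict (\<lambda>i. X i \<omega>) ?P) (PiM ?Q (\<lambda>_. borel)) (\<lambda>\<omega>. restrict (\<lambda>i. X i \<omega>) ?Q)"
    by (rule indep_var_restrict[OF indep]) (auto simp: primes_le_def primes_between_def)
  have B: "B \<in> sets (PiM ?P (\<lambda>_. borel))"
    unfolding B_def
  proof (intro sets.sets_Collect_finite_All)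
    fix p assume p: "p \<in> ?P"
    note A[measurable]
    show "{f \<in> space (PiM ?P (\<lambda>_. borel)). f p \<in> A p} \<in> sets (PiM ?P (\<lambda>_. borel))"
      using p by measurable
  qed auto
  have C: "C \<in> sets (PiM ?Q (\<lambda>_. borel))"
    unfolding C_def by measurable
  have "prob ((\<lambda>\<omega>. (restrict (\<lambda>i. X i \<omega>) ?P, restrict (\<lambda>i. X i \<omega>) ?Q)) -` (B \<times> C) \<inter> space M) =
    prob ((\<lambda>\<omega>. restrict (\<lambda>i. X i \<omega>) ?P) -` B \<inter> space M) * prob ((\<lambda>\<omega>. restrict (\<lambda>i. X i \<omega>) ?Q) -` C \<inter> space M)"
    by (rule indep_varD[OF ind B C])
  moreover have "(\<lambda>\<omega>. restrict (\<lambda>i. X i \<omega>) ?P) -` B \<inter> space M = head_event A m"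
    by (auto simp: B_def head_event_def space_PiM)
  moreover have "(\<lambda>\<omega>. restrict (\<lambda>i. X i \<omega>) ?Q) -` C \<inter> space M =
    {\<omega>\<in>space M. a * Re (prime_sum n \<omega> - prime_sum m \<omega>) + b * Im (prime_sum n \<omega> - prime_sum m \<omega>) \<ge> u}"
    by (auto simp: C_def space_PiM prime_sum_diff[OF assms(2)])
  moreover have "(\<lambda>\<omega>. (restrict (\<lambda>i. X i \<omega>) ?P, restrict (\<lambda>i. X i \<omega>) ?Q)) -` (B \<times> C) \<inter> space M =
    ((\<lambda>\<omega>. restrict (\<lambda>i. X i \<omega>) ?P) -` B \<inter> space M) \<inter> ((\<lambda>\<omega>. restrict (\<lambda>i. X i \<omega>) ?Q) -` C \<inter> space M)"
    by auto
  ultimately show ?thesis by simp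
qed

text \<open>A strict inequality for the limit holds for all large \<open>n\<close>, so up to a null
  set the event lies in the increasing union of the \<open>D k\<close>. Each \<open>D k\<close> lies
  in a single finite-level event, where independence and Hoeffding's inequality apply.\<close>

lemma prob_head_series_tail:
  assumes A: "\<And>p. A p \<in> sets borel" and "u > 0" and ab: "a\<^sup>2 + b\<^sup>2 > 0"
    and V: "\<And>n. (\<Sum>p\<in>primes_between m n. 1 / real p ^ 2) \<le> V"
  shows "prob (head_event A m \<inter> {\<omega>\<in>space M. a * Re (prime_series \<omega> - prime_sum m \<omega>) + b * Im (prime_series \<omega> - prime_sum m \<omega>) > u})
    \<le> prob (head_event A m) * exp (- u\<^sup>2 / (2 * (a\<^sup>2 + b\<^sup>2) * V))"
proof -
  note head_measurable[OF A, measurable]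
  let ?f = "\<lambda>z. a * Re z + b * Im z"
  let ?e = "prob (head_event A m) * exp (- u\<^sup>2 / (2 * (a\<^sup>2 + b\<^sup>2) * V))"
  define B where "B n = head_event A m \<inter> {\<omega>\<in>space M. ?f (prime_sum n \<omega> - prime_sum m \<omega>) \<ge> u}" for n
  define D where "D k = (\<Inter>n\<in>{k..}. B n)" for k
  have B_meas: "B n \<in> events" for n unfolding B_def by measurable
  have D_meas: "D k \<in> events" for k unfolding D_def using B_meas by (intro sets.countable_INT') auto
  have "incseq D" unfolding D_def incseq_def by (auto intro: order_trans)
  have Dle: "prob (D k) \<le> ?e" for k
  proof -
    have "prob (D k) \<le> prob (B (max k m))" using B_meas by (intro finite_measure_mono) (auto simp: D_def)
    also have "\<dots> = prob (head_event A m) * prob {\<omega>\<in>space M. ?f (prime_sum (max k m) \<omega> - prime_sum m \<omega>) \<ge> u}"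
      unfolding B_def by (rule prob_head_tail[OF A]) auto
    also have "\<dots> \<le> ?e" by (intro mult_left_mono hoeffding_tail assms) auto
    finally show ?thesis .
  qed
  have "(\<lambda>k. prob (D k)) \<longlonglongrightarrow> prob (\<Union>k. D k)"
    using D_meas \<open>incseq D\<close> by (intro finite_Lim_measure_incseq) auto
  then have UD: "prob (\<Union>k. D k) \<le> ?e" by (rule LIMSEQ_le_const2) (use Dle in auto)
  have sub: "AE \<omega> in M. \<omega> \<in> head_event A m \<inter> {\<omega>\<in>space M. ?f (prime_series \<omega> - prime_sum m \<omega>) > u} \<longrightarrow> \<omega> \<in> (\<Union>k. D k)"
    using AE_conv_event
  proof eventually_elim
    case (elim \<omega>)
    show ?case
    proof
      assume "\<omega> \<in> head_event A m \<inter> {\<omega>\<in>space M. ?f (prime_series \<omega> - prime_sum m \<omega>) > u}"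
      then have h: "\<omega> \<in> head_event A m" "\<omega> \<in> space M" "?f (prime_series \<omega> - prime_sum m \<omega>) > u" using elim by auto
      have "(\<lambda>n. ?f (prime_sum n \<omega> - prime_sum m \<omega>)) \<longlonglongrightarrow> ?f (prime_series \<omega> - prime_sum m \<omega>)"
        using elim by (intro tendsto_intros) (auto simp: conv_event_def)
      then have "eventually (\<lambda>n. ?f (prime_sum n \<omega> - prime_sum m \<omega>) > u) sequentially" using h(3) by (rule order_tendstoD)
      then obtain k where "\<And>n. n \<ge> k \<Longrightarrow> ?f (prime_sum n \<omega> - prime_sum m \<omega>) > u" by (auto simp: eventually_at_top_linorder)
      then have "\<omega> \<in> D k" using h by (auto simp: D_def B_def intro: less_imp_le)
      then show "\<omega> \<in> (\<Union>k. D k)" by auto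
    qed
  qed
  have "prob (head_event A m \<inter> {\<omega>\<in>space M. ?f (prime_series \<omega> - prime_sum m \<omega>) > u}) \<le> prob (\<Union>k. D k)"
    using D_meas sub by (intro finite_measure_mono_AE) auto
  then show ?thesis using UD by linarith
qed

end

section \<open>A single Euler factor\<close>

definition local_log :: "nat \<Rightarrow> complex \<Rightarrow> complex" where
  "local_log p x = - Ln (1 - x / of_nat p)"

text \<open>For the modulus, the square of \<open>cmod (1 - x / p)\<close> is its value at
  \<open>x = 1\<close> times a factor that measures the distance of \<open>Re x\<close> from 1. For
  the argument, \<open>1 - x / p\<close> lies in the right half-plane, so \<open>Arg\<close> is an
  arctangent.\<close>

lemma local_log_parts:
  assumes p: "p \<ge> 2" and x: "cmod x = 1"
  shows "Re (local_log p x) = euler_weight p - ln (1 + 2 * (1 - Re x) / (real p * (1 - 1 / real p)\<^sup>2)) / 2"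
    "Im (local_log p x) = arctan (Im x / (real p - Re x))"
    "1 - x / of_nat p \<noteq> 0"
proof -
  define c s where "c = Re x" and "s = Im x"
  have cs: "c\<^sup>2 + s\<^sup>2 = 1" using x by (simp add: c_def s_def cmod_power2[symmetric])
  have c1: "\<bar>c\<bar> \<le> 1" using abs_Re_le_cmod[of x] x by (simp add: c_def)
  let ?z = "1 - x / of_nat p"
  have Re: "Re ?z = 1 - c / real p" and Im: "Im ?z = - s / real p"
    by (simp_all add: c_def s_def Re_divide_of_nat Im_divide_of_nat)
  have "c / real p < 1" using c1 p by (simp add: divide_less_eq)
  then have pos: "Re ?z > 0" unfolding Re by linarith
  then show nz: "?z \<noteq> 0" by auto
  have P: "1 - 1 / real p > 0" using p by simp
  have "(cmod ?z)\<^sup>2 = (1 - c / real p)\<^sup>2 + (s / real p)\<^sup>2" unfolding cmod_power2 Re Im by simp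
  also have "\<dots> = 1 - 2 * c / real p + (c\<^sup>2 + s\<^sup>2) / (real p)\<^sup>2"
    by (simp add: power2_diff power_divide add_divide_distrib)
  also have "\<dots> = (1 - 1 / real p)\<^sup>2 + 2 * (1 - c) / real p"
    unfolding cs by (simp add: power2_diff power_divide diff_divide_distrib)
  also have "\<dots> = (1 - 1 / real p)\<^sup>2 * (1 + 2 * (1 - c) / (real p * (1 - 1 / real p)\<^sup>2))"
    using P p by (simp add: distrib_left)
  finally have eq: "(cmod ?z)\<^sup>2 = (1 - 1 / real p)\<^sup>2 * (1 + 2 * (1 - c) / (real p * (1 - 1 / real p)\<^sup>2))" .
  have u: "2 * (1 - c) / (real p * (1 - 1 / real p)\<^sup>2) \<ge> 0" using c1 by (intro divide_nonneg_nonneg) auto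
  have "2 * ln (cmod ?z) = ln ((cmod ?z)\<^sup>2)" using nz by (simp add: ln_realpow)
  also have "\<dots> = 2 * ln (1 - 1 / real p) + ln (1 + 2 * (1 - c) / (real p * (1 - 1 / real p)\<^sup>2))"
    unfolding eq using P u by (subst ln_mult_pos) (auto simp: ln_realpow)
  finally show "Re (local_log p x) = euler_weight p - ln (1 + 2 * (1 - Re x) / (real p * (1 - 1 / real p)\<^sup>2)) / 2"
    using nz by (simp add: local_log_def euler_weight_def c_def)
  have "Im (local_log p x) = - Arg ?z" using nz by (simp add: local_log_def Arg_eq_Im_Ln)
  also have "\<dots> = arctan (- (Im ?z / Re ?z))" using pos by (simp add: arg_conv_arctan arctan_minus)
  also have "- (Im ?z / Re ?z) = s / (real p - c)" unfolding Re Im using p c1 by (simp add: divide_simps)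
  finally show "Im (local_log p x) = arctan (Im x / (real p - Re x))" by (simp add: c_def s_def)
qed

lemma abs_arctan_le: "\<bar>arctan x\<bar> \<le> \<bar>x :: real\<bar>"
proof (cases "x \<ge> 0")
  case True
  then show ?thesis using arctan_le_self[of x] by simp
next
  case False
  then show ?thesis using arctan_le_self[of "- x"] by (simp add: arctan_minus)
qed

text \<open>Maximising over the angle: the linear gain in the argument is beaten by the quadratic loss in the
  modulus.\<close>

lemma local_log_upper:
  assumes p: "p \<ge> 2" and x: "cmod x = 1"
  shows "Re (local_log p x) + b * Im (local_log p x) \<le> euler_weight p + b\<^sup>2 / 2 * ((real p + 4) / (real p - 1)\<^sup>2)"
proof -
  define c s where "c = Re x" and "s = Im x"
  have cs: "c\<^sup>2 + s\<^sup>2 = 1" using x by (simp add: c_def s_def cmod_power2[symmetric])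
  have c1: "\<bar>c\<bar> \<le> 1" using abs_Re_le_cmod[of x] x by (simp add: c_def)
  define q where "q = 1 - c"
  have q: "q \<ge> 0" "q \<le> 2" using c1 by (auto simp: q_def)
  define u where "u = 2 * q / (real p * (1 - 1 / real p)\<^sup>2)"
  have P: "0 < 1 - 1 / real p" "1 - 1 / real p \<le> 1" using p by auto
  \<comment> \<open>The bound \<open>ln (1 + u) \<ge> 1 - 1 / (1 + u)\<close> leads to a loss linear
    in \<open>q\<close>, valid for all \<open>q\<close> up to 2; the 4 in \<open>p + 4\<close> is
    the largest value of \<open>2 * q\<close>.\<close>
  have "2 * q / real p \<le> u"
    unfolding u_def using q p P by (intro divide_left_mono mult_pos_pos) (auto intro!: mult_left_le simp: power_le_one)
  moreover have "0 \<le> 2 * q / real p" using q by simp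
  ultimately have "1 - 1 / (1 + 2 * q / real p) \<le> 1 - 1 / (1 + u)"
    by (simp add: frac_le)
  also have "\<dots> \<le> ln (1 + u)"
    using ln_le_minus_one[of "1 / (1 + u)"] \<open>2 * q / real p \<le> u\<close> \<open>0 \<le> 2 * q / real p\<close> by (simp add: ln_div)
  finally have "1 - 1 / (1 + 2 * q / real p) \<le> ln (1 + u)" .
  moreover have "1 - 1 / (1 + 2 * q / real p) = 2 * q / (real p + 2 * q)"
    using p q by (simp add: divide_simps)
  moreover have "2 * q / (real p + 4) \<le> 2 * q / (real p + 2 * q)"
    using q p by (intro divide_left_mono) auto
  moreover have "2 * q / (real p + 4) = 2 * (q / (real p + 4))" by simp
  ultimately have re: "q / (real p + 4) \<le> ln (1 + u) / 2" by linarith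
  have "Im (local_log p x) = arctan (s / (real p - c))"
    using local_log_parts(2)[OF p x] by (simp add: c_def s_def)
  then have "\<bar>Im (local_log p x)\<bar> \<le> \<bar>s\<bar> / (real p - c)"
    using abs_arctan_le[of "s / (real p - c)"] c1 p by (simp add: abs_divide)
  also have "\<dots> \<le> \<bar>s\<bar> / (real p - 1)" using c1 p by (intro divide_left_mono) auto
  finally have "\<bar>b\<bar> * \<bar>Im (local_log p x)\<bar> \<le> \<bar>b\<bar> * (\<bar>s\<bar> / (real p - 1))"
    by (rule mult_left_mono) simp
  then have "b * Im (local_log p x) \<le> \<bar>b\<bar> * (\<bar>s\<bar> / (real p - 1))"
    using abs_ge_self[of "b * Im (local_log p x)"] unfolding abs_mult by linarith
  \<comment> \<open>Weighted arithmetic-geometric mean with weight \<open>p + 4\<close>, chosen so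
    that the part with \<open>s\<close> is paid for by the loss in the modulus:
    \<open>s^2 = 2 * q - q^2\<close> is at most \<open>2 * q\<close>.\<close>
  also have "\<dots> \<le> s\<^sup>2 / (2 * (real p + 4)) + b\<^sup>2 / 2 * ((real p + 4) / (real p - 1)\<^sup>2)"
  proof -
    define k where "k = sqrt (real p + 4)"
    have k: "k > 0" "k\<^sup>2 = real p + 4" using p by (auto simp: k_def)
    define d where "d = real p - 1"
    have d: "d > 0" using p by (simp add: d_def)
    have "0 \<le> (\<bar>s\<bar> / k - \<bar>b\<bar> * k / d)\<^sup>2" by simp
    also have "\<dots> = s\<^sup>2 / k\<^sup>2 + b\<^sup>2 * (k\<^sup>2 / d\<^sup>2) - 2 * (\<bar>b\<bar> * (\<bar>s\<bar> / d))"
      using k d by (simp add: power2_diff power_divide power_mult_distrib)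
    finally have le: "0 \<le> s\<^sup>2 / k\<^sup>2 + b\<^sup>2 * (k\<^sup>2 / d\<^sup>2) - 2 * (\<bar>b\<bar> * (\<bar>s\<bar> / d))" .
    have "R \<le> P / 2 + Q / 2" if "0 \<le> P + Q - 2 * R" for P Q R :: real using that by linarith
    from this[OF le] have "\<bar>b\<bar> * (\<bar>s\<bar> / d) \<le> s\<^sup>2 / k\<^sup>2 / 2 + b\<^sup>2 * (k\<^sup>2 / d\<^sup>2) / 2" .
    then show ?thesis unfolding k(2) d_def by (simp add: mult.commute)
  qed
  also have "s\<^sup>2 / (2 * (real p + 4)) \<le> q / (real p + 4)"
  proof -
    have "s\<^sup>2 = 2 * q - q\<^sup>2" using cs by (simp add: q_def power2_eq_square algebra_simps)
    then have "s\<^sup>2 / (2 * (real p + 4)) \<le> 2 * q / (2 * (real p + 4))" by (intro divide_right_mono) auto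
    also have "\<dots> = q / (real p + 4)" by (rule mult_divide_mult_cancel_left) simp
    finally show ?thesis .
  qed
  finally have "b * Im (local_log p x) \<le> q / (real p + 4) + b\<^sup>2 / 2 * ((real p + 4) / (real p - 1)\<^sup>2)"
    by simp
  moreover have "Re (local_log p x) = euler_weight p - ln (1 + u) / 2"
    unfolding u_def q_def c_def by (rule local_log_parts(1)[OF p x])
  ultimately show ?thesis using re by linarith
qed

text \<open>No calculus is used: \<open>arctan v\<close> is at least its sine, which is at least
  sine times cosine, and that product is \<open>v / (1 + v^2)\<close>.\<close>

lemma arctan_ge_cubic:
  assumes "0 \<le> (v :: real)"
  shows "v - v ^ 3 \<le> arctan v"
proof -
  have "v - v ^ 3 \<le> v / (1 + v\<^sup>2)"
  proof -
    have "(v - v ^ 3) * (1 + v\<^sup>2) = v - v ^ 5" by (simp add: algebra_simps power_numeral_reduce)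
    also have "\<dots> \<le> v" using assms by simp
    finally show ?thesis by (simp add: pos_le_divide_eq add_pos_nonneg)
  qed
  also have "\<dots> = sin (arctan v) * cos (arctan v)"
    by (simp add: sin_arctan cos_arctan)
  also have "\<dots> \<le> sin (arctan v) * 1"
    using assms by (intro mult_left_mono) (auto simp: sin_arctan)
  also have "\<dots> \<le> arctan v" using sin_x_le_x[of "arctan v"] assms by simp
  finally show ?thesis .
qed

lemma one_minus_cos_le: "1 - cos x \<le> x\<^sup>2 / (2 :: real)"
proof -
  have "1 - cos x = 2 * (sin (x / 2))\<^sup>2" using cos_double_sin[of "x / 2"] by simp
  also have "(sin (x / 2))\<^sup>2 \<le> (x / 2)\<^sup>2"
    using abs_sin_x_le_abs_x[of "x / 2"] by (simp only: abs_le_square_iff)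
  finally show ?thesis by (simp add: power_divide)
qed

text \<open>On an arc the gain in the argument is bounded through the near end
  \<open>\<phi>\<close>, the loss in the modulus through the far end \<open>\<psi>\<close>. The loss
  is enlarged to the weight of \<open>local_log_upper\<close>, so that one sum over primes serves
  both bounds.\<close>

lemma local_log_lower:
  assumes p: "p \<ge> 2" and a: "0 \<le> \<phi>" "\<phi> \<le> \<alpha>" "\<alpha> \<le> \<psi>" "\<psi> \<le> 1"
  shows "euler_weight p - \<psi>\<^sup>2 / 2 * ((real p + 4) / (real p - 1)\<^sup>2) \<le> Re (local_log p (cis \<alpha>))"
    "sin \<phi> * (1 / real p - 1 / real p ^ 3) \<le> Im (local_log p (cis \<alpha>))"
proof -
  have pi: "1 < pi / 2" using pi_gt3 by simp
  have "\<alpha>\<^sup>2 \<le> \<psi>\<^sup>2" using a by (intro power_mono) auto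
  then have q: "1 - cos \<alpha> \<le> \<psi>\<^sup>2 / 2" using one_minus_cos_le[of \<alpha>] by linarith
  define u where "u = 2 * (1 - cos \<alpha>) / (real p * (1 - 1 / real p)\<^sup>2)"
  have P: "1 - 1 / real p > 0" using p by simp
  have "ln (1 + u) \<le> u" unfolding u_def using P by (intro ln_add_one_self_le_self divide_nonneg_nonneg) auto
  also have "u = 2 * (1 - cos \<alpha>) * (real p / (real p - 1)\<^sup>2)"
  proof -
    have "real p * (1 - 1 / real p)\<^sup>2 = (real p - 1)\<^sup>2 / real p" using p by (simp add: field_simps power2_eq_square)
    then show ?thesis unfolding u_def by simp
  qed
  also have "\<dots> \<le> \<psi>\<^sup>2 * ((real p + 4) / (real p - 1)\<^sup>2)"
    using q by (intro mult_mono divide_right_mono) auto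
  finally show "euler_weight p - \<psi>\<^sup>2 / 2 * ((real p + 4) / (real p - 1)\<^sup>2) \<le> Re (local_log p (cis \<alpha>))"
    using local_log_parts(1)[OF p, of "cis \<alpha>"] by (simp add: u_def)
  have s0: "0 \<le> sin \<phi>" using a pi by (intro sin_ge_zero) auto
  have s1: "sin \<phi> \<le> sin \<alpha>" using a pi by (intro sin_monotone_2pi_le) auto
  have c0: "0 \<le> cos \<alpha>" using a pi by (intro cos_ge_zero) auto
  define v where "v = sin \<phi> / real p"
  have v: "0 \<le> v" "v \<le> 1 / real p" using s0 p by (auto simp: v_def divide_right_mono)
  have "v * v\<^sup>2 \<le> v * (1 / real p)\<^sup>2" using v by (intro mult_left_mono power_mono) auto
  then have "sin \<phi> * (1 / real p - 1 / real p ^ 3) \<le> v - v ^ 3"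
    by (simp add: v_def power_numeral_reduce algebra_simps)
  also have "\<dots> \<le> arctan v" by (rule arctan_ge_cubic[OF v(1)])
  also have "\<dots> \<le> arctan (sin \<alpha> / (real p - cos \<alpha>))"
  proof -
    have "cos \<alpha> < real p" using p cos_le_one[of \<alpha>] by linarith
    then show ?thesis unfolding arctan_le_iff v_def using s0 s1 c0 by (intro frac_le) auto
  qed
  finally show "sin \<phi> * (1 / real p - 1 / real p ^ 3) \<le> Im (local_log p (cis \<alpha>))"
    using local_log_parts(2)[OF p, of "cis \<alpha>"] by simp
qed

lemma local_log_linear:
  assumes p: "p \<ge> 2" and x: "cmod x = 1"
  shows "cmod (local_log p x - x / of_nat p) \<le> 2 * (1 / real p ^ 2)"
proof -
  have n: "cmod (- x / of_nat p) = 1 / real p" using x by (simp add: norm_divide)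
  have "cmod (ln (1 + - x / of_nat p) - - x / of_nat p) \<le> cmod (- x / of_nat p) ^ 2 / (1 - cmod (- x / of_nat p))"
    using p by (intro Ln_approx_linear) (subst n, simp)
  also have "\<dots> = 1 / real p ^ 2 * (1 / (1 - 1 / real p))" unfolding n by (simp add: power_divide)
  also have "\<dots> \<le> 1 / real p ^ 2 * 2"
  proof (intro mult_left_mono)
    have "1 - 1 / real p \<ge> 1 / 2" using p by (simp add: field_simps)
    then show "1 / (1 - 1 / real p) \<le> 2" by (simp add: divide_le_eq)
  qed auto
  finally have "cmod (ln (1 - x / of_nat p) + x / of_nat p) \<le> 2 * (1 / real p ^ 2)" by simp
  moreover have "local_log p x - x / of_nat p = - (ln (1 - x / of_nat p) + x / of_nat p)"
    by (simp add: local_log_def)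
  ultimately show ?thesis by (simp only: norm_minus_cancel)
qed

text \<open>These estimates share one constant, fixed before the probability space, so that the
  implied constant of the theorem depends on \<open>\<theta>0\<close> only. The first alone carries
  an exact constant term. \<open>C \<ge> 1\<close> makes \<open>ln (32 * C)\<close> and
  \<open>ln (5 * C)\<close> positive.\<close>

definition mertens_bounds :: "real \<Rightarrow> bool" where
  "mertens_bounds C \<longleftrightarrow> C \<ge> 1 \<and> (\<forall>n\<ge>2.
     \<bar>(\<Sum>p\<in>primes_le n. euler_weight p) - ln (ln (real n)) - euler_mascheroni\<bar> \<le> C / ln (real n) \<and>
     (\<Sum>p\<in>primes_le n. (real p + 4) / (real p - 1)\<^sup>2) \<le> ln (ln (real n)) + C \<and>
     (\<Sum>p\<in>primes_le n. 1 / real p - 1 / real p ^ 3) \<ge> ln (ln (real n)) - C \<and>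
     real (card (primes_le n)) \<le> C * real n / ln (real n) \<and>
     (\<forall>m. (\<Sum>p\<in>primes_between n m. 1 / real p ^ 2) \<le> C / (real n * ln (real n))))"

lemma ex_mertens_bounds: "\<exists>C. mertens_bounds C"
proof -
  obtain C1 where C1: "C1 > 0" "\<And>n. 2 \<le> n \<Longrightarrow>
    \<bar>(\<Sum>p\<in>primes_le n. euler_weight p) - ln (ln (real n)) - euler_mascheroni\<bar> \<le> C1 / ln (real n)"
    using mertens_third by blast
  have f2: "\<bar>(real p + 4) / (real p - 1)\<^sup>2 - 1 / real p\<bar> \<le> 24 / real p ^ 2" if p: "p \<ge> 2" for p :: nat
  proof -
    have eq: "(real p + 4) / (real p - 1)\<^sup>2 - 1 / real p = (6 * real p - 1) / (real p * (real p - 1)\<^sup>2)"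
      using p by (simp add: divide_simps) (simp add: power2_eq_square algebra_simps)
    have "\<bar>(real p + 4) / (real p - 1)\<^sup>2 - 1 / real p\<bar> = (6 * real p - 1) / (real p * (real p - 1)\<^sup>2)"
      unfolding eq using p by simp
    also have "\<dots> \<le> (6 * real p) / (real p * (real p / 2)\<^sup>2)"
      using p by (intro frac_le mult_left_mono power_mono mult_pos_pos) auto
    also have "\<dots> = 24 / real p ^ 2" using p by (simp add: power2_eq_square)
    finally show ?thesis .
  qed
  obtain C2 where C2: "C2 > 0" "\<And>n. 2 \<le> n \<Longrightarrow> \<bar>(\<Sum>p\<in>primes_le n. (real p + 4) / (real p - 1)\<^sup>2) - ln (ln (real n))\<bar> \<le> C2"
    using mertens_perturbed[OF f2] by auto
  have f3: "\<bar>(1 / real p - 1 / real p ^ 3) - 1 / real p\<bar> \<le> 1 / real p ^ 2" if "p \<ge> 2" for p :: nat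
    using that by (simp add: divide_simps power_increasing)
  obtain C3 where C3: "C3 > 0" "\<And>n. 2 \<le> n \<Longrightarrow> \<bar>(\<Sum>p\<in>primes_le n. 1 / real p - 1 / real p ^ 3) - ln (ln (real n))\<bar> \<le> C3"
    using mertens_perturbed[OF f3] by auto
  obtain C4 where C4: "C4 > 0" "\<And>n. 2 \<le> n \<Longrightarrow> real (card (primes_le n)) \<le> C4 * real n / ln (real n)"
    using chebyshev_prime_count by blast
  obtain C5 where C5: "C5 > 0" "\<And>m n. 2 \<le> m \<Longrightarrow> (\<Sum>p\<in>primes_between m n. 1 / real p ^ 2) \<le> C5 / (real m * ln (real m))"
    using prime_square_tail by blast
  define C where "C = 1 + C1 + C2 + C3 + C4 + C5"
  have C: "C \<ge> 1" "C1 \<le> C" "C2 \<le> C" "C3 \<le> C" "C4 \<le> C" "C5 \<le> C"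
    using C1(1) C2(1) C3(1) C4(1) C5(1) by (auto simp: C_def)
  have "C1 / ln (real n) \<le> C / ln (real n)" "C4 * real n / ln (real n) \<le> C * real n / ln (real n)"
    "C5 / (real n * ln (real n)) \<le> C / (real n * ln (real n))" if "n \<ge> 2" for n
    using that C by (auto intro!: divide_right_mono mult_right_mono mult_nonneg_nonneg)
  then have "mertens_bounds C"
    unfolding mertens_bounds_def using C C1(2) C2(2) C3(2) C4(2) C5(2)
    by (intro conjI allI impI) (fastforce intro: order_trans simp: abs_le_iff)+
  then show ?thesis by blast
qed

section \<open>The random Euler product\<close>

context steinhaus
begin

definition log_sum :: "nat \<Rightarrow> 'a \<Rightarrow> complex" where
  "log_sum n \<omega> = (\<Sum>p\<in>primes_le n. local_log p (X p \<omega>))"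

definition log_series :: "'a \<Rightarrow> complex" where "log_series \<omega> = lim (\<lambda>n. log_sum n \<omega>)"

lemma log_sum_measurable [measurable]: "log_sum n \<in> borel_measurable M"
  unfolding log_sum_def[abs_def]
proof (intro borel_measurable_sum)
  fix p assume "p \<in> primes_le n"
  then have [measurable]: "X p \<in> borel_measurable M" by (auto dest: primes_leD)
  show "(\<lambda>\<omega>. local_log p (X p \<omega>)) \<in> borel_measurable M"
    unfolding local_log_def by measurable
qed

lemma log_series_measurable [measurable]: "log_series \<in> borel_measurable M"
  unfolding log_series_def[abs_def] by measurable

text \<open>The terms of \<open>log_sum - prime_sum\<close> are at most \<open>2 / p^2\<close>, so
  the convergence of the linear series carries over, and the tails beyond \<open>m\<close> differ by
  at most the deterministic \<open>2 / m\<close>.\<close>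

lemma conv_event_log_sum:
  assumes "\<omega> \<in> conv_event"
  shows "(\<lambda>n. log_sum n \<omega>) \<longlonglongrightarrow> log_series \<omega>"
    "m \<ge> 1 \<Longrightarrow> cmod ((log_series \<omega> - log_sum m \<omega>) - (prime_series \<omega> - prime_sum m \<omega>)) \<le> 2 / real m"
proof -
  have unit: "cmod (X p \<omega>) = 1" if "prime p" for p using assms that by (auto simp: conv_event_def)
  have prime_sum: "(\<lambda>n. prime_sum n \<omega>) \<longlonglongrightarrow> prime_series \<omega>" using assms by (auto simp: conv_event_def)
  define d where "d p = local_log p (X p \<omega>) - X p \<omega> / of_nat p" for p
  define D where "D n = log_sum n \<omega> - prime_sum n \<omega>" for n
  have D: "D n = (\<Sum>p\<in>primes_le n. d p)" for n by (simp add: D_def log_sum_def prime_sum_def d_def sum_subtractf)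
  have d: "cmod (d p) \<le> 2 * (1 / real p ^ 2)" if "prime p" for p
    unfolding d_def using local_log_linear[OF prime_ge_2_nat[OF that] unit[OF that]] .
  have diff: "cmod (D n - D m) \<le> 2 / real m" if "1 \<le> m" "m \<le> n" for m n
  proof -
    have "cmod (D n - D m) = cmod (\<Sum>p\<in>primes_between m n. d p)"
      unfolding D sum_primes_le_split[OF that(2)] by simp
    also have "\<dots> \<le> (\<Sum>p\<in>primes_between m n. 2 * (1 / real p ^ 2))"
      by (intro sum_norm_le d) (auto dest: primes_betweenD)
    also have "\<dots> = 2 * (\<Sum>p\<in>primes_between m n. 1 / real p ^ 2)" by (simp only: sum_distrib_left)
    also have "\<dots> \<le> 2 * (1 / real m)" by (intro mult_left_mono sum_primes_between_inverse_square that) auto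
    finally show ?thesis by simp
  qed
  have "Cauchy D"
  proof (rule CauchyI')
    fix e :: real assume e: "e > 0"
    obtain M0 :: nat where M0: "2 / e < real M0" using reals_Archimedean2 by blast
    show "\<exists>M0. \<forall>m\<ge>M0. \<forall>n>m. dist (D m) (D n) < e"
    proof (intro exI[of _ "max M0 1"] allI impI)
      fix m n assume mn: "max M0 1 \<le> m" "m < n"
      then have "2 / e < real m" using M0 by (meson le_less_trans less_le_trans max.bounded_iff of_nat_le_iff)
      then have "2 / real m < e" using e mn by (simp add: field_simps)
      then show "dist (D m) (D n) < e" using diff[of m n] mn by (simp add: dist_norm norm_minus_commute)
    qed
  qed
  then obtain l where l: "D \<longlonglongrightarrow> l" by (auto simp: Cauchy_convergent_iff convergent_def)
  have "(\<lambda>n. D n + prime_sum n \<omega>) \<longlonglongrightarrow> l + prime_series \<omega>" by (intro tendsto_intros l prime_sum)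
  then have log_sum: "(\<lambda>n. log_sum n \<omega>) \<longlonglongrightarrow> l + prime_series \<omega>" by (simp add: D_def)
  then show "(\<lambda>n. log_sum n \<omega>) \<longlonglongrightarrow> log_series \<omega>" unfolding log_series_def by (simp add: limI)
  have Sl: "log_series \<omega> = l + prime_series \<omega>" unfolding log_series_def by (rule limI[OF log_sum])
  assume m: "m \<ge> 1"
  have "(\<lambda>n. cmod (D n - D m)) \<longlonglongrightarrow> cmod (l - D m)" by (intro tendsto_intros l)
  then have "cmod (l - D m) \<le> 2 / real m"
    by (rule LIMSEQ_le_const2) (use diff m in auto)
  then show "cmod ((log_series \<omega> - log_sum m \<omega>) - (prime_series \<omega> - prime_sum m \<omega>)) \<le> 2 / real m"
    by (simp add: Sl D_def algebra_simps)
qed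

lemma conv_event_L1:
  assumes "\<omega> \<in> conv_event"
  shows "cmod (L1 X \<omega>) = exp (Re (log_series \<omega>))"
proof -
  have unit: "cmod (X p \<omega>) = 1" if "prime p" for p using assms that by (auto simp: conv_event_def)
  have "exp (log_sum n \<omega>) = (\<Prod>p | prime p \<and> p \<le> n. inverse (1 - X p \<omega> / of_nat p))" for n
    unfolding log_sum_def exp_sum[OF finite_primes_le]
    unfolding primes_le_def
  proof (rule prod.cong)
    fix p assume "p \<in> {p. prime p \<and> p \<le> n}"
    then have "1 - X p \<omega> / of_nat p \<noteq> 0"
      using local_log_parts(3)[OF prime_ge_2_nat unit] by auto
    then show "exp (local_log p (X p \<omega>)) = inverse (1 - X p \<omega> / of_nat p)"
      by (simp add: local_log_def exp_minus)
  qed simp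
  moreover have "(\<lambda>n. exp (log_sum n \<omega>)) \<longlonglongrightarrow> exp (log_series \<omega>)" by (intro tendsto_intros conv_event_log_sum assms)
  ultimately have "L1 X \<omega> = exp (log_series \<omega>)" unfolding L1_def by (simp add: limI)
  then show ?thesis by simp
qed

lemma L1_measurable [measurable]: "L1 X \<in> borel_measurable M"
proof -
  have [measurable]: "(\<lambda>\<omega>. \<Prod>p | prime p \<and> p \<le> n. inverse (1 - X p \<omega> / of_nat p)) \<in> borel_measurable M" for n
  proof (intro borel_measurable_prod)
    fix p assume "p \<in> {p. prime p \<and> p \<le> n}"
    then have [measurable]: "X p \<in> borel_measurable M" by auto
    show "(\<lambda>\<omega>. inverse (1 - X p \<omega> / of_nat p)) \<in> borel_measurable M" by measurable
  qed
  show ?thesis unfolding L1_def[abs_def] by measurable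
qed

lemma arg_L1_eq: "arg_L1 X \<omega> = Im (log_series \<omega>)"
  unfolding arg_L1_def log_series_def log_sum_def local_log_def primes_le_def ..

lemma Phi_eq:
  assumes "\<tau> > 0"
  shows "Phi M X \<tau> \<theta> = prob {\<omega>\<in>space M. Re (log_series \<omega>) > euler_mascheroni + ln \<tau> \<and> \<bar>Im (log_series \<omega>)\<bar> > \<theta>}"
  unfolding Phi_def
proof (rule finite_measure_eq_AE)
  show "AE \<omega> in M. \<omega> \<in> {\<omega> \<in> space M. exp euler_mascheroni * \<tau> < cmod (L1 X \<omega>) \<and> \<theta> < \<bar>arg_L1 X \<omega>\<bar>} \<longleftrightarrow>
    \<omega> \<in> {\<omega>\<in>space M. Re (log_series \<omega>) > euler_mascheroni + ln \<tau> \<and> \<bar>Im (log_series \<omega>)\<bar> > \<theta>}"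
    using AE_conv_event
  proof eventually_elim
    case (elim \<omega>)
    have "exp euler_mascheroni * \<tau> = exp (euler_mascheroni + ln \<tau>)" using assms by (simp add: exp_add)
    then show ?case by (simp add: conv_event_L1[OF elim] arg_L1_eq)
  qed
qed (simp_all add: arg_L1_eq)

text \<open>The threshold consists of the head maximum, the deviation \<open>u\<close>, and
  \<open>4 / N\<close> for the nonlinear part of the tail, whose real and imaginary parts are at
  most \<open>2 / N\<close> each. The 4 in the exponent bounds \<open>2 * (1 + b^2)\<close>.\<close>

lemma upper_tail:
  assumes C: "mertens_bounds C" and N: "N \<ge> 2" and b: "\<bar>b\<bar> \<le> 1" and u: "u > 0"
  shows "prob {\<omega>\<in>space M. Re (log_series \<omega>) + b * Im (log_series \<omega>) >
      euler_mascheroni + ln (ln (real N)) + C / ln (real N) + b\<^sup>2 / 2 * (ln (ln (real N)) + C) + u + 4 / real N}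
    \<le> exp (- (u\<^sup>2 * (real N * ln (real N)) / (4 * C)))"
proof -
  define H where "H = euler_mascheroni + ln (ln (real N)) + C / ln (real N) + b\<^sup>2 / 2 * (ln (ln (real N)) + C)"
  define V where "V = C / (real N * ln (real N))"
  have C1: "C \<ge> 1" using C by (simp add: mertens_bounds_def)
  have lnN: "ln (real N) > 0" using N by simp
  have Vpos: "V > 0" unfolding V_def using C1 lnN N by (intro divide_pos_pos mult_pos_pos) auto
  have V: "(\<Sum>p\<in>primes_between N n. 1 / real p ^ 2) \<le> V" for n
    using C N unfolding mertens_bounds_def V_def by blast
  have b2: "b\<^sup>2 \<le> 1" using b by (simp add: abs_square_le_1)
  have headH: "Re (log_sum N \<omega>) + b * Im (log_sum N \<omega>) \<le> H" if "\<omega> \<in> conv_event" for \<omega>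
  proof -
    have "Re (log_sum N \<omega>) + b * Im (log_sum N \<omega>) = (\<Sum>p\<in>primes_le N. Re (local_log p (X p \<omega>)) + b * Im (local_log p (X p \<omega>)))"
      by (simp add: log_sum_def sum.distrib sum_distrib_left)
    also have "\<dots> \<le> (\<Sum>p\<in>primes_le N. euler_weight p + b\<^sup>2 / 2 * ((real p + 4) / (real p - 1)\<^sup>2))"
      using that by (intro sum_mono local_log_upper) (auto simp: conv_event_def dest: primes_leD)
    also have "\<dots> = (\<Sum>p\<in>primes_le N. euler_weight p) + b\<^sup>2 / 2 * (\<Sum>p\<in>primes_le N. (real p + 4) / (real p - 1)\<^sup>2)"
      by (simp only: sum.distrib sum_distrib_left)
    also have "\<dots> \<le> (euler_mascheroni + ln (ln (real N)) + C / ln (real N)) + b\<^sup>2 / 2 * (ln (ln (real N)) + C)"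
    proof (intro add_mono mult_left_mono)
      have "\<bar>(\<Sum>p\<in>primes_le N. euler_weight p) - ln (ln (real N)) - euler_mascheroni\<bar> \<le> C / ln (real N)"
        using C N unfolding mertens_bounds_def by blast
      then show "(\<Sum>p\<in>primes_le N. euler_weight p) \<le> euler_mascheroni + ln (ln (real N)) + C / ln (real N)"
        by linarith
      show "(\<Sum>p\<in>primes_le N. (real p + 4) / (real p - 1)\<^sup>2) \<le> ln (ln (real N)) + C"
        using C N unfolding mertens_bounds_def by blast
    qed auto
    finally show ?thesis by (simp add: H_def)
  qed
  \<comment> \<open>With no constraint on the \<open>X p\<close> the head event is the whole space,
    so the joint estimate for head and tail applies here too.\<close>
  let ?A = "\<lambda>_::nat. UNIV :: complex set"
  have "prob {\<omega>\<in>space M. Re (log_series \<omega>) + b * Im (log_series \<omega>) > H + u + 4 / real N} \<le>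
    prob (head_event ?A N \<inter> {\<omega>\<in>space M. 1 * Re (prime_series \<omega> - prime_sum N \<omega>) + b * Im (prime_series \<omega> - prime_sum N \<omega>) > u})"
  proof (rule finite_measure_mono_AE)
    show "head_event ?A N \<inter> {\<omega>\<in>space M. 1 * Re (prime_series \<omega> - prime_sum N \<omega>) + b * Im (prime_series \<omega> - prime_sum N \<omega>) > u} \<in> events"
      by (intro sets.Int head_measurable) auto
    show "AE \<omega> in M. \<omega> \<in> {\<omega>\<in>space M. Re (log_series \<omega>) + b * Im (log_series \<omega>) > H + u + 4 / real N} \<longrightarrow>
      \<omega> \<in> head_event ?A N \<inter> {\<omega>\<in>space M. 1 * Re (prime_series \<omega> - prime_sum N \<omega>) + b * Im (prime_series \<omega> - prime_sum N \<omega>) > u}"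
      using AE_conv_event
    proof eventually_elim
      case (elim \<omega>)
      define w where "w = (log_series \<omega> - log_sum N \<omega>) - (prime_series \<omega> - prime_sum N \<omega>)"
      have w: "cmod w \<le> 2 / real N" unfolding w_def using conv_event_log_sum(2)[OF elim, of N] N by simp
      have "\<bar>b * Im w\<bar> \<le> 1 * cmod w" unfolding abs_mult using b abs_Im_le_cmod[of w] by (intro mult_mono) auto
      then have "Re w + b * Im w \<le> 4 / real N" using w abs_Re_le_cmod[of w] by linarith
      moreover have "Re (log_series \<omega>) + b * Im (log_series \<omega>) = (Re (log_sum N \<omega>) + b * Im (log_sum N \<omega>)) +
        (Re (prime_series \<omega> - prime_sum N \<omega>) + b * Im (prime_series \<omega> - prime_sum N \<omega>)) + (Re w + b * Im w)"
        by (simp add: w_def algebra_simps)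
      ultimately show ?case using headH[OF elim] by (auto simp: head_event_def)
    qed
  qed
  also have "\<dots> \<le> prob (head_event ?A N) * exp (- u\<^sup>2 / (2 * (1\<^sup>2 + b\<^sup>2) * V))"
    by (rule prob_head_series_tail) (use u V in \<open>auto intro: add_pos_nonneg\<close>)
  also have "\<dots> \<le> 1 * exp (- u\<^sup>2 / (2 * (1\<^sup>2 + b\<^sup>2) * V))"
    by (intro mult_right_mono) auto
  also have "\<dots> \<le> exp (- (u\<^sup>2 / (2 * 2 * V)))"
    using b2 Vpos by (simp, intro divide_left_mono mult_right_mono mult_pos_pos) (auto intro: add_pos_nonneg)
  also have "u\<^sup>2 / (2 * 2 * V) = u\<^sup>2 * (real N * ln (real N)) / (4 * C)"
    unfolding V_def using C1 lnN N by simp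
  finally show ?thesis by (simp add: H_def)
qed

text \<open>On the head event the sums over \<open>p \<le> N\<close> are good deterministically.
  Four tail half-planes, each of conditional probability at most 1/8, are discarded, so half of the
  head event survives.\<close>

lemma lower_tail:
  assumes C: "mertens_bounds C" and N: "N \<ge> 2" and f: "0 \<le> \<phi>" "\<phi> < \<psi>" "\<psi> \<le> 1"
  shows "((\<psi> - \<phi>) / (2 * pi)) ^ card (primes_le N) / 2 \<le>
    prob {\<omega>\<in>space M. Re (log_series \<omega>) \<ge> euler_mascheroni + ln (ln (real N)) - (C + 10) / ln (real N) - \<psi>\<^sup>2 / 2 * (ln (ln (real N)) + C)
      \<and> Im (log_series \<omega>) \<ge> sin \<phi> * (ln (ln (real N)) - C) - 10 / ln (real N)}" (is "_ \<le> prob ?E")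
proof -
  let ?l = "ln (ln (real N))"
  \<comment> \<open>Against the crude variance bound \<open>1 / N\<close> this deviation gives
    \<open>exp (- 9 / 2)\<close>, which is below 1/8.\<close>
  define e where "e = 3 / sqrt (real N)"
  define A where "A p = cis ` {\<phi>..\<psi>}" for p :: nat
  have A: "A p \<in> sets borel" for p
    unfolding A_def by (intro borel_compact compact_continuous_image continuous_intros) auto
  have lnN: "ln (real N) > 0" using N by simp
  have sN: "sqrt (real N) \<ge> 1" using N by simp
  have epos: "e > 0" unfolding e_def using sN by simp
  have e2: "e\<^sup>2 * real N = 9" unfolding e_def using N by (simp add: power_divide)
  have pi: "1 < pi" using pi_gt3 by simp
  \<comment> \<open>The tail error is of order \<open>1 / sqrt N\<close>; it is weakened to
    \<open>1 / ln N\<close>, the order of the Mertens error.\<close>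
  have e_small: "e + 2 / real N \<le> 10 / ln (real N)"
  proof -
    have "ln (sqrt (real N)) \<le> sqrt (real N) - 1" using N by (intro ln_le_minus_one) auto
    then have "ln (real N) \<le> 2 * sqrt (real N)" using N by (simp add: ln_sqrt)
    then have "1 / sqrt (real N) \<le> 2 / ln (real N)" using lnN sN by (simp add: field_simps)
    moreover have "1 / real N \<le> 1 / sqrt (real N)"
    proof -
      have "sqrt (real N) * 1 \<le> sqrt (real N) * sqrt (real N)" using sN by (intro mult_left_mono) auto
      then have "sqrt (real N) \<le> real N" by simp
      then show ?thesis using sN by (intro divide_left_mono) auto
    qed
    moreover have "e = 3 * (1 / sqrt (real N))" "2 / real N = 2 * (1 / real N)" "10 / ln (real N) = 5 * (2 / ln (real N))"
      by (simp_all add: e_def)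
    ultimately show ?thesis by linarith
  qed
  let ?B = "\<lambda>a b. {\<omega>\<in>space M. a * Re (prime_series \<omega> - prime_sum N \<omega>) + b * Im (prime_series \<omega> - prime_sum N \<omega>) > e}"
  have half: "prob (head_event A N \<inter> ?B a b) \<le> prob (head_event A N) * (1 / 8)" if "a\<^sup>2 + b\<^sup>2 = 1" for a b
  proof -
    have "prob (head_event A N \<inter> ?B a b) \<le> prob (head_event A N) * exp (- e\<^sup>2 / (2 * (a\<^sup>2 + b\<^sup>2) * (1 / real N)))"
      by (rule prob_head_series_tail) (use A epos that sum_primes_between_inverse_square[of N] N in auto)
    also have "- e\<^sup>2 / (2 * (a\<^sup>2 + b\<^sup>2) * (1 / real N)) = - (9 / 2)"
      unfolding that using e2 by simp
    also have "exp (- (9 / 2 :: real)) \<le> 1 / 8"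
    proof -
      have "1 + 9 / 2 + (9 / 2)\<^sup>2 / 2 \<le> exp (9 / 2 :: real)" by (rule exp_lower_Taylor_quadratic) simp
      then have "8 \<le> exp (9 / 2 :: real)" by (simp add: power2_eq_square)
      then show ?thesis by (simp add: exp_minus field_simps)
    qed
    finally show ?thesis by (simp add: mult_left_mono)
  qed
  have hm: "head_event A N \<in> events" using A by (rule head_measurable)
  have bm: "?B a b \<in> events" for a b by measurable
  have "prob (head_event A N) \<le> prob (?E \<union> ((head_event A N \<inter> ?B 1 0 \<union> head_event A N \<inter> ?B (-1) 0) \<union> (head_event A N \<inter> ?B 0 1 \<union> head_event A N \<inter> ?B 0 (-1))))"
  proof (rule finite_measure_mono_AE)
    show "AE \<omega> in M. \<omega> \<in> head_event A N \<longrightarrow>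
      \<omega> \<in> ?E \<union> ((head_event A N \<inter> ?B 1 0 \<union> head_event A N \<inter> ?B (-1) 0) \<union> (head_event A N \<inter> ?B 0 1 \<union> head_event A N \<inter> ?B 0 (-1)))"
      using AE_conv_event
    proof eventually_elim
      case (elim \<omega>)
      define w where "w = (log_series \<omega> - log_sum N \<omega>) - (prime_series \<omega> - prime_sum N \<omega>)"
      have w: "cmod w \<le> 2 / real N" unfolding w_def using conv_event_log_sum(2)[OF elim, of N] N by simp
      show ?case
      proof (intro impI, rule ccontr)
        assume h: "\<omega> \<in> head_event A N" and n: "\<not> \<omega> \<in> ?E \<union> ((head_event A N \<inter> ?B 1 0 \<union> head_event A N \<inter> ?B (-1) 0) \<union> (head_event A N \<inter> ?B 0 1 \<union> head_event A N \<inter> ?B 0 (-1)))"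
        have sp: "\<omega> \<in> space M" using h by (simp add: head_event_def)
        have re: "Re (prime_series \<omega> - prime_sum N \<omega>) \<ge> - e" and im: "Im (prime_series \<omega> - prime_sum N \<omega>) \<ge> - e"
          using n h sp by auto
        have loc: "euler_weight p - \<psi>\<^sup>2 / 2 * ((real p + 4) / (real p - 1)\<^sup>2) \<le> Re (local_log p (X p \<omega>))"
          "sin \<phi> * (1 / real p - 1 / real p ^ 3) \<le> Im (local_log p (X p \<omega>))" if "p \<in> primes_le N" for p
        proof -
          have "X p \<omega> \<in> cis ` {\<phi>..\<psi>}" using h that by (auto simp: head_event_def A_def)
          then obtain \<alpha> where "\<phi> \<le> \<alpha>" "\<alpha> \<le> \<psi>" "X p \<omega> = cis \<alpha>" by auto
          then show "euler_weight p - \<psi>\<^sup>2 / 2 * ((real p + 4) / (real p - 1)\<^sup>2) \<le> Re (local_log p (X p \<omega>))"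
            "sin \<phi> * (1 / real p - 1 / real p ^ 3) \<le> Im (local_log p (X p \<omega>))"
            using local_log_lower[OF primes_leD(3)[OF that] f(1) _ _ f(3)] by auto
        qed
        have "Re (log_sum N \<omega>) \<ge> (\<Sum>p\<in>primes_le N. euler_weight p - \<psi>\<^sup>2 / 2 * ((real p + 4) / (real p - 1)\<^sup>2))"
          unfolding log_sum_def Re_sum by (intro sum_mono loc)
        moreover have "(\<Sum>p\<in>primes_le N. euler_weight p - \<psi>\<^sup>2 / 2 * ((real p + 4) / (real p - 1)\<^sup>2)) =
          (\<Sum>p\<in>primes_le N. euler_weight p) - \<psi>\<^sup>2 / 2 * (\<Sum>p\<in>primes_le N. (real p + 4) / (real p - 1)\<^sup>2)"
          by (simp only: sum_subtractf sum_distrib_left)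
        moreover have "\<psi>\<^sup>2 / 2 * (\<Sum>p\<in>primes_le N. (real p + 4) / (real p - 1)\<^sup>2) \<le> \<psi>\<^sup>2 / 2 * (?l + C)"
          using C N unfolding mertens_bounds_def by (intro mult_left_mono) auto
        moreover have "\<bar>(\<Sum>p\<in>primes_le N. euler_weight p) - ?l - euler_mascheroni\<bar> \<le> C / ln (real N)"
          using C N unfolding mertens_bounds_def by blast
        ultimately have ReS: "Re (log_sum N \<omega>) \<ge> euler_mascheroni + ?l - C / ln (real N) - \<psi>\<^sup>2 / 2 * (?l + C)"
          by linarith
        have "Im (log_sum N \<omega>) \<ge> (\<Sum>p\<in>primes_le N. sin \<phi> * (1 / real p - 1 / real p ^ 3))"
          unfolding log_sum_def Im_sum by (intro sum_mono loc)
        moreover have "(\<Sum>p\<in>primes_le N. sin \<phi> * (1 / real p - 1 / real p ^ 3)) = sin \<phi> * (\<Sum>p\<in>primes_le N. 1 / real p - 1 / real p ^ 3)"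
          by (simp only: sum_distrib_left)
        moreover have "sin \<phi> * (\<Sum>p\<in>primes_le N. 1 / real p - 1 / real p ^ 3) \<ge> sin \<phi> * (?l - C)"
        proof (intro mult_left_mono)
          show "?l - C \<le> (\<Sum>p\<in>primes_le N. 1 / real p - 1 / real p ^ 3)"
            using C N unfolding mertens_bounds_def by blast
          show "0 \<le> sin \<phi>" using f pi by (intro sin_ge_zero) auto
        qed
        ultimately have ImS: "Im (log_sum N \<omega>) \<ge> sin \<phi> * (?l - C)" by linarith
        have "Re (log_series \<omega>) = Re (log_sum N \<omega>) + Re (prime_series \<omega> - prime_sum N \<omega>) + Re w" "Im (log_series \<omega>) = Im (log_sum N \<omega>) + Im (prime_series \<omega> - prime_sum N \<omega>) + Im w"
          by (simp_all add: w_def)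
        moreover have "\<bar>Re w\<bar> \<le> 2 / real N" "\<bar>Im w\<bar> \<le> 2 / real N"
          using w abs_Re_le_cmod[of w] abs_Im_le_cmod[of w] by linarith+
        moreover have "(C + 10) / ln (real N) = C / ln (real N) + 10 / ln (real N)" by (simp add: add_divide_distrib)
        ultimately have "\<omega> \<in> ?E" using sp ReS ImS re im e_small by auto
        then show False using n by auto
      qed
    qed
  qed (use hm bm in auto)
  also have "\<dots> \<le> prob ?E + ((prob (head_event A N \<inter> ?B 1 0) + prob (head_event A N \<inter> ?B (-1) 0)) + (prob (head_event A N \<inter> ?B 0 1) + prob (head_event A N \<inter> ?B 0 (-1))))"
    using hm bm by (intro order_trans[OF measure_Un_le] add_mono measure_Un_le order_refl) auto
  also have "\<dots> \<le> prob ?E + ((prob (head_event A N) * (1 / 8) + prob (head_event A N) * (1 / 8)) + (prob (head_event A N) * (1 / 8) + prob (head_event A N) * (1 / 8)))"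
    by (intro add_mono half) auto
  finally have "prob (head_event A N) / 2 \<le> prob ?E" by simp
  moreover have "((\<psi> - \<phi>) / (2 * pi)) ^ card (primes_le N) \<le> prob (head_event A N)"
  proof -
    have "((\<psi> - \<phi>) / (2 * pi)) ^ card (primes_le N) = (\<Prod>p\<in>primes_le N. (\<psi> - \<phi>) / (2 * pi))" by simp
    also have "\<dots> \<le> (\<Prod>p\<in>primes_le N. measure circle_uniform (A p))"
      unfolding A_def using f pi measure_circle_uniform_arc[of \<phi> \<psi>] by (intro prod_mono) auto
    also have "\<dots> = prob (head_event A N)" using A by (rule prob_head[symmetric])
    finally show ?thesis .
  qed
  ultimately show ?thesis by linarith
qed

end

section \<open>Choice of parameters\<close>

text \<open>\<open>d\<close> is the square of the slope \<open>b = \<theta> / l\<close>. On the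
  event, the functional with slope \<open>b\<close> or \<open>- b\<close> exceeds
  \<open>euler_mascheroni + l + d * l\<close>. Half of \<open>d * l\<close> is matched by
  \<open>ln Y\<close>, the other half by the quadratic gain \<open>b^2 / 2 * ln (ln N)\<close>; the
  term \<open>(3 * C + 10) * d\<close> in \<open>Y\<close> keeps the head and all allowances below
  that level.\<close>

lemma (in steinhaus) Phi_upper:
  fixes \<tau> \<theta> C :: real
  defines "l \<equiv> ln \<tau>"
  defines "d \<equiv> \<theta>\<^sup>2 / l\<^sup>2"
  defines "Y \<equiv> \<tau> * (1 + d * l / 2 - (3 * C + 10) * d)"
  assumes C: "mertens_bounds C" and l: "l \<ge> 1" and \<theta>: "\<theta> > 0"
    and d: "d * \<tau> \<ge> 1" "d \<le> 1" "d * l \<le> 1" "(3 * C + 10) * d \<le> 1 / 4"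
    and \<tau>: "\<tau> \<ge> 4" "32 * C * \<tau> \<le> exp (3 / 4 * \<tau>)"
  shows "Phi M X \<tau> \<theta> \<le> exp (- (1 / \<tau>) * exp (Y - ln (32 * C)))"
proof -
  have C1: "C \<ge> 1" using C by (simp add: mertens_bounds_def)
  define b where "b = \<theta> / l"
  have b: "b > 0" "b\<^sup>2 = d" "b * \<theta> = d * l"
    using \<theta> l by (auto simp: b_def d_def power_divide power2_eq_square)
  have b1: "\<bar>b\<bar> \<le> 1" using b d(2) by (metis abs_square_le_1)
  have dpos: "d > 0" using b by (metis zero_less_power2 less_irrefl)
  \<comment> \<open>Converts every error of size \<open>1 / \<tau>\<close> into \<open>O(d)\<close>,
    the admissible scale.\<close>
  have dinv: "1 / \<tau> \<le> d" using d(1) \<tau> by (simp add: field_simps)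
  define N where "N = nat \<lfloor>exp Y\<rfloor>"
  have "0 \<le> d * l" using dpos l by simp
  then have pos34: "3 / 4 \<le> 1 + d * l / 2 - (3 * C + 10) * d" using d(4) by linarith
  then have "\<tau> * (3 / 4) \<le> Y" unfolding Y_def using \<tau> by (intro mult_left_mono) auto
  then have Y: "3 / 4 * \<tau> \<le> Y" by simp
  have "exp Y \<ge> 1 + Y + Y\<^sup>2 / 2" using Y \<tau> by (intro exp_lower_Taylor_quadratic) auto
  moreover have "Y\<^sup>2 / 2 \<ge> 0" by simp
  ultimately have eY4: "exp Y \<ge> 4" using Y \<tau> by linarith
  have N: "real N \<le> exp Y" "exp Y \<le> real N + 1" "N \<ge> 2"
    unfolding N_def using eY4 by (auto simp: le_nat_iff le_floor_iff) 
  have Nhalf: "exp Y / 2 \<le> real N" using N(2) eY4 by linarith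
  have lnN_le: "ln (real N) \<le> Y" using N by (subst ln_exp[symmetric]) (intro ln_mono, auto)
  have "ln (exp Y / 2) \<le> ln (real N)" using Nhalf by (intro ln_mono) auto
  then have "Y - ln 2 \<le> ln (real N)" by (simp add: ln_div)
  moreover have "ln (2::real) \<le> 1" using ln_le_minus_one[of "2::real"] by simp
  ultimately have lnN: "\<tau> / 2 \<le> ln (real N)" using Y \<tau> by linarith
  have "ln (ln (real N)) \<le> ln Y" using lnN lnN_le \<tau> by (intro ln_mono) auto
  also have "ln Y \<le> l + (d * l / 2 - (3 * C + 10) * d)"
  proof -
    have pos: "1 + (d * l / 2 - (3 * C + 10) * d) > 0" using pos34 by linarith
    have "ln Y = l + ln (1 + (d * l / 2 - (3 * C + 10) * d))"
      unfolding Y_def l_def using \<tau> pos unfolding l_def by (subst ln_mult_pos[symmetric]) (auto simp: algebra_simps)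
    also have "\<dots> \<le> l + (d * l / 2 - (3 * C + 10) * d)"
      using ln_le_minus_one[OF pos] by simp
    finally show ?thesis .
  qed
  finally have lnlnN: "ln (ln (real N)) \<le> l + d * l / 2 - (3 * C + 10) * d" by simp
  have "(3 * C + 10) * d \<ge> 0" using C1 dpos by simp
  then have lnlnN': "ln (ln (real N)) \<le> l + 1 / 2" using lnlnN d(3) by linarith
  have "C / ln (real N) \<le> C / (\<tau> / 2)" using lnN C1 \<tau> by (intro divide_left_mono) auto
  also have "\<dots> = 2 * C * (1 / \<tau>)" by simp
  also have "\<dots> \<le> 2 * C * d" using dinv C1 by (intro mult_left_mono) auto
  finally have t1: "C / ln (real N) \<le> 2 * C * d" .
  have "real N \<ge> \<tau> / 2" using lnN ln_le_minus_one[of "real N"] N(3) by simp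
  then have "4 / real N \<le> 4 / (\<tau> / 2)" using \<tau> by (intro divide_left_mono) auto
  also have "\<dots> = 8 * (1 / \<tau>)" by simp
  also have "\<dots> \<le> 8 * d" using dinv by (intro mult_left_mono) auto
  finally have t2: "4 / real N \<le> 8 * d" .
  have "d / 2 * (ln (ln (real N)) + C) \<le> d / 2 * (l + 1 / 2 + C)"
    using lnlnN' dpos by (intro mult_left_mono) auto
  also have "\<dots> = d * l / 2 + d / 4 + C * d / 2" by (simp add: algebra_simps)
  finally have t3: "d / 2 * (ln (ln (real N)) + C) \<le> d * l / 2 + d / 4 + C * d / 2" .
  have Cd: "C * d \<ge> 0" using C1 dpos by simp
  define H where "H = euler_mascheroni + ln (ln (real N)) + C / ln (real N) + b\<^sup>2 / 2 * (ln (ln (real N)) + C) + 1 / \<tau> + 4 / real N"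
  \<comment> \<open>The errors are \<open>2 * C * d\<close> from Mertens,
    \<open>d / 4 + C * d / 2\<close> from the slope, \<open>d\<close> from the deviation and
    \<open>8 * d\<close> from the nonlinear tail; \<open>3 * C + 10\<close> is a round number above
    their total.\<close>
  have "H \<le> euler_mascheroni + (l + d * l / 2 - (3 * C + 10) * d) + 2 * C * d + (d * l / 2 + d / 4 + C * d / 2) + d + 8 * d"
    unfolding H_def b(2) using lnlnN t1 t2 t3 dinv by linarith
  also have "\<dots> \<le> euler_mascheroni + l + d * l" using Cd dpos by (simp add: algebra_simps)
  finally have H: "H \<le> euler_mascheroni + l + b * \<theta>" using b(3) by simp
  define Q where "Q = (1 / \<tau>)\<^sup>2 * (real N * ln (real N)) / (4 * C)"
  let ?E = "\<lambda>b. {\<omega>\<in>space M. Re (log_series \<omega>) + b * Im (log_series \<omega>) > H}"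
  have up: "prob (?E b') \<le> exp (- Q)" if "b' = b \<or> b' = - b" for b'
    using upper_tail[OF C N(3), of b' "1 / \<tau>"] that b1 \<tau> unfolding H_def Q_def by auto
  have "Phi M X \<tau> \<theta> \<le> prob (?E b \<union> ?E (- b))"
    unfolding Phi_eq[OF less_le_trans[OF _ \<tau>(1), of 0, simplified]]
  proof (intro finite_measure_mono subsetI)
    fix \<omega> assume "\<omega> \<in> {\<omega> \<in> space M. euler_mascheroni + ln \<tau> < Re (log_series \<omega>) \<and> \<theta> < \<bar>Im (log_series \<omega>)\<bar>}"
    then have w: "\<omega> \<in> space M" "euler_mascheroni + l < Re (log_series \<omega>)" "\<theta> < \<bar>Im (log_series \<omega>)\<bar>" by (auto simp: l_def)
    have "b * \<theta> \<le> b * \<bar>Im (log_series \<omega>)\<bar>" using w(3) b(1) by (intro mult_left_mono) auto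
    then show "\<omega> \<in> ?E b \<union> ?E (- b)" using w H by (cases "Im (log_series \<omega>) \<ge> 0") auto
  qed measurable
  also have "\<dots> \<le> prob (?E b) + prob (?E (- b))" by (intro measure_Un_le) auto
  also have "\<dots> \<le> 2 * exp (- Q)" using up[of b] up[of "- b"] by simp
  \<comment> \<open>The factor 2, from the two signs of the argument, is absorbed by half of
    \<open>Q\<close>; \<open>32 * C * \<tau> \<le> exp (3 / 4 * \<tau>)\<close> makes
    \<open>Q\<close> large enough.\<close>
  also have "\<dots> \<le> exp (- (Q / 2))"
  proof -
    have "exp Y / 2 * (\<tau> / 2) \<le> real N * ln (real N)" using Nhalf lnN \<tau> by (intro mult_mono) auto
    then have "(1 / \<tau>)\<^sup>2 * (exp Y / 2 * (\<tau> / 2)) / (4 * C) \<le> Q"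
      unfolding Q_def using C1 by (intro divide_right_mono mult_left_mono) auto
    moreover have "(1 / \<tau>)\<^sup>2 * (exp Y / 2 * (\<tau> / 2)) / (4 * C) = exp Y / (16 * C * \<tau>)"
      using \<tau> by (simp add: power2_eq_square)
    ultimately have QY: "exp Y / (16 * C * \<tau>) \<le> Q" by simp
    have "32 * C * \<tau> \<le> exp Y" using \<tau>(2) Y by (meson exp_le_cancel_iff order_trans)
    then have "2 \<le> exp Y / (16 * C * \<tau>)" using C1 \<tau> by (simp add: field_simps)
    then have "1 \<le> Q / 2" using QY by simp
    then have "2 \<le> exp (Q / 2)" using exp_ge_add_one_self[of "Q / 2"] by linarith
    then have "2 * exp (- Q) \<le> exp (Q / 2) * exp (- Q)" by (intro mult_right_mono) auto
    then show ?thesis by (simp flip: exp_add)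
  qed
  also have "\<dots> \<le> exp (- (1 / \<tau>) * exp (Y - ln (32 * C)))"
  proof -
    have "exp Y / 2 * (\<tau> / 2) \<le> real N * ln (real N)" using Nhalf lnN \<tau> by (intro mult_mono) auto
    then have "(1 / \<tau>)\<^sup>2 * (exp Y / 2 * (\<tau> / 2)) / (4 * C) \<le> Q"
      unfolding Q_def using C1 by (intro divide_right_mono mult_left_mono) auto
    moreover have "(1 / \<tau>)\<^sup>2 * (exp Y / 2 * (\<tau> / 2)) / (4 * C) = 2 * (1 / \<tau> * (exp Y / (32 * C)))"
      using \<tau> by (simp add: power2_eq_square)
    moreover have "exp (Y - ln (32 * C)) = exp Y / (32 * C)" using C1 by (simp add: exp_diff)
    ultimately show ?thesis by simp
  qed
  finally show ?thesis .
qed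

lemma sin_ge_cubic:
  assumes "0 \<le> x" "x \<le> (1 :: real)"
  shows "x * (1 - x\<^sup>2) \<le> sin x"
proof -
  have pi: "1 < pi / 2" using pi_gt3 by simp
  have "1 - x\<^sup>2 \<le> cos x" using one_minus_cos_le[of x] zero_le_power2[of x] by linarith
  then have "x * (1 - x\<^sup>2) \<le> x * cos x" using assms by (intro mult_left_mono) auto
  also have "\<dots> \<le> sin x"
  proof (cases "x = 0")
    case False
    have c: "cos x > 0" using assms pi by (intro cos_gt_zero_pi) auto
    have "x \<le> tan x" using assms pi arctan_le_self[of "tan x"] tan_gt_zero[of x] False by (simp add: arctan_tan)
    then show ?thesis using c by (simp add: tan_def field_simps)
  qed simp
  finally show ?thesis .
qed

text \<open>\<open>K\<close> adds up the losses in the real part: \<open>\<theta>0\<^sup>2\<close>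
  from the second-order term of \<open>ln (1 + x)\<close>, \<open>C + 10\<close> from errors of size
  \<open>1 / \<tau>\<close>, and \<open>1 + C / 2 + K2\<close> from the quadratic loss at the far
  end of the arc; \<open>C / 2 + 1\<close> is left over and makes the inequality strict. Only
  positive arguments are produced.\<close>

lemma (in steinhaus) Phi_lower:
  fixes \<tau> \<theta> \<theta>0 C :: real
  defines "l \<equiv> ln \<tau>"
  defines "d \<equiv> \<theta>\<^sup>2 / l\<^sup>2"
  defines "K1 \<equiv> C + 12"
  defines "K2 \<equiv> 3 * (4 * K1 + 1)"
  defines "K \<equiv> \<theta>0\<^sup>2 + 2 * C + 12 + K2"
  defines "Y \<equiv> \<tau> * (1 + d * l / 2 + K * d)"
  assumes C: "mertens_bounds C" and \<theta>: "0 < \<theta>" "\<theta> \<le> \<theta>0"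
    and l: "l \<ge> 2 * K1" "l \<ge> 4 * K1 + 1" "l \<ge> 2 * K" "l \<ge> 4 * \<theta>0\<^sup>2" "l \<ge> 4 * \<theta>0" "l \<le> sqrt \<tau>"
    and d: "d * \<tau> \<ge> 1" and \<tau>: "\<tau> \<ge> 8"
  shows "Phi M X \<tau> \<theta> \<ge> exp (- (1 / \<tau>) * exp (Y + ln (5 * C) + ln l))"
proof -
  have C1: "C \<ge> 1" using C by (simp add: mertens_bounds_def)
  have K1: "K1 \<ge> 13" "K2 \<ge> 0" "K \<ge> 0" using C1 by (auto simp: K1_def K2_def K_def)
  have l26: "l \<ge> 26" using l(1) K1 by linarith
  have th2: "d * l\<^sup>2 = \<theta>\<^sup>2" using l26 by (simp add: d_def)
  have dpos: "d > 0" unfolding d_def using \<theta> l26 by (intro divide_pos_pos) auto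
  have t0: "\<theta>\<^sup>2 \<le> \<theta>0\<^sup>2" using \<theta> by (intro power_mono) auto
  have dl: "d * l \<le> 1 / 4"
  proof -
    have "d * l * l \<le> 1 / 4 * l" using th2 t0 l(4) by (simp add: power2_eq_square algebra_simps)
    then show ?thesis using l26 by (simp only: mult_le_cancel_right_pos)
  qed
  have dinv: "1 / \<tau> \<le> d" using d \<tau> by (simp add: field_simps)
  define x where "x = d * l / 2 + K * d"
  have x0: "0 \<le> x" using dpos l26 K1 by (simp add: x_def)
  have xdl: "x \<le> d * l" 
  proof -
    have "K * d \<le> l / 2 * d" using l(3) dpos by (intro mult_right_mono) auto
    then show ?thesis by (simp add: x_def algebra_simps)
  qed
  \<comment> \<open>\<open>d * l\<^sup>2\<close> is \<open>\<theta>\<^sup>2\<close>, so the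
    second-order error in \<open>ln (1 + x)\<close> is \<open>O(d)\<close> with a constant depending
    on \<open>\<theta>0\<close>.\<close>
  have x2: "x\<^sup>2 \<le> \<theta>0\<^sup>2 * d"
  proof -
    have "x\<^sup>2 \<le> (d * l)\<^sup>2" using x0 xdl by (intro power_mono) auto
    also have "\<dots> = d * (d * l\<^sup>2)" by (simp add: power2_eq_square algebra_simps)
    also have "\<dots> \<le> d * \<theta>0\<^sup>2" unfolding th2 using t0 dpos by (intro mult_left_mono) auto
    finally show ?thesis by (simp add: mult.commute)
  qed
  have YX: "Y = \<tau> * (1 + x)" by (simp add: Y_def x_def)
  have Y: "Y \<ge> \<tau>" unfolding YX using x0 \<tau> by (simp add: mult_le_cancel_left1)
  \<comment> \<open>Rounded up here and down in the upper bound, so that \<open>ln N\<close> errs on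
    the useful side of \<open>Y\<close>.\<close>
  define N where "N = nat \<lceil>exp Y\<rceil>"
  have eY: "exp Y \<ge> 8" using exp_ge_add_one_self[of Y] Y \<tau> by linarith
  have N: "exp Y \<le> real N" "real N \<le> exp Y + 1" unfolding N_def using eY by linarith+
  have N2: "N \<ge> 2" using N(1) eY by linarith
  have N': "real N \<le> 2 * exp Y" using N eY by linarith
  have lnN: "Y \<le> ln (real N)" using N eY by (subst ln_exp[symmetric]) (intro ln_mono, auto)
  have lnN_\<tau>: "\<tau> \<le> ln (real N)" using lnN Y by linarith
  have lnY: "ln Y = l + ln (1 + x)" unfolding YX l_def using \<tau> x0 by (subst ln_mult_pos) auto
  have "ln Y \<le> ln (ln (real N))" using lnN Y \<tau> by (intro ln_mono) auto
  moreover have "x - x\<^sup>2 \<le> ln (1 + x)" using x0 xdl dl by (intro ln_one_plus_pos_lower_bound) auto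
  ultimately have lnlnN: "l + x - x\<^sup>2 \<le> ln (ln (real N))" using lnY by linarith
  have "x\<^sup>2 \<le> x" using x0 xdl dl by (simp add: power2_eq_square mult_left_le)
  then have lnlnN_l: "l \<le> ln (ln (real N))" using lnlnN by linarith
  have lnlnN_up: "ln (ln (real N)) \<le> l + 2"
  proof -
    have "ln (real N) \<le> ln (2 * exp Y)" using N' N2 by (intro ln_mono) auto
    also have "\<dots> = ln 2 + Y" by (simp add: ln_mult_pos)
    also have "\<dots> \<le> 2 * Y" using Y \<tau> ln_le_minus_one[of "2::real"] by simp
    finally have "ln (real N) \<le> 2 * Y" .
    then have "ln (ln (real N)) \<le> ln (2 * Y)" using lnN Y \<tau> by (intro ln_mono) auto
    also have "\<dots> = ln 2 + (l + ln (1 + x))" using Y \<tau> lnY by (subst ln_mult_pos) auto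
    also have "ln (1 + x) \<le> x" using x0 by (rule ln_add_one_self_le_self)
    finally show ?thesis using ln_le_minus_one[of "2::real"] xdl dl by linarith
  qed
  \<comment> \<open>\<open>l - K1\<close> instead of \<open>l\<close> compensates the losses in the
    imaginary part: \<open>C\<close> from Mertens, 1 from the cubic term of the sine, 10 from the
    tail, and 1 to make the inequality strict.\<close>
  define \<phi> where "\<phi> = \<theta> / (l - K1)"
  define \<psi> where "\<psi> = \<phi> * (1 + 1 / l)"
  have lK: "l - K1 \<ge> l / 2" "l - K1 > 0" using l(1) l26 by auto
  have \<phi>pos: "\<phi> > 0" using \<theta> lK by (simp add: \<phi>_def)
  have \<phi>2: "\<phi> \<le> 2 * \<theta> / l"
  proof -
    have "\<phi> \<le> \<theta> / (l / 2)" unfolding \<phi>_def using \<theta> lK l26 by (intro divide_left_mono) auto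
    then show ?thesis by (simp add: mult.commute)
  qed
  have \<phi>half: "\<phi> \<le> 1 / 2"
  proof -
    have "2 * \<theta> / l \<le> 1 / 2" using l(5) \<theta> l26 by (simp add: field_simps)
    then show ?thesis using \<phi>2 by linarith
  qed
  have \<psi>1: "\<psi> \<le> 1"
  proof -
    have "\<psi> \<le> 1 / 2 * (1 + 1)" unfolding \<psi>_def using \<phi>half \<phi>pos l26 by (intro mult_mono) auto
    then show ?thesis by simp
  qed
  have \<psi>\<phi>: "\<psi> - \<phi> = \<phi> / l" by (simp add: \<psi>_def algebra_simps)
  then have \<phi>\<psi>: "\<phi> < \<psi>" using \<phi>pos l26 by (smt (verit) divide_pos_pos)
  have \<phi>ge: "\<theta> / l \<le> \<phi>" unfolding \<phi>_def using \<theta> lK K1 by (intro divide_left_mono) auto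
  have \<theta>l: "1 / sqrt \<tau> \<le> \<theta> / l"
  proof (rule power2_le_imp_le)
    show "(1 / sqrt \<tau>)\<^sup>2 \<le> (\<theta> / l)\<^sup>2" using dinv \<tau> by (simp add: power_divide d_def)
    show "0 \<le> \<theta> / l" using \<theta> l26 by simp
  qed
  have s\<tau>: "sqrt \<tau> \<ge> 1" "sqrt \<tau> * sqrt \<tau> = \<tau>" using \<tau> by auto
  have \<phi>\<tau>: "1 / \<tau> \<le> \<phi>"
  proof -
    have "sqrt \<tau> * 1 \<le> sqrt \<tau> * sqrt \<tau>" using s\<tau> by (intro mult_left_mono) auto
    then have "1 / \<tau> \<le> 1 / sqrt \<tau>" using s\<tau> \<tau> by (intro divide_left_mono) auto
    then show ?thesis using \<theta>l \<phi>ge by linarith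
  qed
  \<comment> \<open>One factor \<open>1 / sqrt \<tau>\<close> comes from
    \<open>\<theta> / l\<close>, the other from \<open>l \<le> sqrt \<tau>\<close>.\<close>
  have arc: "1 / \<tau> \<le> \<psi> - \<phi>"
  proof -
    have "1 / \<tau> = 1 / sqrt \<tau> / sqrt \<tau>" using s\<tau> by simp
    also have "\<dots> \<le> \<phi> / l" using \<theta>l \<phi>ge l(6) l26 s\<tau> \<phi>pos by (intro frac_le) auto
    finally show ?thesis using \<psi>\<phi> by simp
  qed
  \<comment> \<open>\<open>\<psi>\<close> exceeds \<open>\<theta> / l\<close> by a factor
    \<open>1 + O(1 / l)\<close>; squared and multiplied by \<open>ln (ln N)\<close>, of size
    \<open>l\<close>, the excess costs only \<open>O(d)\<close>. The 3 in \<open>K2\<close> comes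
    from \<open>(1 + a)^2 \<le> 1 + 3 * a\<close>.\<close>
  have "(\<psi> :: real)\<^sup>2 \<le> d * (1 + K2 / l)"
  proof -
    have "l / (l - K1) \<le> 1 + 2 * K1 / l"
    proof -
      have "l / (l - K1) = 1 + K1 / (l - K1)" using lK by (simp add: field_simps)
      also have "K1 / (l - K1) \<le> K1 / (l / 2)" using lK l26 K1 by (intro divide_left_mono) auto
      finally show ?thesis by (simp add: mult.commute)
    qed
    then have "l / (l - K1) * (1 + 1 / l) \<le> (1 + 2 * K1 / l) * (1 + 1 / l)"
      using l26 by (intro mult_right_mono) auto
    also have "\<dots> = 1 + (2 * K1 + 1) / l + (2 * K1 / l) * (1 / l)" by (simp add: algebra_simps add_divide_distrib)
    also have "(2 * K1 / l) * (1 / l) \<le> (2 * K1 / l) * 1" using l26 K1 by (intro mult_left_mono) auto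
    also have "1 + (2 * K1 + 1) / l + (2 * K1 / l) * 1 = 1 + (4 * K1 + 1) / l" by (simp add: add_divide_distrib)
    finally have r: "l / (l - K1) * (1 + 1 / l) \<le> 1 + (4 * K1 + 1) / l" by simp
    define a where "a = (4 * K1 + 1) / l"
    have a: "0 \<le> a" "a \<le> 1" using l(2) K1 l26 by (auto simp: a_def divide_le_eq)
    have "\<psi>\<^sup>2 = d * (l / (l - K1) * (1 + 1 / l))\<^sup>2"
      unfolding \<psi>_def \<phi>_def d_def using l26 by (simp add: power_mult_distrib power_divide)
    also have "\<dots> \<le> d * (1 + a)\<^sup>2"
      using r dpos lK l26 unfolding a_def by (intro mult_left_mono power_mono) auto
    also have "(1 + a)\<^sup>2 \<le> 1 + 3 * a" using a by (simp add: power2_eq_square algebra_simps mult_left_le)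
    also have "3 * a = K2 / l" by (simp add: a_def K2_def)
    finally show ?thesis using dpos by simp
  qed
  then have "\<psi>\<^sup>2 / 2 * (ln (ln (real N)) + C) \<le> d * (1 + K2 / l) / 2 * (l + 2 + C)"
    using lnlnN_up lnlnN_l l26 C1 dpos K1 by (intro mult_mono) auto
  also have "\<dots> = d * l / 2 + d / 2 * (2 + C + K2 + K2 * ((2 + C) / l))"
    using l26 by (simp add: field_simps)
  also have "\<dots> \<le> d * l / 2 + d / 2 * (2 + C + K2 + K2 * 1)"
    using l(1) K1 C1 l26 dpos unfolding K1_def by (intro add_left_mono mult_left_mono) (auto simp: divide_le_eq)
  finally have loss: "\<psi>\<^sup>2 / 2 * (ln (ln (real N)) + C) \<le> d * l / 2 + d * (1 + C / 2 + K2)"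
    by (simp add: algebra_simps)
  have "(C + 10) / ln (real N) \<le> (C + 10) / \<tau>" using lnN_\<tau> \<tau> C1 by (intro divide_left_mono) auto
  also have "\<dots> \<le> (C + 10) * d" using dinv C1 mult_left_mono[OF dinv, of "C + 10"] by simp
  finally have t1: "(C + 10) / ln (real N) \<le> (C + 10) * d" .
  have ReC: "ln (ln (real N)) - (C + 10) / ln (real N) - \<psi>\<^sup>2 / 2 * (ln (ln (real N)) + C) > l"
  proof -
    have "l + (d * l / 2 + K * d) - \<theta>0\<^sup>2 * d - (C + 10) * d - (d * l / 2 + d * (1 + C / 2 + K2)) \<le>
      ln (ln (real N)) - (C + 10) / ln (real N) - \<psi>\<^sup>2 / 2 * (ln (ln (real N)) + C)"
      using lnlnN x2 t1 loss unfolding x_def by linarith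
    moreover have "l + (d * l / 2 + K * d) - \<theta>0\<^sup>2 * d - (C + 10) * d - (d * l / 2 + d * (1 + C / 2 + K2)) = l + d * (C / 2 + 1)"
      by (simp add: K_def algebra_simps)
    moreover have "d * (C / 2 + 1) > 0" using dpos C1 by simp
    ultimately show ?thesis by linarith
  qed
  have ImC: "sin \<phi> * (ln (ln (real N)) - C) - 10 / ln (real N) > \<theta>"
  proof -
    have lC: "l - C > 0" using lK(2) by (simp add: K1_def)
    have "\<phi>\<^sup>2 * (l - C) \<le> 1"
    proof -
      have "\<phi>\<^sup>2 * (l - C) \<le> (2 * \<theta> / l)\<^sup>2 * l" using \<phi>2 \<phi>pos C1 l26 lC by (intro mult_mono power_mono) auto
      also have "\<dots> = 4 * (d * l)" using l26 by (simp add: d_def power_divide power_mult_distrib)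
      also have "\<dots> \<le> 1" using dl by simp
      finally show ?thesis .
    qed
    then have "\<phi> * (\<phi>\<^sup>2 * (l - C)) \<le> \<phi> * 1" using \<phi>pos by (intro mult_left_mono) auto
    then have "\<phi> * (l - C) - \<phi> \<le> \<phi> * (1 - \<phi>\<^sup>2) * (l - C)" by (simp add: algebra_simps)
    also have "\<dots> \<le> sin \<phi> * (l - C)" using sin_ge_cubic[of \<phi>] \<phi>pos \<phi>half lC by (intro mult_right_mono) auto
    also have "\<dots> \<le> sin \<phi> * (ln (ln (real N)) - C)"
      using lnlnN_l \<phi>pos \<phi>half pi_gt3 by (intro mult_left_mono sin_ge_zero) auto
    finally have 1: "\<phi> * (l - C) - \<phi> \<le> sin \<phi> * (ln (ln (real N)) - C)" .
    have "10 / ln (real N) \<le> 10 / \<tau>" using lnN_\<tau> \<tau> by (intro divide_left_mono) auto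
    also have "\<dots> \<le> 10 * \<phi>" using \<phi>\<tau> by simp
    finally have 2: "10 / ln (real N) \<le> 10 * \<phi>" .
    have "\<phi> * (l - K1) = \<theta>" using lK by (simp add: \<phi>_def)
    then have "\<phi> * (l - C) - \<phi> - 10 * \<phi> = \<theta> + \<phi>" by (simp add: K1_def algebra_simps)
    then show ?thesis using 1 2 \<phi>pos by linarith
  qed
  let ?E = "{\<omega>\<in>space M. Re (log_series \<omega>) \<ge> euler_mascheroni + ln (ln (real N)) - (C + 10) / ln (real N) - \<psi>\<^sup>2 / 2 * (ln (ln (real N)) + C)
      \<and> Im (log_series \<omega>) \<ge> sin \<phi> * (ln (ln (real N)) - C) - 10 / ln (real N)}"
  have "((\<psi> - \<phi>) / (2 * pi)) ^ card (primes_le N) / 2 \<le> prob ?E"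
    using lower_tail[OF C N2 less_imp_le[OF \<phi>pos] \<phi>\<psi> \<psi>1] .
  also have "\<dots> \<le> Phi M X \<tau> \<theta>"
    unfolding Phi_eq[OF less_le_trans[OF _ \<tau>, of 0, simplified]]
    using ReC ImC unfolding l_def by (intro finite_measure_mono) auto
  finally have 1: "((\<psi> - \<phi>) / (2 * pi)) ^ card (primes_le N) / 2 \<le> Phi M X \<tau> \<theta>" .
  define n where "n = card (primes_le N)"
  have nle: "real n \<le> 2 * C * exp Y / \<tau>"
  proof -
    have "real n \<le> C * real N / ln (real N)" using C N2 unfolding mertens_bounds_def n_def by blast
    also have "\<dots> \<le> C * (2 * exp Y) / \<tau>" using N' lnN_\<tau> \<tau> C1 by (intro frac_le mult_left_mono) auto
    finally show ?thesis by (simp add: mult_ac)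
  qed
  \<comment> \<open>Each arc has probability at least \<open>1 / \<tau>^2\<close>: one factor for
    its length, one for \<open>2 * pi \<le> 8 \<le> \<tau>\<close>.\<close>
  have "exp (- l) = 1 / \<tau>" unfolding l_def using \<tau> by (simp add: exp_minus inverse_eq_divide)
  moreover have "exp (- (2 * l)) = exp (- l) * exp (- l)" by (simp flip: exp_add)
  ultimately have "exp (- (2 * l)) = 1 / \<tau> * (1 / \<tau>)" by simp
  also have "\<dots> \<le> (\<psi> - \<phi>) * (1 / (2 * pi))"
    using arc \<tau> pi_less_4 \<phi>\<psi> by (intro mult_mono divide_left_mono) auto
  finally have "exp (- (2 * l)) ^ n \<le> ((\<psi> - \<phi>) / (2 * pi)) ^ n" by (intro power_mono) auto
  then have 2: "exp (- (2 * l) * real n) \<le> ((\<psi> - \<phi>) / (2 * pi)) ^ n"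
    by (simp add: exp_of_nat_mult[symmetric] mult.commute)
  \<comment> \<open>Four of the five come from \<open>2 * l\<close> times the bound on
    \<open>n\<close>; the fifth provides \<open>exp (- 1) \<le> 1 / 2\<close> for the lost
    half.\<close>
  have "exp (- (5 * C * l * exp Y / \<tau>)) \<le> exp (- (2 * l) * real n) / 2"
  proof -
    have "2 * l * real n \<le> 2 * l * (2 * C * exp Y / \<tau>)" using nle l26 by (intro mult_left_mono) auto
    moreover have "\<tau> \<le> exp Y" using exp_ge_add_one_self[of Y] Y by linarith
    then have "exp Y / \<tau> \<ge> 1" using \<tau> by simp
    then have "C * l * 1 \<le> C * l * (exp Y / \<tau>)" using C1 l26 by (intro mult_left_mono) auto
    moreover have "1 * 1 \<le> C * l" using C1 l26 by (intro mult_mono) auto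
    moreover have "2 * l * (2 * C * exp Y / \<tau>) = 4 * (C * l * (exp Y / \<tau>))" "5 * C * l * exp Y / \<tau> = 5 * (C * l * (exp Y / \<tau>))"
      by simp_all
    ultimately have "2 * l * real n + 1 \<le> 5 * C * l * exp Y / \<tau>" by linarith
    then have "exp (- (5 * C * l * exp Y / \<tau>)) \<le> exp (- (2 * l) * real n + - 1)" by simp
    also have "\<dots> = exp (- (2 * l) * real n) * exp (- 1)" by (rule exp_add)
    also have "\<dots> \<le> exp (- (2 * l) * real n) * (1 / 2)"
      using exp_ge_add_one_self[of 1] by (intro mult_left_mono) (auto simp: exp_minus field_simps)
    finally show ?thesis by simp
  qed
  moreover have "exp (Y + ln (5 * C) + ln l) = exp Y * (5 * C) * l"
    using C1 l26 by (simp add: exp_add)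
  ultimately show ?thesis using 1 2 unfolding n_def by (simp add: mult_ac)
qed

text \<open>The two bounds put \<open>P\<close> strictly between 0 and 1, so the double exponential
  can be inverted: \<open>E\<close> is \<open>ln (- \<tau> * ln P) - G\<close>, and monotonicity of
  \<open>ln\<close> confines it.\<close>

lemma exponent_sandwich:
  fixes P G a \<tau> :: real
  assumes "\<tau> > 0" and lo: "exp (- (1 / \<tau>) * exp (G + a)) \<le> P" and hi: "P \<le> exp (- (1 / \<tau>) * exp (G - a))"
  shows "\<exists>E. \<bar>E\<bar> \<le> a \<and> P = exp (- (1 / \<tau>) * exp (G + E))"
proof -
  have P: "P > 0" using lo by (rule less_le_trans[rotated]) simp
  have "- (1 / \<tau>) * exp (G + a) \<le> ln P" using lo P by (simp add: ln_ge_iff)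
  then have 1: "- \<tau> * ln P \<le> exp (G + a)" using assms(1) by (simp add: field_simps)
  have "ln P \<le> - (1 / \<tau>) * exp (G - a)" using hi P by (metis ln_exp ln_mono)
  then have 2: "exp (G - a) \<le> - \<tau> * ln P" using assms(1) by (simp add: field_simps)
  have pos: "- \<tau> * ln P > 0" using 2 by (rule less_le_trans[rotated]) simp
  define E where "E = ln (- \<tau> * ln P) - G"
  have "exp (G + E) = - \<tau> * ln P" using pos by (simp add: E_def)
  then have "exp (- (1 / \<tau>) * exp (G + E)) = P" using assms(1) P by simp
  moreover have "ln (- \<tau> * ln P) \<le> G + a" using 1 pos by (metis ln_exp ln_mono)
  moreover have "G - a \<le> ln (- \<tau> * ln P)" using 2 pos by (simp add: ln_ge_iff)
  ultimately show ?thesis by (intro exI[of _ E]) (auto simp: E_def)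
qed

theorem theorem3:
  fixes \<theta>0 :: real
  assumes "\<theta>0 > 0"
  shows "\<exists>C. \<exists>\<tau>0. \<forall>(M :: 'a measure) X. steinhaus_family M X \<longrightarrow>
    (\<forall>\<tau>\<ge>\<tau>0. \<forall>\<theta>. ln \<tau> * sqrt (ln (ln \<tau>) / \<tau>) < \<theta> \<and> \<theta> \<le> \<theta>0 \<longrightarrow>
      (\<exists>E. \<bar>E\<bar> \<le> C * (\<theta>\<^sup>2 * \<tau> / (ln \<tau>)\<^sup>2) \<and>
        Phi M X \<tau> \<theta> = exp (- (1 / \<tau>) * exp (\<tau> + \<theta>\<^sup>2 * \<tau> / (2 * ln \<tau>) + E))))"
proof -
  obtain C where C: "mertens_bounds C" using ex_mertens_bounds by blast
  have C1: "C \<ge> 1" using C by (simp add: mertens_bounds_def)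
  define K1 where "K1 = C + 12"
  define K2 where "K2 = 3 * (4 * K1 + 1)"
  define K where "K = \<theta>0\<^sup>2 + 2 * C + 12 + K2"
  \<comment> \<open>A sum of nonnegative terms, hence above each of the lower bounds on
    \<open>l\<close> that the choice of parameters requires.\<close>
  define L where "L = 2 * K1 + (4 * K1 + 1) + 2 * K + 4 * \<theta>0\<^sup>2 + 4 * \<theta>0 + 4 * (3 * C + 10) * \<theta>0\<^sup>2"
  \<comment> \<open>The upper bound uses \<open>3 * C + 10 + ln (32 * C)\<close>, the lower one
    \<open>K + ln (5 * C) + 1\<close>, where the 1 pays for \<open>ln l\<close>; their sum gives one
    symmetric error.\<close>
  define A where "A = 3 * C + 10 + ln (32 * C) + K + ln (5 * C) + 1"
  have "eventually (\<lambda>\<tau>::real. L \<le> ln \<tau>) at_top" by real_asymp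
  moreover have "eventually (\<lambda>\<tau>::real. 1 \<le> ln (ln \<tau>)) at_top" by real_asymp
  moreover have "eventually (\<lambda>\<tau>::real. ln \<tau> \<le> sqrt \<tau>) at_top" by real_asymp
  moreover have "eventually (\<lambda>\<tau>::real. 32 * C * \<tau> \<le> exp (3 / 4 * \<tau>)) at_top" by real_asymp
  ultimately have "eventually (\<lambda>\<tau>::real. L \<le> ln \<tau> \<and> 1 \<le> ln (ln \<tau>) \<and> ln \<tau> \<le> sqrt \<tau> \<and> 32 * C * \<tau> \<le> exp (3 / 4 * \<tau>)) at_top"
    by eventually_elim blast
  then obtain \<tau>1 where \<tau>1: "\<And>\<tau>. \<tau> \<ge> \<tau>1 \<Longrightarrow> L \<le> ln \<tau> \<and> 1 \<le> ln (ln \<tau>) \<and> ln \<tau> \<le> sqrt \<tau> \<and> 32 * C * \<tau> \<le> exp (3 / 4 * \<tau>)"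
    by (auto simp: eventually_at_top_linorder)
  have "\<exists>E. \<bar>E\<bar> \<le> A * (\<theta>\<^sup>2 * \<tau> / (ln \<tau>)\<^sup>2) \<and>
      Phi M X \<tau> \<theta> = exp (- (1 / \<tau>) * exp (\<tau> + \<theta>\<^sup>2 * \<tau> / (2 * ln \<tau>) + E))"
    if st: "steinhaus_family M X" and \<tau>: "\<tau> \<ge> max \<tau>1 8" and \<theta>: "ln \<tau> * sqrt (ln (ln \<tau>) / \<tau>) < \<theta>" "\<theta> \<le> \<theta>0"
    for M :: "'a measure" and X \<tau> \<theta>
  proof -
    interpret steinhaus M X
      using st unfolding steinhaus_family_def steinhaus_def steinhaus_axioms_def by blast
    define l where "l = ln \<tau>"
    define d where "d = \<theta>\<^sup>2 / l\<^sup>2"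
    have \<tau>8: "\<tau> \<ge> 8" using \<tau> by simp
    have ev: "L \<le> l" "1 \<le> ln l" "l \<le> sqrt \<tau>" "32 * C * \<tau> \<le> exp (3 / 4 * \<tau>)"
      using \<tau>1[of \<tau>] \<tau> by (auto simp: l_def)
    have nn: "0 \<le> 4 * (3 * C + 10) * \<theta>0\<^sup>2" "0 \<le> 4 * \<theta>0\<^sup>2" "0 \<le> K" "13 \<le> K1"
      using C1 by (auto simp: K_def K2_def K1_def)
    have lK: "l \<ge> 2 * K1" "l \<ge> 4 * K1 + 1" "l \<ge> 2 * K" "l \<ge> 4 * \<theta>0\<^sup>2" "l \<ge> 4 * \<theta>0" "l \<ge> 4 * (3 * C + 10) * \<theta>0\<^sup>2" "l \<ge> 1"
      using ev(1) nn assms unfolding L_def by linarith+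
    have m: "0 \<le> ln l / \<tau>" using ev(2) \<tau>8 by simp
    have \<theta>pos: "\<theta> > 0" using \<theta>(1) lK(7) m unfolding l_def[symmetric]
      by (meson le_less_trans mult_nonneg_nonneg order_trans real_sqrt_ge_zero zero_le_one)
    have "sqrt (ln l / \<tau>) \<le> \<theta> / l" using \<theta>(1) lK(7) unfolding l_def[symmetric] by (simp add: field_simps)
    then have "(sqrt (ln l / \<tau>))\<^sup>2 \<le> (\<theta> / l)\<^sup>2" using m by (intro power_mono) auto
    then have "ln l / \<tau> \<le> d" using m by (simp add: d_def power_divide)
    \<comment> \<open>The lower end of the range of \<open>\<theta>\<close>, squared: exactly the
      room for the \<open>ln l\<close> in the lower bound for \<open>Phi\<close>.\<close>
    then have dm: "ln l \<le> d * \<tau>" using \<tau>8 by (simp add: field_simps)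
    then have d1: "1 \<le> d * \<tau>" using ev(2) by linarith
    have dpos: "d > 0" unfolding d_def using \<theta>pos lK(7) by (intro divide_pos_pos) auto
    have "\<theta>\<^sup>2 \<le> \<theta>0\<^sup>2" using \<theta>(2) \<theta>pos by (intro power_mono) auto
    then have dl2: "d * l * l \<le> \<theta>0\<^sup>2" using lK(7) by (simp add: d_def power2_eq_square)
    have dl: "d * l \<le> 1"
    proof -
      have "d * l * l \<le> 1 * l" using dl2 lK(4) by (smt (verit) zero_le_power2)
      then show ?thesis using lK(7) by (simp only: mult_le_cancel_right_pos)
    qed
    have ddl: "d \<le> d * l" using dpos lK(7) by (simp add: mult_le_cancel_left1)
    have Kd: "(3 * C + 10) * d \<le> 1 / 4"
    proof -
      have "(3 * C + 10) * (d * l * l) \<le> (3 * C + 10) * \<theta>0\<^sup>2" using dl2 C1 by (intro mult_left_mono) auto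
      also have "\<dots> \<le> 1 / 4 * l" using lK(6) by (simp add: algebra_simps)
      finally have "((3 * C + 10) * (d * l)) * l \<le> 1 / 4 * l" by (simp add: mult_ac)
      then have "(3 * C + 10) * (d * l) \<le> 1 / 4" using lK(7) by (simp only: mult_le_cancel_right_pos)
      moreover have "(3 * C + 10) * d \<le> (3 * C + 10) * (d * l)" using ddl C1 by (intro mult_left_mono) auto
      ultimately show ?thesis by linarith
    qed
    define G where "G = \<tau> + \<theta>\<^sup>2 * \<tau> / (2 * l)"
    have G: "G = \<tau> * (1 + d * l / 2)" using lK(7) by (simp add: G_def d_def power2_eq_square field_simps)
    have "Phi M X \<tau> \<theta> \<le> exp (- (1 / \<tau>) * exp (\<tau> * (1 + d * l / 2 - (3 * C + 10) * d) - ln (32 * C)))"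
      unfolding d_def l_def
      by (rule Phi_upper[OF C])
        (use lK \<theta>pos d1 dl ddl Kd \<tau>8 ev(4) in \<open>auto simp flip: l_def d_def\<close>)
    also have "\<dots> \<le> exp (- (1 / \<tau>) * exp (G - A * (d * \<tau>)))"
    proof -
      have "ln (32 * C) * 1 \<le> ln (32 * C) * (d * \<tau>)" using d1 C1 by (intro mult_left_mono) auto
      moreover have "0 \<le> (K + ln (5 * C) + 1) * (d * \<tau>)"
        using d1 C1 nn by (intro mult_nonneg_nonneg[of _ "d * \<tau>"] add_nonneg_nonneg) auto
      ultimately have "G - A * (d * \<tau>) \<le> \<tau> * (1 + d * l / 2 - (3 * C + 10) * d) - ln (32 * C)"
        by (simp add: A_def G algebra_simps)
      then show ?thesis using \<tau>8 by (simp add: divide_right_mono)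
    qed
    finally have hi: "Phi M X \<tau> \<theta> \<le> exp (- (1 / \<tau>) * exp (G - A * (d * \<tau>)))" .
    have "exp (- (1 / \<tau>) * exp (G + A * (d * \<tau>))) \<le>
      exp (- (1 / \<tau>) * exp (\<tau> * (1 + d * l / 2 + K * d) + ln (5 * C) + ln l))"
    proof -
      have "ln (5 * C) * 1 \<le> ln (5 * C) * (d * \<tau>)" using d1 C1 by (intro mult_left_mono) auto
      moreover have "0 \<le> (3 * C + 10 + ln (32 * C)) * (d * \<tau>)"
        using d1 C1 by (intro mult_nonneg_nonneg[of _ "d * \<tau>"] add_nonneg_nonneg) auto
      ultimately have "\<tau> * (1 + d * l / 2 + K * d) + ln (5 * C) + ln l \<le> G + A * (d * \<tau>)"
        using dm by (simp add: A_def G algebra_simps)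
      then show ?thesis using \<tau>8 by (simp add: divide_right_mono)
    qed
    also have "\<dots> \<le> Phi M X \<tau> \<theta>"
      unfolding d_def l_def K_def K2_def K1_def
      by (rule Phi_lower[OF C \<theta>pos \<theta>(2)])
        (use lK d1 \<tau>8 ev(3) in \<open>auto simp flip: l_def d_def simp: K_def K2_def K1_def\<close>)
    finally have lo: "exp (- (1 / \<tau>) * exp (G + A * (d * \<tau>))) \<le> Phi M X \<tau> \<theta>" .
    from exponent_sandwich[OF _ lo hi] \<tau>8 show ?thesis
      by (simp add: G_def d_def l_def)
  qed
  then show ?thesis by (intro exI[of _ A] exI[of _ "max \<tau>1 8"]) blast
qed

end
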